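(* Any protocol that solves the $s$-GAP problem with large constant probability requires $\Omega(sn)$ bits of communication.
   Context: The $s$-GAP problem: there are $2s$ players (and a coordinator, all communication passing through the coordinator; cost is total bits communicated). For $i=1,\dots,s$, the $i$-th of the first $s$ players receives $a^i\in\{-1,1\}^n$, and the $i$-th of the remaining $s$ players receives $b^i\in\{-1,1\}^n$, with the guarantee that $a=\sum_i a^i\in\{-1,1\}^n$, $b=\sum_ib^i\in\{-1,1\}^n$, and $\Delta(a,b)\in[-c_2\sqrt n, c_2\sqrt n]$, where $\Delta(a,b)=\sum_{j=1}^n a_jb_j$. The players must determine whether $\Delta(a,b)\ge c_1\sqrt n$ or $\Delta(a,b)\le -c_1\sqrt n$ (any output is allowed if $-c_1\sqrt n<\Delta(a,b)<c_1\sqrt n$). Here $c_1<c_2$ are constants.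
   Formalization: The claim is stated for odd s only: for even s a sum of s entries from {-1,1} is even, so no input satisfies the guarantee that a and b lie in {-1,1}^n, and the problem is solved vacuously with 0 bits. *)

theory Defs
  imports "HOL-Probability.Probability"
begin

text \<open>A deterministic protocol in the coordinator model. Players are indexed by
natural numbers; all communication goes through the coordinator, which has no input
and sees the whole transcript, so the coordinator's behaviour is a decision tree:
  Out v          -- the protocol terminates with output v;
  Send j b p     -- the coordinator sends bit b to player j, then continues with p;
  Recv j p0 p1   -- player j sends one bit c to the coordinator, who continues with
                    p1 if c is True and p0 otherwise.
Each bit costs one unit of communication.\<close>

datatype proto = Out bool | Send nat bool proto | Recv nat proto proto

text \<open>Player strategies: the bit sent by player j depends only on j's own input
and on the history of its private channel with the coordinator (a list of
(direction, bit) pairs, direction True = coordinator-to-player).\<close>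

type_synonym strategies = "nat \<Rightarrow> int list \<Rightarrow> (bool \<times> bool) list \<Rightarrow> bool"

fun run :: "proto \<Rightarrow> strategies \<Rightarrow> (nat \<Rightarrow> int list) \<Rightarrow> (nat \<Rightarrow> (bool \<times> bool) list)
             \<Rightarrow> bool \<times> nat" where
  "run (Out v) st x h = (v, 0)"
| "run (Send j b p) st x h =
     (let r = run p st x (h(j := h j @ [(True, b)])) in (fst r, Suc (snd r)))"
| "run (Recv j p0 p1) st x h =
     (if st j (x j) (h j)
      then (let r = run p1 st x (h(j := h j @ [(False, True)])) in (fst r, Suc (snd r)))
      else (let r = run p0 st x (h(j := h j @ [(False, False)])) in (fst r, Suc (snd r))))"

definition proto_output :: "proto \<times> strategies \<Rightarrow> (nat \<Rightarrow> int list) \<Rightarrow> bool" where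
  "proto_output P x = fst (run (fst P) (snd P) x (\<lambda>_. []))"

definition proto_cost :: "proto \<times> strategies \<Rightarrow> (nat \<Rightarrow> int list) \<Rightarrow> nat" where
  "proto_cost P x = snd (run (fst P) (snd P) x (\<lambda>_. []))"

text \<open>Player i (i < s) holds a^i = x i, player s + i (i < s) holds b^i = x (s + i);
players with index \<ge> 2s do not exist (empty input).\<close>

definition gap_a :: "nat \<Rightarrow> (nat \<Rightarrow> int list) \<Rightarrow> nat \<Rightarrow> int" where
  "gap_a s x k = (\<Sum>i<s. x i ! k)"

definition gap_b :: "nat \<Rightarrow> (nat \<Rightarrow> int list) \<Rightarrow> nat \<Rightarrow> int" where
  "gap_b s x k = (\<Sum>i<s. x (s + i) ! k)"

definition gap_Delta :: "nat \<Rightarrow> nat \<Rightarrow> (nat \<Rightarrow> int list) \<Rightarrow> int" where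
  "gap_Delta s n x = (\<Sum>k<n. gap_a s x k * gap_b s x k)"

definition gap_valid :: "nat \<Rightarrow> nat \<Rightarrow> real \<Rightarrow> (nat \<Rightarrow> int list) \<Rightarrow> bool" where
  "gap_valid s n c2 x \<longleftrightarrow>
     (\<forall>j < 2 * s. length (x j) = n \<and> set (x j) \<subseteq> {-1, 1}) \<and>
     (\<forall>j. j \<ge> 2 * s \<longrightarrow> x j = []) \<and>
     (\<forall>k<n. gap_a s x k \<in> {-1, 1} \<and> gap_b s x k \<in> {-1, 1}) \<and>
     \<bar>real_of_int (gap_Delta s n x)\<bar> \<le> c2 * sqrt n"

definition gap_correct :: "nat \<Rightarrow> nat \<Rightarrow> real \<Rightarrow> (nat \<Rightarrow> int list) \<Rightarrow> bool \<Rightarrow> bool" where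
  "gap_correct s n c1 x out \<longleftrightarrow>
     (real_of_int (gap_Delta s n x) \<ge> c1 * sqrt n \<longrightarrow> out) \<and>
     (real_of_int (gap_Delta s n x) \<le> - c1 * sqrt n \<longrightarrow> \<not> out)"

text \<open>A (public-coin) randomized protocol is a probability distribution over
deterministic protocols. It solves s-GAP with probability at least p if on every
valid input it is correct with probability at least p; it has cost at most C if every
deterministic protocol in its support uses at most C bits on every valid input.\<close>

definition solves_gap ::
  "nat \<Rightarrow> nat \<Rightarrow> real \<Rightarrow> real \<Rightarrow> real \<Rightarrow> (proto \<times> strategies) pmf \<Rightarrow> bool" where
  "solves_gap s n c1 c2 p R \<longleftrightarrow>
     (\<forall>x. gap_valid s n c2 x \<longrightarrow>
        measure_pmf.prob R {P. gap_correct s n c1 x (proto_output P x)} \<ge> p)"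

definition cost_bound ::
  "nat \<Rightarrow> nat \<Rightarrow> real \<Rightarrow> (proto \<times> strategies) pmf \<Rightarrow> nat \<Rightarrow> bool" where
  "cost_bound s n c2 R C \<longleftrightarrow>
     (\<forall>P \<in> set_pmf R. \<forall>x. gap_valid s n c2 x \<longrightarrow> proto_cost P x \<le> C)"

end

theory Submission
  imports Defs
begin

text \<open>
  For sets \<open>A\<close>, \<open>B\<close> of sign vectors of length \<open>m\<close> with density at least \<open>2\<^sup>-\<^sup>m\<^sup>/\<^sup>6\<^sup>4\<close>, the inner product
  \<open>v = \<langle>x, y\<rangle>\<close> on the rectangle \<open>A \<times> B\<close> has a characteristic function of Gaussian size,
  \<open>\<bar>E exp (i \<phi> v)\<bar> \<le> exp (- m sin\<^sup>2(2\<phi>) / 32)\<close>. This is a hypercontractive estimate: the kernel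
  \<open>exp (i \<phi> v)\<close> is a tensor power, and after an even power of the sum over \<open>B\<close> has been expanded, one
  coordinate contributes \<open>\<bar>cos (\<phi> \<Sum> \<plusminus>y\<^sub>j)\<bar>\<close>, which is controlled by a two-point inequality in \<open>L\<^sub>p\<close>
  with \<open>p - 1\<close> of order \<open>\<phi>\<^sup>2\<close>. Hence the distribution of \<open>v\<close> on a large rectangle is smooth at scale
  \<open>\<surd>m\<close>.

  Repeating every coordinate \<open>k\<close> times makes this scale \<open>\<surd>k\<close> times larger than the distance between
  the windows \<open>[c1 \<surd>n, c2 \<surd>n]\<close> and \<open>[- c2 \<surd>n, - c1 \<surd>n]\<close>. A large rectangle then gives nearly the same
  weight (measured with a Fejer kernel) to both windows, although its answer is right for only one of
  them, so a two-player protocol needs many rectangles, that is, \<open>\<Omega>(n)\<close> bits.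

  For \<open>2s\<close> players the columns are uniform among the balanced ones. Given the inputs of everybody
  except the players \<open>i\<close> and \<open>s + i\<close>, these two still hold uniform bits in a constant fraction of the
  blocks, namely where both are in the majority. As the pairs \<open>{i, s + i}\<close> are disjoint, one of them
  sends at most a fraction \<open>1 / s\<close> of the communication.
\<close>

section \<open>Hypercontractivity and the characteristic function on rectangles\<close>

text \<open>The characteristic function is controlled only at frequencies where
  \<open>sin (2*\<phi>)\<close> is comparable to \<open>\<phi>\<close>, so indicators of the windows
  cannot be tested directly. A Fejer kernel is nonnegative with finitely many frequencies; its
  defects are a quadratic tail, repaired by a small width \<open>1 / K\<close>, and periodicity,
  repaired by a large \<open>M\<close>. The argument closes by comparing two powers of
  \<open>k\<close>: moving the kernel from \<open>t\<close> to \<open>- t\<close> changes the weight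
  of a large rectangle by at most a fraction \<open>4096 * t / (k * K)\<close> of its size, whereas
  the total weight near \<open>t\<close> is at least a fraction
  \<open>1 / (200 * sqrt k * K)\<close>. Both carry the factor \<open>1 / K\<close>, so
  \<open>k\<close> is fixed from \<open>t\<close> alone, then \<open>K\<close> from \<open>k\<close>
  and \<open>c2 - c1\<close>, then \<open>M\<close>. That weight would normally come from a local
  limit theorem. Instead, the signs on a padding of order \<open>sqrt n\<close> coordinates shift
  the inner product by a known amount, and a pigeonhole over a grid of shifts as fine as the kernel
  yields one shift with enough weight near \<open>t\<close>.\<close>

lemma entropy_ge_square_aux:
  fixes a :: real
  assumes "0 \<le> a" "a \<le> 1"
  shows "a\<^sup>2 \<le> (1 + a) * ln (1 + a) + (1 - a) * ln (1 - a)"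
proof (cases "a = 1")
  case True
  have "ln (inverse 2) \<le> inverse 2 - (1::real)" by (rule ln_le_minus_one) simp
  hence "1 \<le> 2 * ln (2::real)" by (simp only: ln_inverse) simp
  with True show ?thesis by simp
next
  case False
  with assms have a: "0 \<le> a" "a < 1" by auto
  \<comment> \<open>\<open>g\<close> is the derivative of the \<open>f\<close> below. It vanishes at
    0 and its own derivative \<open>2*x\<^sup>2/((1+x)*(1-x))\<close> is nonnegative.\<close>
  define g where "g = (\<lambda>t::real. ln (1+t) - ln (1-t) - 2*t)"
  have g: "0 \<le> g t" if "0 \<le> t" "t < 1" for t
  proof -
    have "g 0 \<le> g t"
    proof (rule DERIV_nonneg_imp_nondecreasing[OF that(1)])
      fix x assume x: "0 \<le> x" "x \<le> t"
      have "(g has_real_derivative (1/(1+x) + 1/(1-x) - 2)) (at x)"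
        unfolding g_def using x that by (auto intro!: derivative_eq_intros simp: divide_inverse)
      moreover have "1/(1+x) + 1/(1-x) - 2 = 2*x\<^sup>2/((1+x)*(1-x))"
      proof -
        have D: "(1+x)*(1-x) \<noteq> 0" using x that by simp
        have "1/(1+x) + 1/(1-x) - 2 = (2 - 2*((1+x)*(1-x)))/((1+x)*(1-x))"
          using x that D by (simp add: add_frac_eq diff_divide_distrib)
        also have "2 - 2*((1+x)*(1-x)) = 2*x\<^sup>2" by (simp add: algebra_simps power2_eq_square)
        finally show ?thesis .
      qed
      moreover have "0 \<le> 2*x\<^sup>2/((1+x)*(1-x))" using x that by simp
      ultimately show "\<exists>y. (g has_real_derivative y) (at x) \<and> 0 \<le> y" by metis
    qed
    thus ?thesis by (simp add: g_def)
  qed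
  define f where "f = (\<lambda>t::real. (1 + t) * ln (1 + t) + (1 - t) * ln (1 - t) - t\<^sup>2)"
  have "f 0 \<le> f a"
  proof (rule DERIV_nonneg_imp_nondecreasing[OF a(1)])
    fix x assume x: "0 \<le> x" "x \<le> a"
    have ne: "1 + x \<noteq> 0" "1 - x \<noteq> 0" "0 < 1 + x" "0 < 1 - x" using x a by auto
    have "(f has_real_derivative (1 * ln (1+x) + (1/(1+x)) * (1+x) + ((-1) * ln (1-x) + (-1/(1-x)) * (1-x)) - 2*x)) (at x)"
      unfolding f_def using ne
      by (auto intro!: derivative_eq_intros simp: divide_inverse)
    hence "(f has_real_derivative g x) (at x)"
      using ne by (simp add: g_def)
    thus "\<exists>y. (f has_real_derivative y) (at x) \<and> 0 \<le> y" using g[of x] x a by auto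
  qed
  thus ?thesis by (simp add: f_def)
qed

text \<open>Pinsker's inequality for a bit of bias \<open>a\<close>: the right side is twice the
  relative entropy of this bit to a fair one.\<close>

lemma entropy_ge_square:
  fixes a :: real
  assumes "\<bar>a\<bar> \<le> 1"
  shows "a\<^sup>2 \<le> (1 + a) * ln (1 + a) + (1 - a) * ln (1 - a)"
  using entropy_ge_square_aux[of a] entropy_ge_square_aux[of "-a"] assms by (cases "0 \<le> a") auto

text \<open>Tangent at \<open>p = 1\<close> to the convex function of the exponent. It bounds power
  sums with exponent near 1 from below by an entropy.\<close>

lemma powr_ge_linear_in_exponent:
  fixes t p :: real
  assumes "0 \<le> t"
  shows "t + (p - 1) * (t * ln t) \<le> t powr p"
proof (cases "t = 0")
  case False
  with assms have t: "t > 0" by simp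
  have "t powr p = t * exp ((p - 1) * ln t)"
    using t by (simp add: powr_def algebra_simps exp_diff)
  moreover have "1 + (p - 1) * ln t \<le> exp ((p - 1) * ln t)" by (rule exp_ge_add_one_self)
  ultimately show ?thesis using t mult_left_mono[of "1 + (p - 1) * ln t" "exp ((p - 1) * ln t)" t]
    by (simp add: algebra_simps)
qed simp

text \<open>By the tangent bound the mean exceeds 1 by at least \<open>(p - 1) / 2\<close> times the
  entropy, hence by \<open>a\<^sup>2 * s / 8\<close>. The exponent on the left is at most
  \<open>5/64 * (a\<^sup>2 * s)\<close>, which leaves room to replace \<open>exp\<close> by a
  quadratic.\<close>

lemma two_point_powr_mean:
  fixes a s :: real
  assumes a: "\<bar>a\<bar> \<le> 1" and s: "0 \<le> s" "s \<le> 1"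
  defines "p \<equiv> 1 + s / 4"
  shows "exp (p * a\<^sup>2 * s / 16) \<le> ((1 + a) powr p + (1 - a) powr p) / 2"
proof -
  define X Y where "X = (1+a) * ln (1+a)" and "Y = (1-a) * ln (1-a)"
  have "1 + a + (p - 1) * X \<le> (1 + a) powr p" "1 - a + (p - 1) * Y \<le> (1 - a) powr p"
    unfolding X_def Y_def using a by (auto intro!: powr_ge_linear_in_exponent)
  moreover have "(p - 1) * a\<^sup>2 \<le> (p - 1) * (X + Y)"
    using entropy_ge_square[OF a] s by (intro mult_left_mono) (auto simp: p_def X_def Y_def)
  ultimately have 1: "1 + (p - 1) * a\<^sup>2 / 2 \<le> ((1 + a) powr p + (1 - a) powr p) / 2"
    by (simp only: add_divide_distrib distrib_left)
  define x where "x = p * a\<^sup>2 * s / 16"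
  have a1: "a\<^sup>2 \<le> 1" using a by (simp add: abs_square_le_1)
  have as: "a\<^sup>2 * s \<le> 1" "0 \<le> a\<^sup>2 * s" using a1 s mult_mono[of "a\<^sup>2" 1 s 1] by auto
  have p: "1 \<le> p" "p \<le> 5/4" using s by (auto simp: p_def)
  have x5: "x \<le> 5/64 * (a\<^sup>2 * s)"
    using mult_right_mono[OF p(2) as(2)] by (simp add: x_def algebra_simps)
  have x0: "0 \<le> x" using p s by (simp add: x_def)
  have x1: "x \<le> 5/64" using x5 as by linarith
  have "exp x \<le> 1 + x + x\<^sup>2" using x0 x1 by (intro exp_bound) auto
  also have "x\<^sup>2 \<le> x * (5/64)" using x0 x1 mult_left_mono[of x "5/64" x] by (simp add: power2_eq_square)
  also have "1 + x + x * (5/64) \<le> 1 + (a\<^sup>2 * s) / 8" using x5 x0 as by (simp add: field_simps)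
  also have "(a\<^sup>2 * s) / 8 = (p - 1) * a\<^sup>2 / 2" by (simp add: p_def)
  finally show ?thesis using 1 unfolding x_def by linarith
qed

text \<open>Without the exponentials this is Hoelder's inequality, which is nearly tight only for
  \<open>u\<close> close to \<open>v\<close>. There the factor on the left is itself about
  \<open>exp (- s / 16)\<close>; for unbalanced \<open>u\<close>, \<open>v\<close> the slack in
  Hoelder pays for the missing decay. Thus every coordinate gains the full factor
  \<open>exp (- s / 16)\<close>.\<close>

lemma two_point_norm:
  fixes u v s :: real
  assumes uv: "0 \<le> u" "0 \<le> v" and s: "0 \<le> s" "s \<le> 1"
  defines "p \<equiv> 1 + s / 4"
  shows "(u + v) * exp (- (4 * u * v / (u + v)\<^sup>2) * s / 16)
           \<le> 2 powr (1 - 1 / p) * exp (- s / 16) * (u powr p + v powr p) powr (1 / p)"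
proof (cases "u + v = 0")
  case True
  thus ?thesis by simp
next
  case False
  with uv have pos: "u + v > 0" by linarith
  define m a where "m = (u + v) / 2" and "a = (u - v) / (u + v)"
  have m: "m > 0" using pos by (simp add: m_def)
  have p: "p > 0" using s by (simp add: p_def)
  have u: "u = m * (1 + a)" and v: "v = m * (1 - a)"
    using pos by (simp_all add: m_def a_def field_simps)
  have a: "\<bar>a\<bar> \<le> 1" using uv pos by (simp add: a_def abs_le_iff field_simps)
  have uva: "4 * u * v / (u + v)\<^sup>2 = 1 - a\<^sup>2"
  proof -
    have "u + v = 2 * m" by (simp add: m_def)
    hence "4 * u * v / (u + v)\<^sup>2 = (4 * m * m * (1+a) * (1-a)) / (4 * m * m)"
      using u v by (simp add: power2_eq_square)
    also have "\<dots> = (1 + a) * (1 - a)" using m by simp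
    finally show ?thesis by (simp add: algebra_simps power2_eq_square)
  qed
  have "m * exp (a\<^sup>2 * s / 16) = (m powr p * exp (p * a\<^sup>2 * s / 16)) powr (1 / p)"
    using m p by (simp add: powr_mult powr_powr exp_powr_real)
  also have "\<dots> \<le> (m powr p * (((1 + a) powr p + (1 - a) powr p) / 2)) powr (1 / p)"
    using two_point_powr_mean[OF a s] m p unfolding p_def
    by (intro powr_mono2 mult_left_mono) auto
  also have "m powr p * (((1 + a) powr p + (1 - a) powr p) / 2) = (u powr p + v powr p) / 2"
    using a m unfolding u v by (subst (1 2) powr_mult) (auto simp: distrib_left)
  also have "((u powr p + v powr p) / 2) powr (1 / p)
      = (u powr p + v powr p) powr (1 / p) / 2 powr (1 / p)"
    by (simp add: powr_divide)
  finally have 1: "m * exp (a\<^sup>2 * s / 16) \<le> (u powr p + v powr p) powr (1 / p) / 2 powr (1 / p)" .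
  have "(u + v) * exp (- (4 * u * v / (u + v)\<^sup>2) * s / 16)
      = 2 * exp (- s / 16) * (m * exp (a\<^sup>2 * s / 16))"
    unfolding uva by (simp add: m_def algebra_simps diff_divide_distrib exp_add[symmetric])
  also have "\<dots> \<le> 2 * exp (- s / 16) * ((u powr p + v powr p) powr (1 / p) / 2 powr (1 / p))"
    using 1 by (intro mult_left_mono) auto
  also have "\<dots> = 2 powr (1 - 1 / p) * exp (- s / 16) * (u powr p + v powr p) powr (1 / p)"
    by (simp add: powr_diff)
  finally show ?thesis .
qed

text \<open>AM-GM for \<open>\<bar>cos x\<bar>\<close> and 1. The absolute value gives way to a
  trigonometric polynomial, whose weighted sum over subsets factorises.\<close>

lemma abs_cos_le: "\<bar>cos x\<bar> \<le> (3 + cos (2 * x)) / 4" for x :: real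
proof -
  have "0 \<le> (\<bar>cos x\<bar> - 1)\<^sup>2" by simp
  hence "2 * \<bar>cos x\<bar> \<le> (cos x)\<^sup>2 + 1" by (simp add: power2_eq_square algebra_simps)
  thus ?thesis by (simp add: cos_double_cos)
qed

lemma exp_neg_average_le:
  fixes X :: real
  assumes "0 \<le> X" "X \<le> 1"
  shows "(3 + exp (- X)) / 4 \<le> exp (- X / 8)"
proof -
  have "exp X * (1 - X / 2) \<ge> (1 + X) * (1 - X / 2)"
    using assms exp_ge_add_one_self[of X] by (intro mult_right_mono) auto
  moreover have "(1 + X) * (1 - X / 2) \<ge> 1"
    using assms mult_left_mono[of X 1 X] by (simp add: algebra_simps)
  ultimately have "1 \<le> exp X * (1 - X / 2)" by linarith
  hence "exp (- X) * 1 \<le> exp (- X) * (exp X * (1 - X / 2))" by (intro mult_left_mono) auto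
  hence "exp (- X) \<le> 1 - X / 2" by (simp only: mult.assoc[symmetric] exp_add[symmetric]) simp
  moreover have "1 + (- X / 8) \<le> exp (- X / 8)" by (rule exp_ge_add_one_self)
  ultimately show ?thesis by simp
qed

lemma norm_cis_combination:
  fixes u v t :: real
  assumes "0 \<le> u" "0 \<le> v"
  shows "cmod (of_real u * cis t + of_real v * cis (- t))
    \<le> (u + v) * exp (- (4 * u * v / (u + v)\<^sup>2) * (sin t)\<^sup>2 / 2)"
proof (cases "u + v = 0")
  case True
  with assms have "u = 0" "v = 0" by linarith+
  thus ?thesis by simp
next
  case False
  with assms have pos: "u + v > 0" by linarith
  define y where "y = (4 * u * v / (u + v)\<^sup>2) * (sin t)\<^sup>2"
  have "(cmod (of_real u * cis t + of_real v * cis (- t)))\<^sup>2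
      = ((u + v) * cos t)\<^sup>2 + ((u - v) * sin t)\<^sup>2"
  proof -
    have "Re (of_real u * cis t + of_real v * cis (- t)) = (u + v) * cos t"
      "Im (of_real u * cis t + of_real v * cis (- t)) = (u - v) * sin t"
      by (simp_all add: distrib_right left_diff_distrib)
    thus ?thesis by (simp only: cmod_power2)
  qed
  also have "\<dots> = (u + v)\<^sup>2 * ((cos t)\<^sup>2 + (sin t)\<^sup>2) - 4 * u * v * (sin t)\<^sup>2"
  proof -
    have "(x * c)\<^sup>2 + (y * d)\<^sup>2 = x\<^sup>2 * (c\<^sup>2 + d\<^sup>2) - (x\<^sup>2 - y\<^sup>2) * d\<^sup>2" for x y c d :: real
      by (simp add: power_mult_distrib distrib_left left_diff_distrib)
    moreover have "(u + v)\<^sup>2 - (u - v)\<^sup>2 = 4 * u * v" by (simp add: power2_sum power2_diff)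
    ultimately show ?thesis by (simp only:)
  qed
  also have "\<dots> = (u + v)\<^sup>2 - (u + v)\<^sup>2 * y" using pos by (simp add: y_def)
  also have "\<dots> = (u + v)\<^sup>2 * (1 - y)" by (simp only: right_diff_distrib mult_1_right)
  also have "\<dots> \<le> (u + v)\<^sup>2 * exp (- y)"
    using exp_ge_add_one_self[of "-y"] by (intro mult_left_mono) auto
  also have "exp (- y) = (exp (- y / 2))\<^sup>2" using exp_double[of "- y / 2"] by simp
  finally have "(cmod (of_real u * cis t + of_real v * cis (- t)))\<^sup>2 \<le> ((u + v) * exp (- y / 2))\<^sup>2"
    by (simp only: power_mult_distrib)
  hence "cmod (of_real u * cis t + of_real v * cis (- t)) \<le> (u + v) * exp (- y / 2)"
    by (rule power2_le_imp_le) (simp add: assms)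
  moreover have "- y / 2 = - (4 * u * v / (u + v)\<^sup>2) * (sin t)\<^sup>2 / 2" by (simp only: y_def mult_minus_left)
  ultimately show ?thesis by (simp only:)
qed

lemma prod_cis_scaled:
  assumes "finite A" "finite B"
  shows "(\<Prod>j\<in>A. f j * cis (t * \<epsilon> j)) * (\<Prod>j\<in>B. g j * cis (- (t * \<epsilon> j)))
    = prod f A * prod g B * cis (t * (sum \<epsilon> A - sum \<epsilon> B))"
proof -
  have "finite K \<Longrightarrow> (\<Prod>j\<in>K. cis (a * \<epsilon> j)) = cis (a * sum \<epsilon> K)" for K a
    by (induction K rule: finite_induct) (auto simp: cis_mult distrib_left)
  from this[OF assms(1), of t] this[OF assms(2), of "-t"] show ?thesis
    by (simp add: prod.distrib cis_mult right_diff_distrib mult_ac)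
qed

lemma Re_of_real_mult: "Re (of_real x * z) = x * Re z"
  by simp

lemma Re_cis_eq: "Re (cis x) = cos x"
  by simp

text \<open>One coordinate of the cube. After \<open>abs_cos_le\<close> the cosine part is the real
  part of a product over \<open>J\<close> of two-term sums, each bounded by
  \<open>norm_cis_combination\<close>. Only this quarter of the total decays, so
  \<open>exp (- X)\<close> with \<open>X = sum y J / 2\<close> survives as
  \<open>exp (- X / 8)\<close>, and only for \<open>X \<le> 1\<close>. Hence the limit on
  \<open>card J\<close>, which later limits the order of the moments.\<close>

lemma abs_cos_sum_bound:
  fixes u v \<epsilon> :: "'j \<Rightarrow> real" and \<phi> :: real
  assumes J: "finite J" and uv: "\<And>j. j \<in> J \<Longrightarrow> 0 \<le> u j" "\<And>j. j \<in> J \<Longrightarrow> 0 \<le> v j"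
    and \<epsilon>: "\<And>j. j \<in> J \<Longrightarrow> \<epsilon> j \<in> {-1, 1}" and N: "card J * (sin (2*\<phi>))\<^sup>2 \<le> 2"
  shows "(\<Sum>K\<in>Pow J. \<bar>cos (\<phi> * (sum \<epsilon> K - sum \<epsilon> (J - K)))\<bar> * (prod u K * prod v (J - K)))
    \<le> (\<Prod>j\<in>J. (u j + v j) * exp (- (4 * u j * v j / (u j + v j)\<^sup>2) * (sin (2*\<phi>))\<^sup>2 / 16))"
proof -
  define c where "c = (\<lambda>K. sum \<epsilon> K - sum \<epsilon> (J - K))"
  define m where "m = (\<lambda>K. prod u K * prod v (J - K))"
  define y where "y = (\<lambda>j. 4 * u j * v j / (u j + v j)\<^sup>2 * (sin (2*\<phi>))\<^sup>2)"
  have m0: "0 \<le> m K" if "K \<in> Pow J" for K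
    using uv that by (auto simp: m_def intro!: mult_nonneg_nonneg prod_nonneg)
  have y01: "0 \<le> y j" "y j \<le> (sin (2*\<phi>))\<^sup>2" if "j \<in> J" for j
  proof -
    have "0 \<le> (u j - v j)\<^sup>2" by simp
    hence "4 * u j * v j \<le> (u j + v j)\<^sup>2" by (simp add: power2_eq_square algebra_simps)
    hence "4 * u j * v j / (u j + v j)\<^sup>2 \<le> 1" by (simp add: divide_le_eq_1)
    moreover have "0 \<le> 4 * u j * v j / (u j + v j)\<^sup>2" using uv that by simp
    moreover have "0 \<le> (sin (2*\<phi>))\<^sup>2" by simp
    ultimately show "0 \<le> y j" "y j \<le> (sin (2*\<phi>))\<^sup>2"
      unfolding y_def using mult_nonneg_nonneg mult_left_le_one_le by metis+
  qed
  have prod_exp_scaled: "(\<Prod>j\<in>J. (u j + v j) * exp (c * y j)) = (\<Prod>j\<in>J. u j + v j) * exp (c * sum y J)" for c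
    unfolding prod.distrib sum_distrib_left exp_sum[OF J] ..
  have summ: "(\<Sum>K\<in>Pow J. m K) = (\<Prod>j\<in>J. u j + v j)"
    unfolding m_def using J by (simp add: prod_add)
  have "(\<Prod>j\<in>J. of_real (u j) * cis (2*\<phi>*\<epsilon> j) + of_real (v j) * cis (- (2*\<phi>*\<epsilon> j)))
     = (\<Sum>K\<in>Pow J. of_real (m K) * cis (2 * (\<phi> * c K)))"
    unfolding prod_add[OF J]
  proof (rule sum.cong[OF refl])
    fix K assume "K \<in> Pow J"
    hence "finite K" "finite (J - K)" using J finite_subset by auto
    from prod_cis_scaled[OF this, of "\<lambda>j. of_real (u j)" "2*\<phi>" \<epsilon> "\<lambda>j. of_real (v j)"]
    show "(\<Prod>j\<in>K. of_real (u j) * cis (2*\<phi>*\<epsilon> j)) * (\<Prod>j\<in>J-K. of_real (v j) * cis (- (2*\<phi>*\<epsilon> j)))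
        = of_real (m K) * cis (2 * (\<phi> * c K))"
      unfolding m_def c_def of_real_mult of_real_prod mult.assoc[of 2] .
  qed
  from arg_cong[OF this, of Re] have "(\<Sum>K\<in>Pow J. m K * cos (2 * (\<phi> * c K)))
      = Re (\<Prod>j\<in>J. of_real (u j) * cis (2*\<phi>*\<epsilon> j) + of_real (v j) * cis (- (2*\<phi>*\<epsilon> j)))"
    by (simp only: Re_sum Re_of_real_mult Re_cis_eq)
  also have "\<dots> \<le> (\<Prod>j\<in>J. cmod (of_real (u j) * cis (2*\<phi>*\<epsilon> j) + of_real (v j) * cis (- (2*\<phi>*\<epsilon> j))))"
    unfolding prod_norm by (rule complex_Re_le_cmod)
  also have "\<dots> \<le> (\<Prod>j\<in>J. (u j + v j) * exp (-1/2 * y j))"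
  proof (intro prod_mono conjI)
    fix j assume j: "j \<in> J"
    have "(sin (2*\<phi>*\<epsilon> j))\<^sup>2 = (sin (2*\<phi>))\<^sup>2" using \<epsilon>[OF j] by auto
    thus "cmod (of_real (u j) * cis (2*\<phi>*\<epsilon> j) + of_real (v j) * cis (- (2*\<phi>*\<epsilon> j)))
      \<le> (u j + v j) * exp (-1/2 * y j)"
      using norm_cis_combination[OF uv(1)[OF j] uv(2)[OF j], of "2*\<phi>*\<epsilon> j"] by (simp add: y_def mult.assoc)
  qed auto
  also have "\<dots> = (\<Prod>j\<in>J. u j + v j) * exp (-1/2 * sum y J)"
    by (rule prod_exp_scaled)
  finally have cosb: "(\<Sum>K\<in>Pow J. m K * cos (2 * (\<phi> * c K))) \<le> (\<Prod>j\<in>J. u j + v j) * exp (-1/2 * sum y J)" .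
  have "sum y J \<le> 2" using sum_mono[of J y "\<lambda>_. (sin (2*\<phi>))\<^sup>2"] y01 N by simp
  moreover have "0 \<le> sum y J" using y01 by (auto intro: sum_nonneg)
  ultimately have e: "(3 + exp (-1/2 * sum y J)) / 4 \<le> exp (-1/16 * sum y J)"
    using exp_neg_average_le[of "sum y J / 2"] by simp
  have "(\<Sum>K\<in>Pow J. \<bar>cos (\<phi> * c K)\<bar> * m K) \<le> (\<Sum>K\<in>Pow J. (3 + cos (2 * (\<phi> * c K))) / 4 * m K)"
    using m0 by (intro sum_mono mult_right_mono abs_cos_le) auto
  also have "\<dots> = 3 / 4 * (\<Sum>K\<in>Pow J. m K) + (\<Sum>K\<in>Pow J. m K * cos (2 * (\<phi> * c K))) / 4"
    unfolding sum_distrib_left sum_divide_distrib sum.distrib[symmetric]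
    by (intro sum.cong refl) (simp add: field_simps)
  also have "\<dots> \<le> (\<Prod>j\<in>J. u j + v j) * ((3 + exp (-1/2 * sum y J)) / 4)"
    using cosb unfolding summ by argo
  also have "\<dots> \<le> (\<Prod>j\<in>J. u j + v j) * exp (-1/16 * sum y J)"
    using e uv by (intro mult_left_mono prod_nonneg) auto
  also have "\<dots> = (\<Prod>j\<in>J. (u j + v j) * exp (-1/16 * y j))"
    by (rule prod_exp_scaled[symmetric])
  finally show ?thesis
    unfolding c_def m_def y_def by (simp only: mult_minus_left mult_minus_right minus_divide_left times_divide_eq_left mult_1_left)
qed

section \<open>Tensorisation of the two-point estimate over the cube\<close>

definition sgn_in :: "'k set \<Rightarrow> 'k \<Rightarrow> real" where
  "sgn_in S j = (if j \<in> S then -1 else 1)"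

text \<open>Sign vectors are coded by the sets of their negative coordinates. The weights
  \<open>w\<close> will be the signs with which the blocks entered before any flip.\<close>

definition bil :: "'k set \<Rightarrow> ('k \<Rightarrow> real) \<Rightarrow> 'k set \<Rightarrow> 'k set \<Rightarrow> real" where
  "bil I w S T = (\<Sum>j\<in>I. w j * sgn_in S j * sgn_in T j)"

lemma sum_Pow_insert:
  fixes f :: "'k set \<Rightarrow> 'b::comm_monoid_add"
  assumes "finite I" "k \<notin> I"
  shows "(\<Sum>S\<in>Pow (insert k I). f S) = (\<Sum>S\<in>Pow I. f S + f (insert k S))"
proof -
  have "inj_on (insert k) (Pow I)" using assms by (auto simp: inj_on_def)
  thus ?thesis unfolding Pow_insert using assms
    by (subst sum.union_disjoint) (auto simp: sum.reindex sum.distrib)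
qed

lemma bil_insert:
  assumes "finite I" "k \<notin> I" "S \<subseteq> I" "T \<subseteq> I"
  shows "bil (insert k I) w S T = bil I w S T + w k"
    "bil (insert k I) w (insert k S) T = bil I w S T - w k"
    "bil (insert k I) w S (insert k T) = bil I w S T - w k"
    "bil (insert k I) w (insert k S) (insert k T) = bil I w S T + w k"
proof -
  have *: "k \<notin> S" "k \<notin> T" using assms by auto
  have eq: "sgn_in (insert k U) j = sgn_in U j" if "j \<in> I" for U j
    using that assms by (auto simp: sgn_in_def)
  show "bil (insert k I) w S T = bil I w S T + w k"
    "bil (insert k I) w (insert k S) T = bil I w S T - w k"
    "bil (insert k I) w S (insert k T) = bil I w S T - w k"
    "bil (insert k I) w (insert k S) (insert k T) = bil I w S T + w k"
    using assms * by (simp_all add: bil_def eq) (simp_all add: sgn_in_def)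
qed

text \<open>The induction on coordinates forces distinct functions \<open>g j\<close>: splitting on
  the new coordinate \<open>k\<close> of \<open>T\<close> sends each factor to one of its two halves
  independently. \<open>K\<close> collects the factors with \<open>k \<notin> T\<close>; adding the
  two cases for \<open>k\<close> in \<open>S\<close> turns the phases into
  \<open>2 * cos (c K)\<close>. The induction hypothesis for each \<open>K\<close>, then
  \<open>abs_cos_sum_bound\<close> and \<open>two_point_norm\<close>, finish the step. The signs
  \<open>\<epsilon> j\<close> allow conjugated factors, as even moments require.\<close>

lemma multilinear_cube_bound:
  fixes g :: "'j \<Rightarrow> 'k set \<Rightarrow> real" and w :: "'k \<Rightarrow> real" and \<epsilon> :: "'j \<Rightarrow> real" and \<phi> :: real
  assumes J: "finite J" and \<epsilon>: "\<And>j. j \<in> J \<Longrightarrow> \<epsilon> j \<in> {-1, 1}"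
    and N: "card J * (sin (2*\<phi>))\<^sup>2 \<le> 2"
    and I: "finite I" and w: "\<And>k. k \<in> I \<Longrightarrow> w k \<in> {-1, 1}"
    and g: "\<And>j T. j \<in> J \<Longrightarrow> 0 \<le> g j T"
  defines "p \<equiv> 1 + (sin (2*\<phi>))\<^sup>2 / 4"
  defines "d \<equiv> 2 powr (1 - 1 / p) * exp (- (sin (2*\<phi>))\<^sup>2 / 16)"
  shows "cmod (\<Sum>S\<in>Pow I. \<Prod>j\<in>J. \<Sum>T\<in>Pow I. of_real (g j T) * cis (\<phi> * \<epsilon> j * bil I w S T))
    \<le> 2 ^ card I * (\<Prod>j\<in>J. d ^ card I * (\<Sum>T\<in>Pow I. g j T powr p) powr (1 / p))"
  using I w g
proof (induction I arbitrary: g rule: finite_induct)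
  case empty
  have "p > 0" unfolding p_def by (intro add_pos_nonneg) auto
  with empty show ?case
    by (simp add: bil_def powr_powr prod_norm[symmetric] abs_of_nonneg prod_mono)
next
  case (insert k I)
  define s where "s = (sin (2*\<phi>))\<^sup>2"
  have s: "0 \<le> s" "s \<le> 1" by (auto simp: s_def abs_square_le_1)
  have p: "p = 1 + s / 4" "p > 0" using s by (auto simp: p_def s_def intro: add_pos_nonneg)
  have d0: "d > 0" by (simp add: d_def)
  have wk: "w k \<in> {-1, 1}" using insert.prems by auto
  define h0 h1 where "h0 = (\<lambda>j. (\<Sum>T\<in>Pow I. g j T powr p) powr (1 / p))"
    and "h1 = (\<lambda>j. (\<Sum>T\<in>Pow I. g j (Set.insert k T) powr p) powr (1 / p))"
  define G0 G1 where "G0 = (\<lambda>j S. \<Sum>T\<in>Pow I. of_real (g j T) * cis (\<phi> * \<epsilon> j * bil I w S T))"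
    and "G1 = (\<lambda>j S. \<Sum>T\<in>Pow I. of_real (g j (Set.insert k T)) * cis (\<phi> * \<epsilon> j * bil I w S T))"
  define G where "G = (\<lambda>j S. \<Sum>T\<in>Pow (Set.insert k I). of_real (g j T) * cis (\<phi> * \<epsilon> j * bil (Set.insert k I) w S T))"
  define c where "c = (\<lambda>K. \<phi> * (sum \<epsilon> K - sum \<epsilon> (J - K)))"
  define Q where "Q = (\<lambda>K S. (\<Prod>j\<in>K. G0 j S) * (\<Prod>j\<in>J-K. G1 j S))"
  have cis_plus: "cis (t * (x + y)) = cis (t * y) * cis (t * x)"
    and cis_minus: "cis (t * (x - y)) = cis (- (t * y)) * cis (t * x)" for t x y
    by (simp_all add: cis_mult algebra_simps)
  have Ga: "G j S = cis (\<phi> * \<epsilon> j * w k) * G0 j S + cis (- (\<phi> * \<epsilon> j * w k)) * G1 j S"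
    and Gb: "G j (Set.insert k S) = cis (- (\<phi> * \<epsilon> j * w k)) * G0 j S + cis (\<phi> * \<epsilon> j * w k) * G1 j S"
    if "S \<in> Pow I" for j S
  proof -
    have "G j S = (\<Sum>T\<in>Pow I. of_real (g j T) * cis (\<phi> * \<epsilon> j * (bil I w S T + w k))
        + of_real (g j (Set.insert k T)) * cis (\<phi> * \<epsilon> j * (bil I w S T - w k)))"
      unfolding G_def sum_Pow_insert[OF insert.hyps] using insert.hyps that
      by (intro sum.cong) (auto simp: bil_insert)
    thus "G j S = cis (\<phi> * \<epsilon> j * w k) * G0 j S + cis (- (\<phi> * \<epsilon> j * w k)) * G1 j S"
      unfolding cis_plus cis_minus G0_def G1_def sum.distrib sum_distrib_left by (simp only: mult.left_commute)
    have "G j (Set.insert k S) = (\<Sum>T\<in>Pow I. of_real (g j T) * cis (\<phi> * \<epsilon> j * (bil I w S T - w k))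
        + of_real (g j (Set.insert k T)) * cis (\<phi> * \<epsilon> j * (bil I w S T + w k)))"
      unfolding G_def sum_Pow_insert[OF insert.hyps] using insert.hyps that
      by (intro sum.cong) (auto simp: bil_insert)
    thus "G j (Set.insert k S) = cis (- (\<phi> * \<epsilon> j * w k)) * G0 j S + cis (\<phi> * \<epsilon> j * w k) * G1 j S"
      unfolding cis_plus cis_minus G0_def G1_def sum.distrib sum_distrib_left by (simp only: mult.left_commute)
  qed
  have expand: "(\<Prod>j\<in>J. cis (t * \<epsilon> j) * G0 j S + cis (- (t * \<epsilon> j)) * G1 j S)
      = (\<Sum>K\<in>Pow J. cis (t * (sum \<epsilon> K - sum \<epsilon> (J - K))) * Q K S)" for t S
    unfolding prod_add[OF J]
  proof (rule sum.cong[OF refl])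
    fix K assume "K \<in> Pow J"
    hence "finite K" "finite (J - K)" using J finite_subset by auto
    thus "(\<Prod>j\<in>K. cis (t * \<epsilon> j) * G0 j S) * (\<Prod>j\<in>J-K. cis (- (t * \<epsilon> j)) * G1 j S)
      = cis (t * (sum \<epsilon> K - sum \<epsilon> (J - K))) * Q K S"
      using prod_cis_scaled[of K "J - K" "\<lambda>j. G0 j S" t \<epsilon> "\<lambda>j. G1 j S"]
      by (simp add: Q_def mult_ac)
  qed
  have pair: "(\<Prod>j\<in>J. G j S) + (\<Prod>j\<in>J. G j (Set.insert k S))
      = (\<Sum>K\<in>Pow J. of_real (2 * cos (c K)) * Q K S)" if "S \<in> Pow I" for S
  proof -
    have "(\<Prod>j\<in>J. G j S) = (\<Prod>j\<in>J. cis (\<phi> * w k * \<epsilon> j) * G0 j S + cis (- (\<phi> * w k * \<epsilon> j)) * G1 j S)"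
      using Ga[OF that] by (simp add: mult_ac)
    moreover have "(\<Prod>j\<in>J. G j (Set.insert k S))
        = (\<Prod>j\<in>J. cis ((- \<phi> * w k) * \<epsilon> j) * G0 j S + cis (- ((- \<phi> * w k) * \<epsilon> j)) * G1 j S)"
      using Gb[OF that] by (simp add: mult_ac)
    moreover have "cis (\<phi> * w k * x) + cis (- \<phi> * w k * x) = of_real (2 * cos (\<phi> * x))" for x
      using wk by (auto simp: complex_eq_iff)
    ultimately show ?thesis
      unfolding expand by (simp add: sum.distrib[symmetric] c_def distrib_right[symmetric])
  qed
  have Qb: "cmod (\<Sum>S\<in>Pow I. Q K S) \<le> 2 ^ card I * ((d ^ card I) ^ card J * (prod h0 K * prod h1 (J - K)))"
    if K: "K \<in> Pow J" for K
  proof -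
    define g' where "g' = (\<lambda>j T. if j \<in> K then g j T else g j (Set.insert k T))"
    have fin: "finite K" "finite (J - K)" using J K finite_subset by auto
    have split: "prod f J = prod f K * prod f (J - K)" for f :: "'j \<Rightarrow> 'z::comm_monoid_mult"
      using K J by (metis PowD mult.commute prod.subset_diff)
    have "cmod (\<Sum>S\<in>Pow I. \<Prod>j\<in>J. \<Sum>T\<in>Pow I. of_real (g' j T) * cis (\<phi> * \<epsilon> j * bil I w S T))
      \<le> 2 ^ card I * (\<Prod>j\<in>J. d ^ card I * (\<Sum>T\<in>Pow I. g' j T powr p) powr (1 / p))"
      using insert.prems by (intro insert.IH) (auto simp: g'_def)
    also have "(\<lambda>S. \<Prod>j\<in>J. \<Sum>T\<in>Pow I. of_real (g' j T) * cis (\<phi> * \<epsilon> j * bil I w S T)) = Q K"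
      unfolding split by (simp add: Q_def G0_def G1_def g'_def fun_eq_iff)
    also have "(\<Prod>j\<in>J. d ^ card I * (\<Sum>T\<in>Pow I. g' j T powr p) powr (1 / p))
        = (d ^ card I) ^ card J * (prod h0 K * prod h1 (J - K))"
      unfolding prod.distrib by (subst (2) split) (simp add: h0_def h1_def g'_def)
    finally show ?thesis .
  qed
  have "(\<Sum>S\<in>Pow (Set.insert k I). \<Prod>j\<in>J. G j S) = (\<Sum>S\<in>Pow I. \<Sum>K\<in>Pow J. of_real (2 * cos (c K)) * Q K S)"
    unfolding sum_Pow_insert[OF insert.hyps] by (intro sum.cong refl pair)
  also have "\<dots> = (\<Sum>K\<in>Pow J. of_real (2 * cos (c K)) * (\<Sum>S\<in>Pow I. Q K S))"
    by (subst sum.swap) (simp add: sum_distrib_left)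
  also have "cmod \<dots> \<le> (\<Sum>K\<in>Pow J. 2 * \<bar>cos (c K)\<bar> * cmod (\<Sum>S\<in>Pow I. Q K S))"
    by (rule order.trans[OF norm_sum]) (auto simp: norm_mult abs_mult intro!: sum_mono)
  also have "\<dots> \<le> (\<Sum>K\<in>Pow J. 2 * \<bar>cos (c K)\<bar> * (2 ^ card I * ((d ^ card I) ^ card J * (prod h0 K * prod h1 (J - K)))))"
    by (intro sum_mono mult_left_mono Qb) auto
  also have "\<dots> = 2 * 2 ^ card I * (d ^ card I) ^ card J * (\<Sum>K\<in>Pow J. \<bar>cos (c K)\<bar> * (prod h0 K * prod h1 (J - K)))"
    by (simp add: sum_distrib_left mult_ac)
  also have "\<dots> \<le> 2 * 2 ^ card I * (d ^ card I) ^ card J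
      * (\<Prod>j\<in>J. (h0 j + h1 j) * exp (- (4 * h0 j * h1 j / (h0 j + h1 j)\<^sup>2) * s / 16))"
    unfolding c_def s_def using J \<epsilon> N d0
    by (intro mult_left_mono abs_cos_sum_bound) (auto simp: h0_def h1_def)
  also have "\<dots> \<le> 2 * 2 ^ card I * (d ^ card I) ^ card J * (\<Prod>j\<in>J. d * (\<Sum>T\<in>Pow (Set.insert k I). g j T powr p) powr (1 / p))"
  proof (intro mult_left_mono prod_mono conjI)
    fix j assume j: "j \<in> J"
    have "(h0 j + h1 j) * exp (- (4 * h0 j * h1 j / (h0 j + h1 j)\<^sup>2) * s / 16)
       \<le> d * (h0 j powr p + h1 j powr p) powr (1 / p)"
      using two_point_norm[of "h0 j" "h1 j" s] s by (simp add: d_def p(1) s_def h0_def h1_def)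
    also have "h0 j powr p + h1 j powr p = (\<Sum>T\<in>Pow (Set.insert k I). g j T powr p)"
      unfolding sum_Pow_insert[OF insert.hyps] h0_def h1_def using p(2)
      by (simp add: powr_powr sum.distrib sum_nonneg)
    finally show "(h0 j + h1 j) * exp (- (4 * h0 j * h1 j / (h0 j + h1 j)\<^sup>2) * s / 16)
      \<le> d * (\<Sum>T\<in>Pow (Set.insert k I). g j T powr p) powr (1 / p)" .
  qed (use d0 in \<open>auto simp: h0_def h1_def\<close>)
  also have "\<dots> = 2 ^ card (Set.insert k I) * (\<Prod>j\<in>J. d ^ card (Set.insert k I) * (\<Sum>T\<in>Pow (Set.insert k I). g j T powr p) powr (1 / p))"
    using insert.hyps by (simp add: prod.distrib power_mult_distrib)
  finally show ?case by (simp add: G_def)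
qed

lemma power_mean_ineq:
  fixes f :: "'a \<Rightarrow> real"
  assumes "finite A" "A \<noteq> {}" and f: "\<And>x. x \<in> A \<Longrightarrow> 0 \<le> f x"
  shows "(sum f A / card A) ^ n \<le> (\<Sum>x\<in>A. f x ^ n) / card A"
proof -
  have "convex_on {0..} (\<lambda>x::real. x ^ n)"
  proof (cases "even n")
    case True
    thus ?thesis using convex_power_even convex_on_subset by blast
  qed (rule convex_power_odd)
  hence "(\<Sum>x\<in>A. (1 / card A) *\<^sub>R f x) ^ n \<le> (\<Sum>x\<in>A. (1 / card A) * f x ^ n)"
    using assms by (intro convex_on_sum[where C="{0..}"]) auto
  thus ?thesis by (simp add: sum_divide_distrib)
qed

lemma rectangle_char_bound:
  fixes w :: "'k \<Rightarrow> real" and \<phi> :: real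
  assumes I: "finite I" and w: "\<And>k. k \<in> I \<Longrightarrow> w k \<in> {-1, 1}"
    and A: "A \<subseteq> Pow I" "2 powr (card I * (1 - 1/64)) \<le> card A"
    and B: "B \<subseteq> Pow I" "2 powr (card I * (1 - 1/64)) \<le> card B"
  shows "cmod (\<Sum>S\<in>A. \<Sum>T\<in>B. cis (\<phi> * bil I w S T))
    \<le> card A * card B * exp (- (card I * (sin (2*\<phi>))\<^sup>2 / 32))"
proof -
  define s m where "s = (sin (2*\<phi>))\<^sup>2" and "m = card I"
  define a b where "a = real (card A)" and "b = real (card B)"
  define G where "G = (\<lambda>S. \<Sum>T\<in>B. cis (\<phi> * bil I w S T))"
  have ab: "a > 0" "b > 0"
  proof -
    have "0 < (2::real) powr (card I * (1 - 1/64))" by simp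
    thus "a > 0" "b > 0" using A(2) B(2) unfolding a_def b_def by linarith+
  qed
  have fin: "finite A" "finite B" using ab by (auto simp: a_def b_def intro: card_ge_0_finite)
  have ne: "A \<noteq> {}" using ab by (auto simp: a_def)
  have s01: "0 \<le> s" "s \<le> 1" by (auto simp: s_def abs_square_le_1)
  have Gsum: "cmod (\<Sum>S\<in>A. G S) \<le> (\<Sum>S\<in>A. cmod (G S))" by (rule norm_sum)
  have "(\<Sum>S\<in>A. cmod (G S)) / a \<le> b * exp (- (m * s / 32))"
  proof (cases "s = 0")
    case True
    have "cmod (G S) \<le> b" for S
      unfolding G_def b_def by (rule order.trans[OF norm_sum]) simp
    hence "(\<Sum>S\<in>A. cmod (G S)) \<le> a * b" unfolding a_def by (intro sum_bounded_above) auto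
    thus ?thesis using True ab by (simp add: field_simps)
  next
    case False
    with s01 have s: "0 < s" "s \<le> 1" by auto
    \<comment> \<open>Moments of order about \<open>1 / s\<close> are the largest that the two-point inequality permits; with them
      the density of \<open>A\<close> costs only a factor \<open>exp (O (s m / 64))\<close>.\<close>
    define r where "r = nat \<lfloor>1 / s\<rfloor>"
    have r1: "real r \<le> 1 / s" "1 / s < real r + 1" using s unfolding r_def by (simp_all add: floor_less_iff)
    have "1 \<le> 1 / s" using s by simp
    hence r2: "1 / s \<le> 2 * real r" using r1 by (cases "r = 0") auto
    have rs: "real r * s \<le> 1" "1 \<le> 2 * real r * s" using r1(1) r2 s by (simp_all add: field_simps)
    define t where "t = - (m * s / 16) + m * s / 256"
    define N where "N = 2 * r"
    have N0: "N > 0" using rs by (cases r) (auto simp: N_def)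
    \<comment> \<open>\<open>r\<close> factors equal \<open>G S\<close> and \<open>r\<close> equal
      its conjugate, so that their product is \<open>cmod (G S) ^ N\<close>.\<close>
    define \<epsilon> :: "nat \<Rightarrow> real" where "\<epsilon> = (\<lambda>j. if j < r then 1 else -1)"
    define p d where "p = 1 + s / 4" and "d = 2 powr (1 - 1 / p) * exp (- s / 16)"
    have p: "p > 0" "1 - 1 / p \<le> s / 4" "0 \<le> 1 - 1 / p" using s by (auto simp: p_def field_simps)
    have d: "d > 0" by (simp add: d_def)
    have Pow_ind: "(\<Sum>T\<in>Pow I. of_real (indicator B T) * F T) = (\<Sum>T\<in>B. F T)" for F :: "'k set \<Rightarrow> complex"
      by (rule sum.mono_neutral_cong_right) (use B(1) I in auto)
    have prodG: "(\<Prod>j<N. \<Sum>T\<in>Pow I. of_real (indicator B T) * cis (\<phi> * \<epsilon> j * bil I w S T))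
        = of_real (cmod (G S) ^ N)" for S
    proof -
      have "(\<Prod>j<N. \<Sum>T\<in>Pow I. of_real (indicator B T) * cis (\<phi> * \<epsilon> j * bil I w S T))
         = (\<Prod>j<N. if j < r then G S else cnj (G S))"
        unfolding Pow_ind by (intro prod.cong refl) (auto simp: G_def \<epsilon>_def cis_cnj)
      also have "\<dots> = (\<Prod>j<r. G S) * (\<Prod>j\<in>{r..<N}. cnj (G S))"
      proof -
        have "{..<N} \<inter> {j. j < r} = {..<r}" "{..<N} \<inter> - {j. j < r} = {r..<N}"
          by (auto simp: N_def)
        thus ?thesis by (simp add: prod.If_cases)
      qed
      also have "\<dots> = (G S * cnj (G S)) ^ r" by (simp add: N_def power_mult_distrib)
      also have "\<dots> = of_real (cmod (G S) ^ N)"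
        by (simp add: complex_norm_square[symmetric] N_def power_mult)
      finally show ?thesis .
    qed
    have "cmod (\<Sum>S\<in>Pow I. \<Prod>j<N. \<Sum>T\<in>Pow I. of_real (indicator B T) * cis (\<phi> * \<epsilon> j * bil I w S T))
       \<le> 2 ^ card I * (\<Prod>j<N. d ^ card I * (\<Sum>T\<in>Pow I. indicator B T powr p) powr (1 / p))"
      unfolding p_def d_def s_def
      by (rule multilinear_cube_bound[OF _ _ _ I w]) (use rs in \<open>auto simp: \<epsilon>_def N_def s_def indicator_def\<close>)
    moreover have "(\<Sum>T\<in>Pow I. indicator B T powr p) = b"
    proof -
      have "(\<Sum>T\<in>Pow I. indicator B T powr p) = (\<Sum>T\<in>B. 1)"
        by (rule sum.mono_neutral_cong_right) (use B(1) I in auto)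
      thus ?thesis by (simp add: b_def)
    qed
    moreover have "cmod (\<Sum>S\<in>Pow I. of_real (cmod (G S) ^ N)) = (\<Sum>S\<in>Pow I. cmod (G S) ^ N)"
      by (simp add: of_real_sum[symmetric] sum_nonneg del: of_real_sum of_real_power)
    ultimately have mom: "(\<Sum>S\<in>Pow I. cmod (G S) ^ N) \<le> 2 ^ m * (d ^ m * b powr (1 / p)) ^ N"
      unfolding prodG by (simp add: m_def)
    have "((\<Sum>S\<in>A. cmod (G S)) / a) ^ N \<le> (\<Sum>S\<in>A. cmod (G S) ^ N) / a"
      unfolding a_def using fin ne by (intro power_mean_ineq) auto
    also have "\<dots> \<le> (\<Sum>S\<in>Pow I. cmod (G S) ^ N) / a"
      using ab A(1) I by (intro divide_right_mono sum_mono2) auto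
    also have "\<dots> \<le> (2 ^ m * (d ^ m * b powr (1 / p)) ^ N) / a"
      using mom ab by (intro divide_right_mono) auto
    also have "\<dots> = (2 ^ m / a) * (d ^ m * b powr (1 / p)) ^ N" by simp
    \<comment> \<open>The density loss of \<open>A\<close> occurs once for all \<open>N\<close>
      factors; that of \<open>B\<close> occurs in each factor, but only to the power
      \<open>1 - 1 / p \<le> s / 4\<close>.\<close>
    also have "\<dots> \<le> exp (m / 64) * (b * exp t) ^ N"
    proof -
      have two: "(2::real) powr x \<le> exp x" if "0 \<le> x" for x
        using that ln_le_minus_one[of 2] mult_left_mono[of "ln 2" 1 x] by (simp add: powr_def)
      have pm: "2 ^ m = 2 powr (m * (1 - 1/64)) * (2::real) powr (m / 64)"
        by (simp add: powr_add[symmetric] powr_realpow[symmetric] field_simps)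
      have quot: "2 ^ m / x \<le> exp (m / 64)" if "2 powr (m * (1 - 1/64)) \<le> x" for x :: real
      proof -
        have "0 < (2::real) powr (m * (1 - 1/64))" by simp
        hence x0: "0 < x" using that by linarith
        have "2 ^ m \<le> x * exp (m / 64)"
          unfolding pm using that two[of "m/64"] x0 by (intro mult_mono) auto
        thus ?thesis using x0 by (simp add: pos_divide_le_eq mult.commute)
      qed
      have q1: "2 ^ m / a \<le> exp (m / 64)" using A(2) by (intro quot) (simp add: a_def m_def)
      have "d ^ m * b powr (1 / p) = b * exp (- (m * s / 16)) * (2 ^ m / b) powr (1 - 1 / p)"
      proof -
        have "d ^ m = (2 ^ m) powr (1 - 1 / p) * exp (- (m * s / 16))"
          by (simp add: d_def power_mult_distrib exp_of_nat_mult[symmetric] powr_power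
              powr_realpow[symmetric] powr_powr mult_ac)
        moreover have "b powr (1 / p) = b / b powr (1 - 1 / p)"
          using ab by (simp add: powr_diff)
        ultimately show ?thesis using ab by (simp add: powr_divide)
      qed
      also have "\<dots> \<le> b * exp (- (m * s / 16)) * exp (m * s / 256)"
      proof (intro mult_left_mono)
        have "(2 ^ m / b) powr (1 - 1 / p) \<le> exp (m / 64) powr (1 - 1 / p)"
          using B(2) p ab by (intro powr_mono2 quot) (simp_all add: b_def m_def)
        also have "\<dots> = exp (m / 64 * (1 - 1 / p))" by (simp add: exp_powr_real)
        also have "\<dots> \<le> exp (m / 64 * (s / 4))" using p by (simp only: exp_le_cancel_iff) (intro mult_left_mono, auto)
        finally show "(2 ^ m / b) powr (1 - 1 / p) \<le> exp (m * s / 256)" by simp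
      qed (use ab in auto)
      also have "\<dots> = b * exp t" by (simp only: t_def exp_add mult.assoc)
      finally have q2: "d ^ m * b powr (1 / p) \<le> b * exp t" .
      show ?thesis
        by (rule mult_mono[OF q1 power_mono[OF q2]]) (use ab d in auto)
    qed
    also have "\<dots> = b ^ N * exp (m / 64 + N * t)"
      by (simp add: power_mult_distrib exp_of_nat_mult exp_add)
    also have "\<dots> \<le> b ^ N * exp (N * (- (m * s / 32)))"
    proof (intro mult_left_mono, simp only: exp_le_cancel_iff)
      \<comment> \<open>As \<open>N * s\<close> is at least 1, everything compares with
        \<open>N * m * s\<close>, and 1/64 + 1/256 - 1/16 = -11/256 lies below -1/32.\<close>
      have "real m * 1 \<le> m * (N * s)" using rs by (intro mult_left_mono) (auto simp: N_def)
      thus "m / 64 + N * t \<le> N * (- (m * s / 32))"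
        by (simp add: t_def algebra_simps)
    qed (use ab in auto)
    also have "\<dots> = (b * exp (- (m * s / 32))) ^ N"
      by (simp only: power_mult_distrib exp_of_nat_mult)
    finally show ?thesis
      using N0 ab by (subst (asm) power_mono_iff) (auto intro!: divide_nonneg_nonneg sum_nonneg)
  qed
  hence "(\<Sum>S\<in>A. cmod (G S)) \<le> a * (b * exp (- (m * s / 32)))"
    using ab by (simp add: field_simps)
  with Gsum show ?thesis by (simp add: G_def a_def b_def m_def s_def mult_ac)
qed

section \<open>Fejer kernels\<close>

lemma abs_sin_ge_half:
  fixes y :: real
  assumes "\<bar>y\<bar> \<le> 3 / 2"
  shows "\<bar>y\<bar> / 2 \<le> \<bar>sin y\<bar>"
proof -
  have "\<bar>sin y - (\<Sum>m<3. sin_coeff m * y ^ m)\<bar> \<le> inverse (fact 3) * \<bar>y\<bar> ^ 3"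
    by (rule Maclaurin_sin_bound)
  moreover have "(\<Sum>m<3. sin_coeff m * y ^ m) = y"
    by (simp add: eval_nat_numeral sin_coeff_def)
  moreover have "inverse (fact 3) = (1 / 6 :: real)" by (simp add: eval_nat_numeral)
  ultimately have 1: "\<bar>sin y - y\<bar> \<le> 1 / 6 * \<bar>y\<bar> ^ 3" by (simp only:)
  have "\<bar>y\<bar> ^ 2 \<le> (3 / 2) ^ 2" by (rule power_mono[OF assms]) simp
  also have "(3 / 2) ^ 2 \<le> (3 :: real)" by (simp add: power2_eq_square)
  finally have "\<bar>y\<bar> * \<bar>y\<bar> ^ 2 \<le> \<bar>y\<bar> * 3" by (rule mult_left_mono) simp
  moreover have "\<bar>y\<bar> * \<bar>y\<bar> ^ 2 = \<bar>y\<bar> ^ 3" by (simp only: power3_eq_cube power2_eq_square mult.assoc)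
  ultimately have "1 / 6 * \<bar>y\<bar> ^ 3 \<le> \<bar>y\<bar> / 2" by linarith
  thus ?thesis using 1 by linarith
qed

lemma cmod_cis_diff: "cmod (cis a - cis b) = 2 * \<bar>sin ((a - b) / 2)\<bar>"
proof -
  have "(cmod (cis a - cis b))\<^sup>2 = (cos a - cos b)\<^sup>2 + (sin a - sin b)\<^sup>2"
    by (simp add: cmod_power2)
  also have "\<dots> = ((cos a)\<^sup>2 + (sin a)\<^sup>2) + ((cos b)\<^sup>2 + (sin b)\<^sup>2) - 2 * (cos a * cos b + sin a * sin b)"
    unfolding power2_diff by (simp only: algebra_simps)
  also have "\<dots> = 2 - 2 * cos (a - b)" by (simp add: cos_diff)
  also have "cos (a - b) = 1 - 2 * (sin ((a - b) / 2))\<^sup>2"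
  proof -
    have "2 * ((a - b) / 2) = a - b" by simp
    thus ?thesis using cos_double_sin[of "(a - b) / 2"] by (simp only:)
  qed
  finally have "(cmod (cis a - cis b))\<^sup>2 = (2 * \<bar>sin ((a - b) / 2)\<bar>)\<^sup>2" by (simp add: power_mult_distrib)
  thus ?thesis by (subst (asm) power2_eq_iff_nonneg) auto
qed

lemma cmod_cis_diff_le: "cmod (cis a - cis b) \<le> \<bar>a - b\<bar>"
  using abs_sin_x_le_abs_x[of "(a - b) / 2"] unfolding cmod_cis_diff by simp

text \<open>The usual Fejer kernel divided by \<open>L\<close>: for \<open>L > 0\<close> its value
  at 0 is 1. Its period is 2 pi.\<close>

definition fejer :: "nat \<Rightarrow> real \<Rightarrow> real" where
  "fejer L x = (cmod (\<Sum>l<L. cis (real l * x)) / real L)\<^sup>2"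

lemma fejer_nonneg: "0 \<le> fejer L x"
  by (simp add: fejer_def)

lemma fejer_le_1: "fejer L x \<le> 1"
proof -
  have "cmod (\<Sum>l<L. cis (real l * x)) \<le> real L"
    by (rule order.trans[OF norm_sum]) simp
  hence "cmod (\<Sum>l<L. cis (real l * x)) / real L \<le> 1"
    by (cases "L = 0") (simp_all add: divide_le_eq_1)
  thus ?thesis unfolding fejer_def by (simp add: power_le_one)
qed

lemma fejer_near_0:
  assumes "L > 0" "real L * \<bar>x\<bar> \<le> 1"
  shows "1 / 4 \<le> fejer L x"
proof -
  have "1 / 2 \<le> cos (real l * x)" if "l < L" for l
  proof -
    have "\<bar>real l * x\<bar> \<le> real L * \<bar>x\<bar>" using that by (simp add: abs_mult mult_right_mono)
    hence "\<bar>real l * x\<bar> \<le> 1" using assms by linarith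
    hence *: "\<bar>real l * x / 2\<bar> \<le> 1 / 2" by simp
    have "\<bar>sin (real l * x / 2)\<bar> \<le> 1 / 2"
      using abs_sin_x_le_abs_x[of "real l * x / 2"] * by linarith
    hence "(sin (real l * x / 2))\<^sup>2 \<le> (1 / 2)\<^sup>2" by (simp add: abs_le_square_iff[symmetric])
    thus ?thesis using cos_double_sin[of "real l * x / 2"] by (simp add: power2_eq_square)
  qed
  hence "(\<Sum>l<L. 1 / 2) \<le> (\<Sum>l<L. cos (real l * x))" by (intro sum_mono) auto
  also have "\<dots> = Re (\<Sum>l<L. cis (real l * x))" by simp
  also have "\<dots> \<le> cmod (\<Sum>l<L. cis (real l * x))" by (rule complex_Re_le_cmod)
  finally have "1 / 2 \<le> cmod (\<Sum>l<L. cis (real l * x)) / real L"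
    using assms by (simp add: field_simps)
  hence "(1 / 2)\<^sup>2 \<le> fejer L x" unfolding fejer_def by (intro power_mono) auto
  thus ?thesis by (simp add: power2_eq_square)
qed

text \<open>Geometric sum with numerator at most 2 and denominator at least
  \<open>\<bar>x\<bar> / 2\<close>. The range \<open>\<bar>x\<bar> \<le> 3\<close> stays away from
  the neighbouring peaks at distance 2 pi.\<close>

lemma fejer_decay:
  assumes "L > 0" "x \<noteq> 0" "\<bar>x\<bar> \<le> 3"
  shows "fejer L x \<le> 16 / (real L * x)\<^sup>2"
proof -
  have "\<bar>x\<bar> / 2 \<le> cmod (cis x - 1)"
    using cmod_cis_diff[of x 0] abs_sin_ge_half[of "x / 2"] assms by simp
  hence "\<bar>x\<bar> / 2 * cmod (\<Sum>l<L. cis (real l * x)) \<le> cmod (cis x - 1) * cmod (\<Sum>l<L. cis (real l * x))"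
    by (rule mult_right_mono) simp
  also have "\<dots> = cmod ((cis x - 1) * (\<Sum>l<L. cis x ^ l))"
    by (simp add: norm_mult Complex.DeMoivre)
  also have "\<dots> = cmod (cis x ^ L - 1)" by (simp add: power_diff_1_eq)
  also have "\<dots> \<le> 2" using norm_triangle_ineq4[of "cis x ^ L" 1] by (simp add: norm_power)
  finally have "cmod (\<Sum>l<L. cis (real l * x)) \<le> 4 / \<bar>x\<bar>"
    using assms by (simp add: field_simps)
  hence "cmod (\<Sum>l<L. cis (real l * x)) / real L \<le> 4 / \<bar>x\<bar> / real L" by (intro divide_right_mono) auto
  hence "fejer L x \<le> (4 / \<bar>x\<bar> / real L)\<^sup>2" unfolding fejer_def by (intro power_mono) auto
  thus ?thesis by (simp add: power_divide power_mult_distrib mult.commute)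
qed

lemma fejer_expand:
  "fejer L x = (\<Sum>l<L. \<Sum>l'<L. Re (cis ((real l - real l') * x))) / (real L)\<^sup>2"
proof -
  have "complex_of_real ((cmod (\<Sum>l<L. cis (real l * x)))\<^sup>2)
      = (\<Sum>l<L. cis (real l * x)) * cnj (\<Sum>l<L. cis (real l * x))"
    by (rule complex_norm_square)
  also have "\<dots> = (\<Sum>l<L. \<Sum>l'<L. cis (real l * x) * cis (- (real l' * x)))"
    by (simp only: sum_product cnj_sum cis_cnj)
  also have "\<dots> = (\<Sum>l<L. \<Sum>l'<L. cis ((real l - real l') * x))"
    by (simp add: cis_mult left_diff_distrib)
  finally have "(cmod (\<Sum>l<L. cis (real l * x)))\<^sup>2 = Re (\<Sum>l<L. \<Sum>l'<L. cis ((real l - real l') * x))"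
    by (metis Re_complex_of_real)
  thus ?thesis unfolding fejer_def power_divide by simp
qed

text \<open>Discrete version of integrating \<open>x * exp (- a * x\<^sup>2)\<close>, by
  telescoping: for \<open>X\<close> and \<open>Y\<close> as in the proof, \<open>X * Y \<le> (1 + a
  * l\<^sup>2)\<^sup>2 \<le> 2 * exp (a * l\<^sup>2)\<close>, so the term at \<open>l\<close> is at
  most \<open>1 / a * (1 / X - 1 / Y)\<close>.\<close>

lemma sum_linear_gaussian_le:
  fixes a :: real
  assumes "a > 0"
  shows "(\<Sum>d=1..n. real d * exp (- a * (real d)\<^sup>2)) \<le> 1 / a"
proof -
  have "(\<Sum>d=1..n. real d * exp (- a * (real d)\<^sup>2)) \<le> 1 / a * (1 - 1 / (1 + a * real n * (real n + 1)))"
  proof (induction n)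
    case (Suc n)
    define l where "l = real n + 1"
    have l: "l \<ge> 1" by (simp add: l_def)
    define X Y where "X = 1 + a * (l - 1) * l" and "Y = 1 + a * l * (l + 1)"
    have XY: "X > 0" "Y > 0" using l assms by (auto simp: X_def Y_def intro!: add_pos_nonneg)
    have al: "0 \<le> a * l\<^sup>2" using assms by simp
    have XYb: "X * Y \<le> (1 + a * l\<^sup>2)\<^sup>2"
    proof -
      have "(1 + a * l\<^sup>2)\<^sup>2 - X * Y = (a * l)\<^sup>2"
        unfolding X_def Y_def by (simp add: power2_eq_square algebra_simps)
      thus ?thesis using zero_le_power2[of "a * l"] by linarith
    qed
    have "(1 + a * l\<^sup>2)\<^sup>2 / 2 \<le> 1 + a * l\<^sup>2 + (a * l\<^sup>2)\<^sup>2 / 2"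
      by (simp add: power2_eq_square algebra_simps)
    also have "\<dots> \<le> exp (a * l\<^sup>2)" by (rule exp_lower_Taylor_quadratic[OF al])
    finally have "X * Y \<le> 2 * exp (a * l\<^sup>2)" using XYb by linarith
    hence "l * (X * Y) \<le> l * (2 * exp (a * l\<^sup>2))" using l by (intro mult_left_mono) auto
    hence "l * exp (- a * l\<^sup>2) \<le> 2 * l / (X * Y)"
      using XY by (simp add: exp_minus field_simps)
    also have "\<dots> = 1 / a * (1 / X - 1 / Y)"
    proof -
      have "1 / X - 1 / Y = (Y - X) / (X * Y)" using XY by (simp add: field_simps)
      also have "Y - X = a * (2 * l)" by (simp add: X_def Y_def algebra_simps)
      finally show ?thesis using assms by simp
    qed
    finally have "real (Suc n) * exp (- a * (real (Suc n))\<^sup>2)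
      \<le> 1 / a * (1 / (1 + a * real n * (real n + 1)) - 1 / (1 + a * real (Suc n) * (real (Suc n) + 1)))"
      by (simp add: l_def X_def Y_def add.commute)
    with Suc.IH show ?case
      unfolding sum.cl_ivl_Suc right_diff_distrib by simp
  qed simp
  also have "\<dots> \<le> 1 / a" using assms by (intro mult_left_le) auto
  finally show ?thesis .
qed

lemma sum_abs_diff_gaussian_le:
  fixes a :: real
  assumes "a > 0" "l < L"
  shows "(\<Sum>l'<L. \<bar>real l - real l'\<bar> * exp (- a * (real l - real l')\<^sup>2)) \<le> 2 / a"
proof -
  define h where "h = (\<lambda>d::nat. real d * exp (- a * (real d)\<^sup>2))"
  have h0: "0 \<le> h d" for d by (simp add: h_def)
  have part: "(\<Sum>l'\<in>M. h (f l')) \<le> 1 / a" if "inj_on f M" "f ` M \<subseteq> {1..L}" for M and f :: "nat \<Rightarrow> nat"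
  proof -
    have "(\<Sum>l'\<in>M. h (f l')) = sum h (f ` M)" using that by (simp add: sum.reindex)
    also have "\<dots> \<le> sum h {1..L}" using that h0 by (intro sum_mono2) auto
    also have "\<dots> \<le> 1 / a" unfolding h_def by (rule sum_linear_gaussian_le[OF assms(1)])
    finally show ?thesis .
  qed
  have disj: "{..<l} \<inter> {l<..<L} = {}" by auto
  have "{..<L} = insert l ({..<l} \<union> {l<..<L})" using assms by auto
  hence "(\<Sum>l'<L. \<bar>real l - real l'\<bar> * exp (- a * (real l - real l')\<^sup>2))
     = (\<Sum>l'<l. \<bar>real l - real l'\<bar> * exp (- a * (real l - real l')\<^sup>2))
     + (\<Sum>l'\<in>{l<..<L}. \<bar>real l - real l'\<bar> * exp (- a * (real l - real l')\<^sup>2))"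
    by (simp add: sum.union_disjoint[OF _ _ disj])
  also have "(\<Sum>l'<l. \<bar>real l - real l'\<bar> * exp (- a * (real l - real l')\<^sup>2)) = (\<Sum>l'<l. h (l - l'))"
    by (intro sum.cong refl) (simp add: h_def of_nat_diff)
  also have "(\<Sum>l'\<in>{l<..<L}. \<bar>real l - real l'\<bar> * exp (- a * (real l - real l')\<^sup>2)) = (\<Sum>l'\<in>{l<..<L}. h (l' - l))"
    by (intro sum.cong refl) (simp add: h_def of_nat_diff power2_commute)
  also have "(\<Sum>l'<l. h (l - l')) \<le> 1 / a" using assms by (intro part) (auto simp: inj_on_def)
  also have "(\<Sum>l'\<in>{l<..<L}. h (l' - l)) \<le> 1 / a" by (intro part) (auto simp: inj_on_def)
  finally show ?thesis by simp
qed

lemma sum_swap22: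
  "(\<Sum>x\<in>A. \<Sum>y\<in>B. \<Sum>u\<in>C. \<Sum>v\<in>D. f x y u v) = (\<Sum>u\<in>C. \<Sum>v\<in>D. \<Sum>x\<in>A. \<Sum>y\<in>B. f x y u v)"
proof -
  have "(\<Sum>x\<in>A. \<Sum>y\<in>B. \<Sum>u\<in>C. \<Sum>v\<in>D. f x y u v) = (\<Sum>x\<in>A. \<Sum>u\<in>C. \<Sum>y\<in>B. \<Sum>v\<in>D. f x y u v)"
    by (rule sum.cong[OF refl], rule sum.swap)
  also have "\<dots> = (\<Sum>u\<in>C. \<Sum>x\<in>A. \<Sum>y\<in>B. \<Sum>v\<in>D. f x y u v)" by (rule sum.swap)
  also have "\<dots> = (\<Sum>u\<in>C. \<Sum>x\<in>A. \<Sum>v\<in>D. \<Sum>y\<in>B. f x y u v)"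
    by (rule sum.cong[OF refl], rule sum.cong[OF refl], rule sum.swap)
  also have "\<dots> = (\<Sum>u\<in>C. \<Sum>v\<in>D. \<Sum>x\<in>A. \<Sum>y\<in>B. f x y u v)"
    by (rule sum.cong[OF refl], rule sum.swap)
  finally show ?thesis .
qed

text \<open>At frequency \<open>d = l - l'\<close> the two shifts differ by at most
  \<open>2 * \<eta> * \<bar>d\<bar>\<close>, and the rectangle contributes
  \<open>exp (- a * d\<^sup>2)\<close>. The sum over \<open>l'\<close> is then at most of order
  \<open>1 / a\<close>, whatever \<open>L\<close>, so the normalisation by the square of
  \<open>L\<close> leaves a gain \<open>1 / L\<close>. The condition on \<open>L\<close> keeps
  \<open>2 * d * \<phi>\<close> where \<open>sin\<close> is bounded below linearly.\<close>

lemma fejer_shift_rectangle: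
  fixes w :: "'k \<Rightarrow> real" and \<phi> \<psi> \<eta> a :: real
  assumes I: "finite I" and w: "\<And>k. k \<in> I \<Longrightarrow> w k \<in> {-1, 1}"
    and A: "A \<subseteq> Pow I" "2 powr (card I * (1 - 1/64)) \<le> card A"
    and B: "B \<subseteq> Pow I" "2 powr (card I * (1 - 1/64)) \<le> card B"
    and L: "L > 0" "2 * L * \<bar>\<phi>\<bar> \<le> 1" and \<eta>: "0 \<le> \<eta>"
    and a: "0 < a" "a \<le> card I * \<phi>\<^sup>2 / 32"
  shows "\<bar>\<Sum>S\<in>A. \<Sum>T\<in>B. fejer L (\<phi> * bil I w S T + (\<psi> - \<eta>)) - fejer L (\<phi> * bil I w S T + (\<psi> + \<eta>))\<bar>
    \<le> card A * card B * (4 * \<eta> / (a * L))"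
proof -
  define N where "N = real (card A) * real (card B)"
  define X where "X = (\<lambda>d::real. \<Sum>S\<in>A. \<Sum>T\<in>B. cis ((d * \<phi>) * bil I w S T))"
  have X: "cmod (X d) \<le> N * exp (- a * d\<^sup>2)" if "\<bar>d\<bar> \<le> real L" for d
  proof -
    have "\<bar>2 * (d * \<phi>)\<bar> = 2 * \<bar>d\<bar> * \<bar>\<phi>\<bar>" by (simp add: abs_mult)
    also have "\<dots> \<le> 2 * real L * \<bar>\<phi>\<bar>" using that by (intro mult_right_mono) auto
    finally have "\<bar>2 * (d * \<phi>)\<bar> \<le> 1" using L by simp
    hence "\<bar>d * \<phi>\<bar> \<le> \<bar>sin (2 * (d * \<phi>))\<bar>" using abs_sin_ge_half[of "2 * (d * \<phi>)"] by simp
    hence "(d * \<phi>)\<^sup>2 \<le> (sin (2 * (d * \<phi>)))\<^sup>2" by (simp only: abs_le_square_iff)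
    hence "card I * (d * \<phi>)\<^sup>2 / 32 \<le> card I * (sin (2 * (d * \<phi>)))\<^sup>2 / 32"
      by (intro divide_right_mono mult_left_mono) auto
    moreover have "a * d\<^sup>2 \<le> card I * \<phi>\<^sup>2 / 32 * d\<^sup>2" using a by (intro mult_right_mono) auto
    moreover have "card I * (d * \<phi>)\<^sup>2 / 32 = card I * \<phi>\<^sup>2 / 32 * d\<^sup>2" by (simp add: power_mult_distrib)
    ultimately have "exp (- (card I * (sin (2 * (d * \<phi>)))\<^sup>2 / 32)) \<le> exp (- a * d\<^sup>2)" by simp
    moreover have "cmod (X d) \<le> N * exp (- (card I * (sin (2 * (d * \<phi>)))\<^sup>2 / 32))"
      unfolding X_def N_def by (unfold of_nat_mult[symmetric], rule rectangle_char_bound; fact)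
    moreover have "0 \<le> N" by (simp add: N_def)
    ultimately show ?thesis by (meson mult_left_mono order.trans)
  qed
  have sumf: "(\<Sum>S\<in>A. \<Sum>T\<in>B. fejer L (\<phi> * bil I w S T + c))
      = (\<Sum>l<L. \<Sum>l'<L. Re (cis ((real l - real l') * c) * X (real l - real l'))) / (real L)\<^sup>2" for c
  proof -
    have "(\<Sum>S\<in>A. \<Sum>T\<in>B. \<Sum>l<L. \<Sum>l'<L. Re (cis ((real l - real l') * (\<phi> * bil I w S T + c))))
      = (\<Sum>l<L. \<Sum>l'<L. \<Sum>S\<in>A. \<Sum>T\<in>B. Re (cis ((real l - real l') * (\<phi> * bil I w S T + c))))"
      by (rule sum_swap22)
    also have "\<dots> = (\<Sum>l<L. \<Sum>l'<L. Re (cis ((real l - real l') * c) * X (real l - real l')))"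
    proof (intro sum.cong refl)
      fix l l'
      have "cis ((real l - real l') * (\<phi> * bil I w S T + c))
          = cis ((real l - real l') * c) * cis (((real l - real l') * \<phi>) * bil I w S T)" for S T
        by (simp add: cis_mult distrib_left add.commute mult.assoc)
      thus "(\<Sum>S\<in>A. \<Sum>T\<in>B. Re (cis ((real l - real l') * (\<phi> * bil I w S T + c))))
        = Re (cis ((real l - real l') * c) * X (real l - real l'))"
        by (simp only: X_def sum_distrib_left Re_sum)
    qed
    finally show ?thesis by (simp only: fejer_expand sum_divide_distrib[symmetric])
  qed
  define Z where "Z = (\<lambda>d. (cis (d * (\<psi> - \<eta>)) - cis (d * (\<psi> + \<eta>))) * X d)"
  have "(\<Sum>S\<in>A. \<Sum>T\<in>B. fejer L (\<phi> * bil I w S T + (\<psi> - \<eta>)) - fejer L (\<phi> * bil I w S T + (\<psi> + \<eta>)))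
     = (\<Sum>l<L. \<Sum>l'<L. Re (Z (real l - real l'))) / (real L)\<^sup>2"
    unfolding sum_subtractf sumf Z_def left_diff_distrib minus_complex.sel by (simp only: diff_divide_distrib)
  also have "\<bar>\<dots>\<bar> \<le> (\<Sum>l<L. \<Sum>l'<L. cmod (Z (real l - real l'))) / (real L)\<^sup>2"
    unfolding abs_divide abs_power2
    by (intro divide_right_mono order.trans[OF sum_abs] sum_mono abs_Re_le_cmod) auto
  also have "\<dots> \<le> (\<Sum>l<L. \<Sum>l'<L. 2 * \<eta> * N * (\<bar>real l - real l'\<bar> * exp (- a * (real l - real l')\<^sup>2))) / (real L)\<^sup>2"
  proof (intro divide_right_mono sum_mono)
    fix l l' assume "l \<in> {..<L}" "l' \<in> {..<L}"
    define d where "d = real l - real l'"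
    have d: "\<bar>d\<bar> \<le> real L" using \<open>l \<in> _\<close> \<open>l' \<in> _\<close> by (auto simp: d_def)
    have "cmod (Z d) = cmod (cis (d * (\<psi> - \<eta>)) - cis (d * (\<psi> + \<eta>))) * cmod (X d)"
      by (simp add: Z_def norm_mult)
    also have "\<dots> \<le> (2 * \<eta> * \<bar>d\<bar>) * (N * exp (- a * d\<^sup>2))"
    proof (rule mult_mono[OF _ X[OF d]])
      have "\<bar>d * (\<psi> - \<eta>) - d * (\<psi> + \<eta>)\<bar> = \<bar>d * (- 2 * \<eta>)\<bar>" by (simp add: algebra_simps)
      also have "\<dots> = 2 * \<eta> * \<bar>d\<bar>" using \<eta> by (simp add: abs_mult)
      finally show "cmod (cis (d * (\<psi> - \<eta>)) - cis (d * (\<psi> + \<eta>))) \<le> 2 * \<eta> * \<bar>d\<bar>"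
        using cmod_cis_diff_le[of "d * (\<psi> - \<eta>)" "d * (\<psi> + \<eta>)"] by simp
    qed (use \<eta> in auto)
    finally show "cmod (Z (real l - real l')) \<le> 2 * \<eta> * N * (\<bar>real l - real l'\<bar> * exp (- a * (real l - real l')\<^sup>2))"
      by (simp add: d_def mult_ac)
  qed auto
  also have "\<dots> \<le> (\<Sum>l<L. 2 * \<eta> * N * (2 / a)) / (real L)\<^sup>2"
    unfolding sum_distrib_left[symmetric] using \<eta> a
    by (intro divide_right_mono mult_left_mono sum_mono sum_abs_diff_gaussian_le) (auto simp: N_def)
  also have "\<dots> = N * (4 * \<eta> / (a * L))" using L a by (simp add: power2_eq_square field_simps)
  finally show ?thesis by (simp add: N_def)
qed

section \<open>Transcripts and rectangles\<close>

text \<open>Only bits sent by players in \<open>Q\<close> are recorded. Once the other inputs are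
  fixed, these bits determine those of the other players and of the coordinator, hence the whole
  run.\<close>

fun heard_from :: "nat set \<Rightarrow> proto \<Rightarrow> strategies \<Rightarrow> (nat \<Rightarrow> int list) \<Rightarrow> (nat \<Rightarrow> (bool \<times> bool) list) \<Rightarrow> bool list" where
  "heard_from Q (Out v) st x h = []"
| "heard_from Q (Send j b p) st x h = heard_from Q p st x (h(j := h j @ [(True, b)]))"
| "heard_from Q (Recv j p0 p1) st x h =
     (if j \<in> Q then (#) (st j (x j) (h j)) else id)
       (heard_from Q (if st j (x j) (h j) then p1 else p0) st x (h(j := h j @ [(False, st j (x j) (h j))])))"

lemma run_Recv:
  "run (Recv j p0 p1) st x h =
     (let c = st j (x j) (h j); r = run (if c then p1 else p0) st x (h(j := h j @ [(False, c)]))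
      in (fst r, Suc (snd r)))"
  by (simp add: Let_def)

text \<open>Cut and paste: as long as the two runs agree, each queried player answers alike on
  \<open>x j\<close> and \<open>y j\<close> with the same private history, hence also on
  \<open>z j\<close>, which is one of them.\<close>

lemma heard_from_mix:
  assumes "\<And>j. j \<notin> Q \<Longrightarrow> x j = y j" "\<And>j. z j = x j \<or> z j = y j"
    and "heard_from Q p st x h = heard_from Q p st y h"
  shows "heard_from Q p st z h = heard_from Q p st x h"
  using assms(3)
proof (induction p arbitrary: h)
  case (Recv j p0 p1)
  have eq: "st j (x j) (h j) = st j (y j) (h j)"
    using Recv.prems assms(1)[of j] by (cases "j \<in> Q") auto
  moreover have "st j (z j) (h j) = st j (x j) (h j)"
    using eq assms(2)[of j] by auto
  ultimately show ?case
    using Recv.prems Recv.IH by (cases "j \<in> Q"; cases "st j (y j) (h j)") auto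
qed auto

lemma run_eq_if_heard_from_eq:
  assumes "\<And>j. j \<notin> Q \<Longrightarrow> x j = y j"
    and "heard_from Q p st x h = heard_from Q p st y h"
  shows "run p st x h = run p st y h"
  using assms(2)
proof (induction p arbitrary: h)
  case (Recv j p0 p1)
  have eq: "st j (x j) (h j) = st j (y j) (h j)"
    using Recv.prems assms(1)[of j] by (cases "j \<in> Q") auto
  thus ?case
    using Recv.prems Recv.IH
    by (cases "j \<in> Q"; cases "st j (y j) (h j)") (auto simp: Let_def)
qed (auto simp: Let_def)

text \<open>Each bit received by the coordinator has one sender, so it is charged to at most one of
  the disjoint sets.\<close>

lemma sum_heard_from_le_cost:
  assumes "finite M" "\<And>i i'. i \<in> M \<Longrightarrow> i' \<in> M \<Longrightarrow> i \<noteq> i' \<Longrightarrow> Q i \<inter> Q i' = {}"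
  shows "(\<Sum>i\<in>M. length (heard_from (Q i) p st x h)) \<le> snd (run p st x h)"
proof (induction p arbitrary: h)
  case (Send j b p)
  thus ?case by (simp add: Let_def le_SucI)
next
  case (Recv j p0 p1)
  define c where "c = st j (x j) (h j)"
  define p' h' where "p' = (if c then p1 else p0)" and "h' = h(j := h j @ [(False, c)])"
  have "(\<Sum>i\<in>M. length (heard_from (Q i) (Recv j p0 p1) st x h))
      = (\<Sum>i\<in>M. of_bool (j \<in> Q i) + length (heard_from (Q i) p' st x h'))"
    by (intro sum.cong) (auto simp: c_def p'_def h'_def)
  also have "\<dots> = card {i \<in> M. j \<in> Q i} + (\<Sum>i\<in>M. length (heard_from (Q i) p' st x h'))"
    using assms(1) by (simp add: sum.distrib Int_def)
  also have "card {i \<in> M. j \<in> Q i} \<le> 1"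
    using assms by (intro card_le_Suc0_iff_eq[THEN iffD2, simplified One_nat_def[symmetric]]) auto
  also have "(\<Sum>i\<in>M. length (heard_from (Q i) p' st x h')) \<le> snd (run p' st x h')"
    unfolding p'_def using Recv.IH by auto
  also have "1 + snd (run p' st x h') = snd (run (Recv j p0 p1) st x h)"
    unfolding run_Recv by (simp add: Let_def c_def p'_def h'_def)
  finally show ?case by simp
qed simp

lemma card_short_lists: "card {xs :: bool list. length xs \<le> n} \<le> 2 ^ (n + 1)"
proof -
  have "card {xs :: bool list. length xs \<le> n} = (\<Sum>i\<le>n. 2 ^ i)"
    using card_lists_length_le[of "UNIV :: bool set" n] by simp
  also have "\<dots> \<le> 2 ^ (n + 1)" by (induction n) auto
  finally show ?thesis .
qed

lemma finite_short_lists: "finite {xs :: bool list. length xs \<le> n}"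
  using finite_lists_length_le[of "UNIV :: bool set" n] by simp

text \<open>The cells of equal transcript are rectangles with constant output. Large cells are
  charged in proportion to their areas, which add up to at most \<open>4 ^ card F\<close>. A cell
  with a side shorter than \<open>\<theta>\<close> has at most \<open>2 ^ card F * \<theta>\<close>
  points, and at most \<open>2 ^ (n + 1)\<close> transcripts have length up to
  \<open>n\<close>.\<close>

lemma rectangle_partition_bound:
  fixes F :: "'k set" and \<tau> :: "'k set \<Rightarrow> 'k set \<Rightarrow> bool list" and f :: "'k set \<Rightarrow> 'k set \<Rightarrow> real"
    and out :: "'k set \<Rightarrow> 'k set \<Rightarrow> bool" and D \<theta> :: real
  assumes F: "finite F"
    and rect: "\<And>S T S' T'. \<lbrakk>S \<subseteq> F; T \<subseteq> F; S' \<subseteq> F; T' \<subseteq> F; \<tau> S T = \<tau> S' T'\<rbrakk> \<Longrightarrow> \<tau> S T' = \<tau> S T"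
    and out: "\<And>S T S' T'. \<lbrakk>S \<subseteq> F; T \<subseteq> F; S' \<subseteq> F; T' \<subseteq> F; \<tau> S T = \<tau> S' T'\<rbrakk> \<Longrightarrow> out S T = out S' T'"
    and large: "\<And>A C. \<lbrakk>A \<subseteq> Pow F; C \<subseteq> Pow F; \<theta> \<le> card A; \<theta> \<le> card C\<rbrakk>
       \<Longrightarrow> \<bar>\<Sum>S\<in>A. \<Sum>T\<in>C. f S T\<bar> \<le> card A * card C * D"
    and f1: "\<And>S T. \<bar>f S T\<bar> \<le> 1" and D: "0 \<le> D" and \<theta>: "0 \<le> \<theta>"
  shows "\<bar>\<Sum>S\<in>Pow F. \<Sum>T\<in>Pow F. if length (\<tau> S T) \<le> n \<and> out S T then f S T else 0\<bar>
    \<le> 4 ^ card F * D + 2 ^ (n + 1) * (2 ^ card F * \<theta>)"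
proof -
  define P where "P = {(S, T). S \<subseteq> F \<and> T \<subseteq> F \<and> length (\<tau> S T) \<le> n}"
  define K where "K = {xs :: bool list. length xs \<le> n}"
  define A where "A = (\<lambda>\<beta>. {S. S \<subseteq> F \<and> (\<exists>T. T \<subseteq> F \<and> \<tau> S T = \<beta>)})"
  define C where "C = (\<lambda>\<beta>. {T. T \<subseteq> F \<and> (\<exists>S. S \<subseteq> F \<and> \<tau> S T = \<beta>)})"
  have finP: "finite (Pow F \<times> Pow F)" using F by simp
  have P: "P \<subseteq> Pow F \<times> Pow F" by (auto simp: P_def)
  have fP: "finite P" using finP P finite_subset by blast
  have fK: "finite K" unfolding K_def by (rule finite_short_lists)
  have cell: "{z \<in> P. case_prod \<tau> z = \<beta>} = A \<beta> \<times> C \<beta>" if "\<beta> \<in> K" for \<beta>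
  proof (intro equalityI subsetI)
    fix z assume "z \<in> A \<beta> \<times> C \<beta>"
    then obtain S T T' S' where z: "z = (S, T')" "S \<subseteq> F" "T \<subseteq> F" "\<tau> S T = \<beta>"
      "T' \<subseteq> F" "S' \<subseteq> F" "\<tau> S' T' = \<beta>" unfolding A_def C_def by blast
    hence "\<tau> S T' = \<beta>" using rect[of S T S' T'] by metis
    thus "z \<in> {z \<in> P. case_prod \<tau> z = \<beta>}" using z that by (simp add: P_def K_def)
  qed (auto simp: P_def A_def C_def)
  have sub: "A \<beta> \<subseteq> Pow F" "C \<beta> \<subseteq> Pow F" for \<beta> by (auto simp: A_def C_def)
  have fin: "finite (A \<beta>)" "finite (C \<beta>)" for \<beta> using sub F finite_subset by (metis finite_Pow_iff)+
  have card_le: "real (card (A \<beta>)) \<le> 2 ^ card F" "real (card (C \<beta>)) \<le> 2 ^ card F" for \<beta>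
    using card_mono[OF _ sub(1)] card_mono[OF _ sub(2)] F by (simp_all add: card_Pow)
  define G where "G = (\<lambda>z. if case_prod out z then case_prod f z else 0)"
  have cellbound: "\<bar>sum G {z \<in> P. case_prod \<tau> z = \<beta>}\<bar> \<le> card (A \<beta>) * card (C \<beta>) * D + 2 ^ card F * \<theta>"
    if K: "\<beta> \<in> K" for \<beta>
  proof -
    have nn: "0 \<le> card (A \<beta>) * card (C \<beta>) * D" "0 \<le> 2 ^ card F * \<theta>" using D \<theta> by auto
    have const: "sum G (A \<beta> \<times> C \<beta>) = 0 \<or> sum G (A \<beta> \<times> C \<beta>) = sum (case_prod f) (A \<beta> \<times> C \<beta>)"
    proof (cases "\<exists>z \<in> A \<beta> \<times> C \<beta>. case_prod out z")
      case True
      then obtain z0 where z0: "z0 \<in> {z \<in> P. case_prod \<tau> z = \<beta>}" "case_prod out z0"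
        using cell[OF K] by auto
      have "case_prod out z" if "z \<in> {z \<in> P. case_prod \<tau> z = \<beta>}" for z
        using that z0 out[of "fst z0" "snd z0" "fst z" "snd z"] by (auto simp: P_def split_beta)
      hence "case_prod out z" if "z \<in> A \<beta> \<times> C \<beta>" for z using that cell[OF K] by blast
      hence "sum G (A \<beta> \<times> C \<beta>) = sum (case_prod f) (A \<beta> \<times> C \<beta>)"
        unfolding G_def by (intro sum.cong) auto
      thus ?thesis ..
    next
      case False
      hence "sum G (A \<beta> \<times> C \<beta>) = 0" unfolding G_def by (intro sum.neutral) auto
      thus ?thesis ..
    qed
    have "\<bar>sum (case_prod f) (A \<beta> \<times> C \<beta>)\<bar> \<le> card (A \<beta>) * card (C \<beta>) * D + 2 ^ card F * \<theta>"
    proof (cases "\<theta> \<le> card (A \<beta>) \<and> \<theta> \<le> card (C \<beta>)")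
      case True
      hence "\<bar>sum (case_prod f) (A \<beta> \<times> C \<beta>)\<bar> \<le> card (A \<beta>) * card (C \<beta>) * D"
        using large[OF sub(1) sub(2)] by (simp add: sum.cartesian_product)
      thus ?thesis using nn by linarith
    next
      case False
      have "\<bar>sum (case_prod f) (A \<beta> \<times> C \<beta>)\<bar> \<le> (\<Sum>z\<in>A \<beta> \<times> C \<beta>. 1)"
        by (rule order.trans[OF sum_abs]) (intro sum_mono, use f1 in \<open>auto simp: split_beta\<close>)
      also have "\<dots> = real (card (A \<beta>)) * real (card (C \<beta>))" by (simp add: card_cartesian_product)
      also have "\<dots> \<le> 2 ^ card F * \<theta>"
      proof (cases "\<theta> \<le> card (A \<beta>)")
        case True
        thus ?thesis using False card_le \<theta> by (intro mult_mono) auto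
      next
        case False
        hence "real (card (C \<beta>)) * real (card (A \<beta>)) \<le> 2 ^ card F * \<theta>"
          using card_le \<theta> by (intro mult_mono) auto
        thus ?thesis by (simp add: mult.commute)
      qed
      finally show ?thesis using nn by linarith
    qed
    thus ?thesis using const nn unfolding cell[OF K] by auto
  qed
  have "(\<Sum>S\<in>Pow F. \<Sum>T\<in>Pow F. if length (\<tau> S T) \<le> n \<and> out S T then f S T else 0)
      = (\<Sum>z\<in>Pow F \<times> Pow F. if z \<in> P then G z else 0)"
    unfolding sum.cartesian_product by (intro sum.cong refl) (auto simp: P_def G_def split: if_splits)
  also have "\<dots> = sum G P" using finP P by (simp add: sum.If_cases Int_absorb1)
  also have "\<dots> = (\<Sum>\<beta>\<in>K. sum G {z \<in> P. case_prod \<tau> z = \<beta>})"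
    using fP fK by (intro sum.group[symmetric]) (auto simp: P_def K_def)
  also have "\<bar>\<dots>\<bar> \<le> (\<Sum>\<beta>\<in>K. card (A \<beta>) * card (C \<beta>) * D + 2 ^ card F * \<theta>)"
    by (rule order.trans[OF sum_abs]) (intro sum_mono cellbound)
  also have "\<dots> = (\<Sum>\<beta>\<in>K. real (card {z \<in> P. case_prod \<tau> z = \<beta>})) * D + card K * (2 ^ card F * \<theta>)"
    by (simp add: sum.distrib sum_distrib_right cell card_cartesian_product)
  also have "(\<Sum>\<beta>\<in>K. real (card {z \<in> P. case_prod \<tau> z = \<beta>})) = real (card P)"
  proof -
    have "(\<Sum>\<beta>\<in>K. \<Sum>z\<in>{z \<in> P. case_prod \<tau> z = \<beta>}. 1) = (\<Sum>z\<in>P. (1::real))"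
      using fP fK by (intro sum.group) (auto simp: P_def K_def)
    thus ?thesis by simp
  qed
  also have "real (card P) * D \<le> 4 ^ card F * D"
  proof -
    have "card P \<le> card (Pow F \<times> Pow F)" by (rule card_mono[OF finP P])
    also have "\<dots> = 4 ^ card F"
      using F by (simp add: card_cartesian_product card_Pow power_mult_distrib[symmetric])
    finally have "real (card P) \<le> 4 ^ card F" by (metis of_nat_le_iff of_nat_numeral of_nat_power)
    thus ?thesis using D by (rule mult_right_mono)
  qed
  also have "card K * (2 ^ card F * \<theta>) \<le> 2 ^ (n + 1) * (2 ^ card F * \<theta>)"
  proof -
    have "real (card K) \<le> 2 ^ (n + 1)"
      using card_short_lists[of n] unfolding K_def by (metis of_nat_le_iff of_nat_numeral of_nat_power)
    thus ?thesis using \<theta> by (intro mult_right_mono) auto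
  qed
  finally show ?thesis by simp
qed

section \<open>Balanced columns\<close>

text \<open>A column holds the entries of all \<open>2 * s\<close> players at one coordinate and is
  coded as the set of players that hold -1.\<close>

definition sg :: "nat set \<Rightarrow> nat \<Rightarrow> int" where
  "sg c p = (if p \<in> c then -1 else 1)"

definition colA :: "nat \<Rightarrow> nat set \<Rightarrow> int" where
  "colA s c = (\<Sum>p<s. sg c p)"

definition colB :: "nat \<Rightarrow> nat set \<Rightarrow> int" where
  "colB s c = (\<Sum>p<s. sg c (s + p))"

definition Cols :: "nat \<Rightarrow> nat set set" where
  "Cols s = {c. c \<subseteq> {..<2 * s} \<and> colA s c \<in> {-1, 1} \<and> colB s c \<in> {-1, 1}}"

text \<open>In a balanced column the majority of each half wins by one, so the condition says that
  \<open>i\<close> and \<open>s + i\<close> are both in the majority. Flipping such a bit negates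
  the sum of its half; hence the two players can flip independently without leaving
  \<open>Cols s\<close>.\<close>

definition free_col :: "nat \<Rightarrow> nat \<Rightarrow> nat set \<Rightarrow> bool" where
  "free_col s i c \<longleftrightarrow> colA s c = sg c i \<and> colB s c = sg c (s + i)"

lemma finite_Cols: "finite (Cols s)"
  by (rule finite_subset[of _ "Pow {..<2 * s}"]) (auto simp: Cols_def)

lemma sg_sym_diff: "sg (sym_diff c E) p = (if p \<in> E then - sg c p else sg c p)"
  by (auto simp: sg_def)

lemma colA_toggle:
  assumes "i < s" "E \<subseteq> {i, s + i}" "colA s c = sg c i"
  shows "colA s (sym_diff c E) = (if i \<in> E then - colA s c else colA s c)"
proof -
  have "colA s (sym_diff c E) = (\<Sum>p<s. sg c p - (if p = i \<and> i \<in> E then 2 * sg c i else 0))"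
    unfolding colA_def sg_sym_diff using assms by (intro sum.cong) auto
  also have "\<dots> = colA s c - (if i \<in> E then 2 * sg c i else 0)"
    unfolding sum_subtractf colA_def using assms by (cases "i \<in> E") simp_all
  finally show ?thesis using assms by simp
qed

lemma colB_toggle:
  assumes "i < s" "E \<subseteq> {i, s + i}" "colB s c = sg c (s + i)"
  shows "colB s (sym_diff c E) = (if s + i \<in> E then - colB s c else colB s c)"
proof -
  have "colB s (sym_diff c E) = (\<Sum>p<s. sg c (s + p) - (if p = i \<and> s + i \<in> E then 2 * sg c (s + i) else 0))"
    unfolding colB_def sg_sym_diff using assms by (intro sum.cong) auto
  also have "\<dots> = colB s c - (if s + i \<in> E then 2 * sg c (s + i) else 0)"
    unfolding sum_subtractf colB_def using assms by (cases "s + i \<in> E") simp_all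
  finally show ?thesis using assms by simp
qed

lemma free_col_toggle:
  assumes "i < s" "E \<subseteq> {i, s + i}" "free_col s i c"
  shows "free_col s i (sym_diff c E)"
  using assms colA_toggle[OF assms(1,2)] colB_toggle[OF assms(1,2)]
  unfolding free_col_def sg_sym_diff by auto

lemma Cols_toggle:
  assumes "i < s" "E \<subseteq> {i, s + i}" "free_col s i c" "c \<in> Cols s"
  shows "sym_diff c E \<in> Cols s"
  using assms colA_toggle[OF assms(1,2)] colB_toggle[OF assms(1,2)]
  unfolding free_col_def Cols_def by auto

definition halfcols :: "nat \<Rightarrow> nat set set" where
  "halfcols s = {c. c \<subseteq> {..<s} \<and> (\<Sum>p<s. sg c p) \<in> {-1, 1}}"

lemma sum_sg: "c \<subseteq> {..<s} \<Longrightarrow> (\<Sum>p<s. sg c p) = int s - 2 * int (card c)"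
proof -
  assume c: "c \<subseteq> {..<s}"
  have "(\<Sum>p<s. sg c p) = (\<Sum>p<s. 1 - 2 * of_bool (p \<in> c))"
    by (intro sum.cong) (auto simp: sg_def)
  also have "\<dots> = int s - 2 * int (card ({..<s} \<inter> c))"
    by (simp add: sum_subtractf sum_distrib_left[symmetric] Int_def)
  also have "{..<s} \<inter> c = c" using c by auto
  finally show ?thesis .
qed

text \<open>With \<open>s = 2 * h + 1\<close> there are \<open>2 * (s choose h)\<close> balanced
  halves, and in \<open>2 * ((2 * h) choose h)\<close> of them \<open>i\<close> is in the majority:
  \<open>Y1\<close> has those where \<open>i\<close> holds 1, \<open>Y2\<close> those where it holds
  -1. The ratio (h + 1) / (2h + 1) exceeds one half.\<close>

lemma card_halfcols_le:
  assumes "odd s" "i < s"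
  shows "card (halfcols s) \<le> 2 * card {c \<in> halfcols s. (\<Sum>p<s. sg c p) = sg c i}"
proof -
  obtain h where s: "s = 2 * h + 1" using assms by (auto elim: oddE)
  define U where "U = {..<s} - {i}"
  have U: "finite U" "card U = 2 * h" using assms by (simp_all add: U_def s)
  have fin: "finite {c. c \<subseteq> {..<s} \<and> card c = k}" for k by simp
  have "halfcols s \<subseteq> {c. c \<subseteq> {..<s} \<and> card c = h} \<union> {c. c \<subseteq> {..<s} \<and> card c = h + 1}"
  proof
    fix c assume "c \<in> halfcols s"
    thus "c \<in> {c. c \<subseteq> {..<s} \<and> card c = h} \<union> {c. c \<subseteq> {..<s} \<and> card c = h + 1}"
      using sum_sg[of c s] by (auto simp: halfcols_def s)
  qed
  hence "card (halfcols s) \<le> card ({c. c \<subseteq> {..<s} \<and> card c = h} \<union> {c. c \<subseteq> {..<s} \<and> card c = h + 1})"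
    by (intro card_mono) auto
  also have "\<dots> \<le> card {c. c \<subseteq> {..<s} \<and> card c = h} + card {c. c \<subseteq> {..<s} \<and> card c = h + 1}"
    by (rule card_Un_le)
  also have "\<dots> = (s choose h) + (s choose (h + 1))"
    using n_subsets[of "{..<s}"] by simp
  also have "s choose (h + 1) = s choose h"
    using binomial_symmetric[of "h + 1" s] by (simp add: s)
  also have "s choose h \<le> 2 * ((2 * h) choose h)"
  proof (cases h)
    case (Suc k)
    have "s choose h = ((2 * h) choose k) + ((2 * h) choose h)"
      unfolding s Suc add_Suc_right add_0_right One_nat_def by (rule binomial_Suc_Suc)
    thus ?thesis using binomial_maximum'[of h k] by linarith
  qed (simp add: s)
  finally have 1: "card (halfcols s) \<le> 4 * ((2 * h) choose h)" by simp
  define Y1 where "Y1 = {c. c \<subseteq> U \<and> card c = h}"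
  define Y2 where "Y2 = insert i ` Y1"
  have fY: "finite Y1" "finite Y2" using U by (auto simp: Y1_def Y2_def)
  have cY1: "card Y1 = (2 * h) choose h" unfolding Y1_def using n_subsets[OF U(1)] U(2) by simp
  have "inj_on (insert i) Y1" by (auto simp: inj_on_def Y1_def U_def)
  hence cY2: "card Y2 = (2 * h) choose h" unfolding Y2_def by (simp add: card_image cY1)
  have "Y1 \<inter> Y2 = {}" by (auto simp: Y1_def Y2_def U_def)
  hence "card (Y1 \<union> Y2) = 2 * ((2 * h) choose h)"
    using fY cY1 cY2 by (simp add: card_Un_disjoint)
  moreover have "Y1 \<union> Y2 \<subseteq> {c \<in> halfcols s. (\<Sum>p<s. sg c p) = sg c i}"
  proof
    fix c assume "c \<in> Y1 \<union> Y2"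
    hence "c \<subseteq> {..<s} \<and> (i \<notin> c \<and> card c = h \<or> i \<in> c \<and> card c = h + 1)"
    proof
      assume "c \<in> Y1" thus ?thesis by (auto simp: Y1_def U_def)
    next
      assume "c \<in> Y2"
      then obtain d where d: "c = insert i d" "d \<subseteq> U" "card d = h" by (auto simp: Y2_def Y1_def)
      hence "finite d" "i \<notin> d" using U finite_subset by (auto simp: U_def)
      thus ?thesis using d assms by (auto simp: U_def)
    qed
    thus "c \<in> {c \<in> halfcols s. (\<Sum>p<s. sg c p) = sg c i}"
      using sum_sg[of c s] by (auto simp: halfcols_def s sg_def)
  qed
  moreover have "finite (halfcols s)" by (rule finite_subset[of _ "Pow {..<s}"]) (auto simp: halfcols_def)
  ultimately have "2 * ((2 * h) choose h) \<le> card {c \<in> halfcols s. (\<Sum>p<s. sg c p) = sg c i}"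
    by (metis (no_types, lifting) card_mono finite_subset mem_Collect_eq subsetI)
  with 1 show ?thesis by linarith
qed

definition join_cols :: "nat \<Rightarrow> nat set \<times> nat set \<Rightarrow> nat set" where
  "join_cols s z = fst z \<union> (+) s ` snd z"

lemma join_cols:
  assumes "fst z \<subseteq> {..<s}" "snd z \<subseteq> {..<s}"
  shows "p < s \<Longrightarrow> sg (join_cols s z) p = sg (fst z) p"
    "p < s \<Longrightarrow> sg (join_cols s z) (s + p) = sg (snd z) p"
  using assms by (auto simp: join_cols_def sg_def)

text \<open>The two halves of a column are chosen independently, so the factor 2 of
  \<open>card_halfcols_le\<close> gets squared.\<close>

lemma card_Cols_le:
  assumes "odd s" "i < s"
  shows "card (Cols s) \<le> 4 * card {c \<in> Cols s. free_col s i c}"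
proof -
  define X where "X = halfcols s"
  define Y where "Y = {c \<in> halfcols s. (\<Sum>p<s. sg c p) = sg c i}"
  have X: "finite X" unfolding X_def by (rule finite_subset[of _ "Pow {..<s}"]) (auto simp: halfcols_def)
  have Xs: "c \<subseteq> {..<s}" if "c \<in> X" for c using that by (auto simp: X_def halfcols_def)
  have Ys: "c \<subseteq> {..<s}" if "c \<in> Y" for c using that by (auto simp: Y_def halfcols_def)
  have inj: "inj_on (join_cols s) (Pow {..<s} \<times> Pow {..<s})"
  proof (rule inj_onI)
    fix z z' assume z: "z \<in> Pow {..<s} \<times> Pow {..<s}" "z' \<in> Pow {..<s} \<times> Pow {..<s}"
      and eq: "join_cols s z = join_cols s z'"
    have "fst y = join_cols s y \<inter> {..<s}" "snd y = {p. s + p \<in> join_cols s y}"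
      if "y \<in> Pow {..<s} \<times> Pow {..<s}" for y
      using that by (auto simp: join_cols_def)
    thus "z = z'" using z eq by (metis prod_eqI)
  qed
  have "Cols s \<subseteq> join_cols s ` (X \<times> X)"
  proof
    fix c assume c: "c \<in> Cols s"
    define z where "z = (c \<inter> {..<s}, {p. p < s \<and> s + p \<in> c})"
    have "c = join_cols s z"
    proof (intro equalityI subsetI)
      fix p assume p: "p \<in> c"
      show "p \<in> join_cols s z"
      proof (cases "p < s")
        case False
        hence "p = s + (p - s)" "p - s < s" using c p by (auto simp: Cols_def)
        thus ?thesis using p by (auto simp: join_cols_def z_def image_iff intro!: exI[of _ "p - s"])
      qed (use p in \<open>auto simp: join_cols_def z_def\<close>)
    qed (auto simp: join_cols_def z_def)
    moreover have "fst z \<subseteq> {..<s}" "snd z \<subseteq> {..<s}" by (auto simp: z_def)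
    ultimately have "(\<Sum>p<s. sg (fst z) p) = colA s c" "(\<Sum>p<s. sg (snd z) p) = colB s c"
      unfolding colA_def colB_def using join_cols[of z s] by auto
    hence "z \<in> X \<times> X" using c by (auto simp: X_def halfcols_def Cols_def z_def)
    thus "c \<in> join_cols s ` (X \<times> X)" using \<open>c = join_cols s z\<close> by blast
  qed
  hence "card (Cols s) \<le> card (X \<times> X)"
    using X by (intro order.trans[OF card_mono card_image_le]) auto
  hence 1: "card (Cols s) \<le> card X * card X" by (simp add: card_cartesian_product)
  have "join_cols s ` (Y \<times> Y) \<subseteq> {c \<in> Cols s. free_col s i c}"
  proof
    fix c assume "c \<in> join_cols s ` (Y \<times> Y)"
    then obtain z where z: "z \<in> Y \<times> Y" "c = join_cols s z" by blast
    have sub: "fst z \<subseteq> {..<s}" "snd z \<subseteq> {..<s}"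
      using z(1) Ys[of "fst z"] Ys[of "snd z"] by (auto simp: mem_Times_iff)
    have "colA s c = (\<Sum>p<s. sg (fst z) p)" "colB s c = (\<Sum>p<s. sg (snd z) p)"
      unfolding colA_def colB_def using join_cols[OF sub] z by auto
    moreover have "sg c i = sg (fst z) i" "sg c (s + i) = sg (snd z) i"
      using join_cols[OF sub] assms z by auto
    moreover have "c \<subseteq> {..<2 * s}" using sub z by (force simp: join_cols_def)
    ultimately show "c \<in> {c \<in> Cols s. free_col s i c}"
      using z by (auto simp: Cols_def free_col_def Y_def halfcols_def)
  qed
  hence "card (join_cols s ` (Y \<times> Y)) \<le> card {c \<in> Cols s. free_col s i c}"
    using finite_Cols by (intro card_mono) auto
  moreover have "card (join_cols s ` (Y \<times> Y)) = card Y * card Y"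
    using Ys by (subst card_image) (auto simp: card_cartesian_product intro!: inj_on_subset[OF inj])
  ultimately have 2: "card Y * card Y \<le> card {c \<in> Cols s. free_col s i c}" by simp
  have "card X * card X \<le> (2 * card Y) * (2 * card Y)"
    using card_halfcols_le[OF assms] unfolding X_def Y_def by (intro mult_mono) auto
  thus ?thesis using 1 2 by linarith
qed

lemma Cols_nonempty:
  assumes "odd s"
  shows "Cols s \<noteq> {}"
proof -
  obtain h where s: "s = 2 * h + 1" using assms by (auto elim: oddE)
  define z where "z = ({..<h}, {..<h})"
  have sub: "fst z \<subseteq> {..<s}" "snd z \<subseteq> {..<s}" by (auto simp: z_def s)
  have "colA s (join_cols s z) = 1" "colB s (join_cols s z) = 1"
    unfolding colA_def colB_def using join_cols[OF sub] sum_sg[of "{..<h}" s] sub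
    by (simp_all add: z_def) (simp_all add: s)
  moreover have "join_cols s z \<subseteq> {..<2 * s}" using sub by (force simp: join_cols_def)
  ultimately have "join_cols s z \<in> Cols s" by (simp add: Cols_def)
  thus ?thesis by blast
qed

definition colw :: "nat \<Rightarrow> nat set \<Rightarrow> real" where
  "colw s c = of_int (colA s c * colB s c)"

lemma colw_values: "c \<in> Cols s \<Longrightarrow> colw s c \<in> {-1, 1}"
  by (auto simp: Cols_def colw_def)

lemma colw_toggle:
  assumes "i < s" "E \<subseteq> {i, s + i}" "free_col s i c"
  shows "colw s (sym_diff c E)
    = colw s c * (if i \<in> E then -1 else 1) * (if s + i \<in> E then -1 else 1)"
  using assms colA_toggle[OF assms(1,2)] colB_toggle[OF assms(1,2)]
  by (simp add: colw_def free_col_def)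

text \<open>Flipping the whole first half of a column is an involution of \<open>Cols s\<close> that
  negates \<open>colw s\<close>.\<close>

lemma sum_colw_eq_0:
  assumes "s > 0"
  shows "(\<Sum>c\<in>Cols s. colw s c) = 0"
proof -
  have A: "colA s (sym_diff c {..<s}) = - colA s c" and B: "colB s (sym_diff c {..<s}) = colB s c" for c
    unfolding colA_def colB_def sg_sym_diff by (simp_all add: sum_negf)
  have mem: "sym_diff c {..<s} \<in> Cols s" if "c \<in> Cols s" for c
    using that A[of c] B[of c] by (auto simp: Cols_def)
  have inv: "sym_diff (sym_diff c {..<s}) {..<s} = c" for c by auto
  have "(\<Sum>c\<in>Cols s. colw s c) = (\<Sum>c\<in>Cols s. - colw s c)"
    by (rule sum.reindex_bij_witness[where i="\<lambda>c. sym_diff c {..<s}" and j="\<lambda>c. sym_diff c {..<s}"])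
      ((rule inv mem; assumption?) | (simp add: colw_def A B))+
  thus ?thesis by (simp add: sum_negf)
qed

section \<open>Independent blocks and resampling of the free ones\<close>

definition Omega :: "nat \<Rightarrow> nat \<Rightarrow> (nat \<Rightarrow> nat set) set" where
  "Omega s q = PiE {..<q} (\<lambda>_. Cols s)"

definition free_blocks :: "nat \<Rightarrow> nat \<Rightarrow> nat \<Rightarrow> (nat \<Rightarrow> nat set) \<Rightarrow> nat set" where
  "free_blocks s q i \<omega> = {j. j < q \<and> free_col s i (\<omega> j)}"

definition toggled :: "nat \<Rightarrow> nat \<Rightarrow> nat set \<Rightarrow> nat set \<Rightarrow> nat \<Rightarrow> nat set" where
  "toggled s i S T j = (if j \<in> S then {i} else {}) \<union> (if j \<in> T then {s + i} else {})"

text \<open>Player \<open>i\<close> flips its bit in the blocks of \<open>S\<close>, player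
  \<open>s + i\<close> in those of \<open>T\<close>. The restriction to \<open>{..<q}\<close> keeps
  the result extensional, as membership in \<open>PiE\<close> demands.\<close>

definition flip :: "nat \<Rightarrow> nat \<Rightarrow> nat \<Rightarrow> (nat \<Rightarrow> nat set) \<Rightarrow> nat set \<Rightarrow> nat set \<Rightarrow> nat \<Rightarrow> nat set" where
  "flip s q i \<omega> S T = (\<lambda>j\<in>{..<q}. sym_diff (\<omega> j) (toggled s i S T j))"

definition blockW :: "nat \<Rightarrow> nat \<Rightarrow> (nat \<Rightarrow> nat set) \<Rightarrow> real" where
  "blockW s q \<omega> = (\<Sum>j<q. colw s (\<omega> j))"

lemma finite_Omega: "finite (Omega s q)"
  unfolding Omega_def by (intro finite_PiE finite_Cols) auto

lemma card_Omega: "card (Omega s q) = card (Cols s) ^ q"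
  unfolding Omega_def by (simp add: card_PiE)

lemma card_Omega_pos: "odd s \<Longrightarrow> 0 < card (Omega s q)"
  using Cols_nonempty finite_Cols by (simp add: card_Omega card_gt_0_iff)

lemma finite_free_blocks: "finite (free_blocks s q i \<omega>)"
  by (rule finite_subset[of _ "{..<q}"]) (auto simp: free_blocks_def)

lemma toggled_subset: "toggled s i S T j \<subseteq> {i, s + i}"
  by (auto simp: toggled_def)

lemma toggled_empty: "j \<notin> S \<Longrightarrow> j \<notin> T \<Longrightarrow> toggled s i S T j = {}"
  by (simp add: toggled_def)

lemma toggled_iff:
  assumes "i < s"
  shows "i \<in> toggled s i S T j \<longleftrightarrow> j \<in> S" "s + i \<in> toggled s i S T j \<longleftrightarrow> j \<in> T"
  using assms by (auto simp: toggled_def)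

lemma sym_diff_cancel: "sym_diff (sym_diff c E) E = c"
  by auto

lemma flip_mem_Omega:
  assumes "i < s" "\<omega> \<in> Omega s q" "S \<subseteq> free_blocks s q i \<omega>" "T \<subseteq> free_blocks s q i \<omega>"
  shows "flip s q i \<omega> S T \<in> Omega s q"
  unfolding Omega_def
proof (rule PiE_I)
  fix j assume j: "j \<in> {..<q}"
  hence c: "\<omega> j \<in> Cols s" using assms(2) by (auto simp: Omega_def)
  show "flip s q i \<omega> S T j \<in> Cols s"
  proof (cases "j \<in> S \<union> T")
    case True
    hence "free_col s i (\<omega> j)" using assms(3,4) by (auto simp: free_blocks_def)
    thus ?thesis using Cols_toggle[OF assms(1) toggled_subset _ c] j by (simp add: flip_def)
  next
    case False
    thus ?thesis using c j by (simp add: flip_def toggled_empty)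
  qed
qed (simp add: flip_def)

lemma flip_flip:
  assumes "\<omega> \<in> Omega s q"
  shows "flip s q i (flip s q i \<omega> S T) S T = \<omega>"
proof
  fix j
  show "flip s q i (flip s q i \<omega> S T) S T j = \<omega> j"
  proof (cases "j < q")
    case True
    thus ?thesis using sym_diff_cancel[of "\<omega> j"] by (simp add: flip_def)
  next
    case False
    thus ?thesis using assms by (auto simp: flip_def Omega_def PiE_def extensional_def)
  qed
qed

lemma free_blocks_flip:
  assumes "i < s" "S \<subseteq> free_blocks s q i \<omega>" "T \<subseteq> free_blocks s q i \<omega>"
  shows "free_blocks s q i (flip s q i \<omega> S T) = free_blocks s q i \<omega>"
proof -
  have "free_col s i (sym_diff (\<omega> j) (toggled s i S T j)) \<longleftrightarrow> free_col s i (\<omega> j)" if "j < q" for j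
  proof (cases "j \<in> S \<union> T")
    case True
    hence f: "free_col s i (\<omega> j)" using assms(2,3) by (auto simp: free_blocks_def)
    show ?thesis using free_col_toggle[OF assms(1) toggled_subset f, of S T j] f by simp
  next
    case False
    thus ?thesis by (simp add: toggled_empty)
  qed
  thus ?thesis by (auto simp: free_blocks_def flip_def)
qed

text \<open>Uniform columns followed by uniform flips of free blocks are again uniform, because for
  given \<open>S\<close>, \<open>T\<close> the flip is an involution that preserves the set of free
  blocks; \<open>g\<close> is this involution on triples. The inner double sum is what remains after
  conditioning on everything except the free bits of \<open>i\<close> and
  \<open>s + i\<close>.\<close>

lemma sum_Omega_flip:
  fixes h :: "(nat \<Rightarrow> nat set) \<Rightarrow> real"
  assumes "i < s"
  shows "(\<Sum>\<omega>\<in>Omega s q. h \<omega>) = (\<Sum>\<omega>\<in>Omega s q.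
    (\<Sum>S\<in>Pow (free_blocks s q i \<omega>). \<Sum>T\<in>Pow (free_blocks s q i \<omega>). h (flip s q i \<omega> S T))
      / 4 ^ card (free_blocks s q i \<omega>))"
proof -
  define F where "F = free_blocks s q i"
  define Z where "Z = (SIGMA \<omega>:Omega s q. Pow (F \<omega>) \<times> Pow (F \<omega>))"
  define g where "g = (\<lambda>(\<omega>, S, T). (flip s q i \<omega> S T, S, T))"
  have g: "g z \<in> Z \<and> g (g z) = z \<and> F (fst (g z)) = F (fst z)" if z: "z \<in> Z" for z
  proof -
    obtain \<omega> S T where z: "z = (\<omega>, S, T)" "\<omega> \<in> Omega s q" "S \<subseteq> F \<omega>" "T \<subseteq> F \<omega>"
      using z by (auto simp: Z_def)
    thus ?thesis
      using flip_mem_Omega[OF assms z(2)] flip_flip[OF z(2), of i S T] free_blocks_flip[OF assms, of S q \<omega> T]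
      by (simp add: Z_def g_def F_def)
  qed
  have finF: "finite (F \<omega>)" for \<omega> unfolding F_def by (rule finite_free_blocks)
  have "(\<Sum>\<omega>\<in>Omega s q. (\<Sum>S\<in>Pow (F \<omega>). \<Sum>T\<in>Pow (F \<omega>). h (flip s q i \<omega> S T)) / 4 ^ card (F \<omega>))
     = (\<Sum>\<omega>\<in>Omega s q. \<Sum>y\<in>Pow (F \<omega>) \<times> Pow (F \<omega>). h (fst (g (\<omega>, y))) / 4 ^ card (F \<omega>))"
    by (simp add: sum.cartesian_product sum_divide_distrib g_def split_beta)
  also have "\<dots> = (\<Sum>z\<in>Z. h (fst (g z)) / 4 ^ card (F (fst z)))"
    unfolding Z_def by (subst sum.Sigma) (auto simp: finite_Omega finF intro!: sum.cong)
  also have "\<dots> = (\<Sum>z\<in>Z. h (fst z) / 4 ^ card (F (fst z)))"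
    by (rule sum.reindex_bij_witness[where i=g and j=g]) (use g in auto)
  also have "\<dots> = (\<Sum>\<omega>\<in>Omega s q. \<Sum>y\<in>Pow (F \<omega>) \<times> Pow (F \<omega>). h \<omega> / 4 ^ card (F \<omega>))"
    unfolding Z_def by (subst sum.Sigma) (auto simp: finite_Omega finF intro!: sum.cong)
  also have "\<dots> = (\<Sum>\<omega>\<in>Omega s q. h \<omega>)"
  proof (intro sum.cong refl)
    fix \<omega>
    have "real (card (Pow (F \<omega>) \<times> Pow (F \<omega>))) = 4 ^ card (F \<omega>)"
      using finF by (simp add: card_cartesian_product card_Pow power_mult_distrib[symmetric])
    thus "(\<Sum>y\<in>Pow (F \<omega>) \<times> Pow (F \<omega>). h \<omega> / 4 ^ card (F \<omega>)) = h \<omega>"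
      by simp
  qed
  finally show ?thesis by (simp add: F_def)
qed

text \<open>Brings the inner product into the form of \<open>fejer_shift_rectangle\<close>: a signed
  bilinear form in \<open>S\<close> and \<open>T\<close>, shifted by a constant from the blocks that
  are not free.\<close>

lemma blockW_flip:
  assumes "i < s" "S \<subseteq> free_blocks s q i \<omega>" "T \<subseteq> free_blocks s q i \<omega>"
  shows "blockW s q (flip s q i \<omega> S T)
    = bil (free_blocks s q i \<omega>) (\<lambda>j. colw s (\<omega> j)) S T
      + (\<Sum>j\<in>{..<q} - free_blocks s q i \<omega>. colw s (\<omega> j))"
proof -
  define F where "F = free_blocks s q i \<omega>"
  have F: "F \<subseteq> {..<q}" by (auto simp: F_def free_blocks_def)
  have "blockW s q (flip s q i \<omega> S T) = (\<Sum>j<q. colw s (sym_diff (\<omega> j) (toggled s i S T j)))"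
    unfolding blockW_def by (intro sum.cong) (auto simp: flip_def)
  also have "\<dots> = (\<Sum>j\<in>{..<q} - F. colw s (sym_diff (\<omega> j) (toggled s i S T j)))
      + (\<Sum>j\<in>F. colw s (sym_diff (\<omega> j) (toggled s i S T j)))"
    by (rule sum.subset_diff[OF F]) simp
  also have "(\<Sum>j\<in>{..<q} - F. colw s (sym_diff (\<omega> j) (toggled s i S T j))) = (\<Sum>j\<in>{..<q} - F. colw s (\<omega> j))"
  proof (intro sum.cong refl)
    fix j assume "j \<in> {..<q} - F"
    hence "toggled s i S T j = {}" using assms(2,3) by (intro toggled_empty) (auto simp: F_def)
    thus "colw s (sym_diff (\<omega> j) (toggled s i S T j)) = colw s (\<omega> j)" by simp
  qed
  also have "(\<Sum>j\<in>F. colw s (sym_diff (\<omega> j) (toggled s i S T j))) = bil F (\<lambda>j. colw s (\<omega> j)) S T"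
    unfolding bil_def
  proof (intro sum.cong refl)
    fix j assume "j \<in> F"
    hence "free_col s i (\<omega> j)" by (simp add: F_def free_blocks_def)
    from colw_toggle[OF assms(1) toggled_subset this, of S T j]
    show "colw s (sym_diff (\<omega> j) (toggled s i S T j)) = colw s (\<omega> j) * sgn_in S j * sgn_in T j"
      by (simp add: toggled_iff[OF assms(1)] sgn_in_def)
  qed
  finally show ?thesis by (simp add: F_def)
qed

lemma sum_Omega_prod:
  fixes f :: "nat \<Rightarrow> nat set \<Rightarrow> real"
  shows "(\<Sum>\<omega>\<in>Omega s q. \<Prod>j<q. f j (\<omega> j)) = (\<Prod>j<q. \<Sum>c\<in>Cols s. f j c)"
  unfolding Omega_def by (rule prod_sum_PiE[symmetric]) (auto simp: finite_Cols)

text \<open>Exponential moment. A block is free with probability at least 1/4, so the mean of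
  \<open>(1 / 2) ^ card (free_blocks s q i \<omega>)\<close> is at most \<open>(7 / 8) ^ q\<close>.
  Since 2 is at most the 16th power of 17/16, fewer than \<open>q / 16\<close> free blocks cost a
  factor \<open>(17 / 16) ^ q\<close>, and 7/8 times 17/16 is 119/128.\<close>

lemma card_few_free_blocks:
  assumes "odd s" "i < s"
  shows "card {\<omega> \<in> Omega s q. 16 * card (free_blocks s q i \<omega>) < q} \<le> card (Omega s q) * (119 / 128 :: real) ^ q"
proof -
  define f where "f = (\<lambda>c. if free_col s i c then 1 / 2 else (1::real))"
  define M where "M = real (card (Cols s))"
  have "(\<Sum>c\<in>Cols s. f c) = (\<Sum>c\<in>Cols s. 1 - 1 / 2 * of_bool (free_col s i c))"
    by (intro sum.cong) (auto simp: f_def)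
  also have "\<dots> = M - 1 / 2 * (\<Sum>c\<in>Cols s. of_bool (free_col s i c))"
    unfolding sum_subtractf sum_distrib_left[symmetric] by (simp add: M_def)
  also have "(\<Sum>c\<in>Cols s. of_bool (free_col s i c)) = real (card {c \<in> Cols s. free_col s i c})"
    by (simp add: finite_Cols Int_def)
  also have "M - 1 / 2 * real (card {c \<in> Cols s. free_col s i c}) \<le> 7 / 8 * M"
    using card_Cols_le[OF assms] unfolding M_def by linarith
  finally have f: "(\<Sum>c\<in>Cols s. f c) \<le> 7 / 8 * M" .
  have f0: "0 \<le> (\<Sum>c\<in>Cols s. f c)" by (intro sum_nonneg) (auto simp: f_def)
  have prodf: "(\<Prod>j<q. f (\<omega> j)) = (1 / 2) ^ card (free_blocks s q i \<omega>)" for \<omega>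
    unfolding f_def by (simp add: prod.If_cases Int_def free_blocks_def lessThan_def)
  have ineq: "1 \<le> (17 / 16) ^ q * (1 / 2 :: real) ^ t" if "16 * t < q" for t
  proof -
    have "1 + real 16 * (1 / 16) \<le> (1 + 1 / 16 :: real) ^ 16" by (rule Bernoulli_inequality) simp
    hence "(2::real) \<le> (17 / 16) ^ 16" by simp
    hence "(2::real) ^ t \<le> ((17 / 16) ^ 16) ^ t" by (intro power_mono) auto
    also have "\<dots> = (17 / 16) ^ (16 * t)" by (simp only: power_mult)
    also have "\<dots> \<le> (17 / 16 :: real) ^ q" using that by (intro power_increasing) auto
    finally have "2 ^ t * (1 / 2 :: real) ^ t \<le> (17 / 16) ^ q * (1 / 2) ^ t"
      by (intro mult_right_mono) auto
    moreover have "2 ^ t * (1 / 2 :: real) ^ t = 1" by (simp add: power_mult_distrib[symmetric])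
    ultimately show ?thesis by simp
  qed
  define Bd where "Bd = {\<omega> \<in> Omega s q. 16 * card (free_blocks s q i \<omega>) < q}"
  have "real (card Bd) = (\<Sum>\<omega>\<in>Bd. 1)" by simp
  also have "\<dots> \<le> (\<Sum>\<omega>\<in>Bd. (17 / 16) ^ q * (1 / 2 :: real) ^ card (free_blocks s q i \<omega>))"
    by (intro sum_mono ineq) (auto simp: Bd_def)
  also have "\<dots> \<le> (\<Sum>\<omega>\<in>Omega s q. (17 / 16) ^ q * (1 / 2 :: real) ^ card (free_blocks s q i \<omega>))"
    by (intro sum_mono2 finite_Omega) (auto simp: Bd_def)
  also have "\<dots> = (17 / 16) ^ q * (\<Sum>c\<in>Cols s. f c) ^ q"
    using sum_Omega_prod[of "\<lambda>_. f" q s] by (simp add: prodf sum_distrib_left[symmetric])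
  also have "\<dots> \<le> (17 / 16) ^ q * (7 / 8 * M) ^ q"
    using f f0 by (intro mult_left_mono power_mono) auto
  also have "\<dots> = card (Omega s q) * (119 / 128) ^ q"
    by (simp add: card_Omega M_def power_mult_distrib[symmetric] mult_ac)
  finally show ?thesis by (simp add: Bd_def)
qed

text \<open>The block products are independent signs of mean 0, so the variance is \<open>q\<close>.
  Only this second moment of the input distribution is used, through Chebyshev.\<close>

lemma sum_blockW_squared:
  assumes "s > 0"
  shows "(\<Sum>\<omega>\<in>Omega s q. (blockW s q \<omega>)\<^sup>2) = q * card (Omega s q)"
proof -
  have cross: "(\<Sum>\<omega>\<in>Omega s q. colw s (\<omega> a) * colw s (\<omega> b)) = (if a = b then real (card (Omega s q)) else 0)"
    if ab: "a < q" "b < q" for a b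
  proof (cases "a = b")
    case True
    have "colw s (\<omega> a) * colw s (\<omega> b) = 1" if "\<omega> \<in> Omega s q" for \<omega>
    proof -
      have "\<omega> a \<in> Cols s" using that ab by (auto simp: Omega_def)
      thus ?thesis using colw_values True by fastforce
    qed
    thus ?thesis using True by simp
  next
    case False
    define f where "f = (\<lambda>j c. if j = a \<or> j = b then colw s c else 1)"
    have "(\<Prod>j<q. f j (\<omega> j)) = colw s (\<omega> a) * colw s (\<omega> b)" for \<omega>
    proof -
      have "(\<Prod>j<q. f j (\<omega> j)) = (\<Prod>j\<in>{a, b}. f j (\<omega> j))"
        using ab by (intro prod.mono_neutral_right) (auto simp: f_def)
      thus ?thesis using False by (simp add: f_def)
    qed
    hence "(\<Sum>\<omega>\<in>Omega s q. colw s (\<omega> a) * colw s (\<omega> b)) = (\<Prod>j<q. \<Sum>c\<in>Cols s. f j c)"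
      using sum_Omega_prod[of f q s] by simp
    also have "\<dots> = 0"
      using ab sum_colw_eq_0[OF assms] by (intro prod_zero bexI[of _ a]) (auto simp: f_def)
    finally show ?thesis using False by simp
  qed
  have "(\<Sum>\<omega>\<in>Omega s q. (blockW s q \<omega>)\<^sup>2)
      = (\<Sum>\<omega>\<in>Omega s q. \<Sum>a<q. \<Sum>b<q. colw s (\<omega> a) * colw s (\<omega> b))"
    by (simp add: blockW_def power2_eq_square sum_product)
  also have "\<dots> = (\<Sum>a<q. \<Sum>b<q. \<Sum>\<omega>\<in>Omega s q. colw s (\<omega> a) * colw s (\<omega> b))"
    by (subst sum.swap) (rule sum.cong[OF refl], rule sum.swap)
  also have "\<dots> = (\<Sum>a<q. \<Sum>b<q. if a = b then real (card (Omega s q)) else 0)"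
    by (intro sum.cong refl) (simp add: cross)
  also have "\<dots> = q * card (Omega s q)" by simp
  finally show ?thesis .
qed

lemma card_large_blockW:
  assumes "s > 0" "t > 0"
  shows "card {\<omega> \<in> Omega s q. t \<le> \<bar>blockW s q \<omega>\<bar>} \<le> q / t\<^sup>2 * card (Omega s q)"
proof -
  define U where "U = {\<omega> \<in> Omega s q. t \<le> \<bar>blockW s q \<omega>\<bar>}"
  have "card U * t\<^sup>2 = (\<Sum>\<omega>\<in>U. t\<^sup>2)" by simp
  also have "\<dots> \<le> (\<Sum>\<omega>\<in>U. (blockW s q \<omega>)\<^sup>2)"
  proof (intro sum_mono)
    fix \<omega> assume "\<omega> \<in> U"
    thus "t\<^sup>2 \<le> (blockW s q \<omega>)\<^sup>2" using assms power_mono[of t "\<bar>blockW s q \<omega>\<bar>" 2] by (auto simp: U_def)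
  qed
  also have "\<dots> \<le> (\<Sum>\<omega>\<in>Omega s q. (blockW s q \<omega>)\<^sup>2)"
    by (intro sum_mono2 finite_Omega) (auto simp: U_def)
  finally show ?thesis unfolding sum_blockW_squared[OF assms(1)] U_def[symmetric]
    using assms by (simp add: field_simps)
qed

text \<open>The first \<open>k * q\<close> coordinates repeat each of the \<open>q\<close> blocks \<open>k\<close> times. On the padding all
  inputs are fixed and alternate in sign along the players, so that \<open>a = 1\<close> and \<open>b = \<plusminus>1\<close> there.\<close>

definition inputs :: "nat \<Rightarrow> nat \<Rightarrow> nat \<Rightarrow> nat \<Rightarrow> nat \<Rightarrow> (nat \<Rightarrow> nat set) \<Rightarrow> nat \<Rightarrow> int list" where
  "inputs s n k q r \<omega> p = (if p < 2 * s then map (\<lambda>x.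
     if x < k * q then sg (\<omega> (x div k)) p
     else if p < s then (-1) ^ p
     else (-1) ^ (p - s) * (if x < k * q + r then -1 else 1)) [0..<n] else [])"

lemma sum_alternating: "odd s \<Longrightarrow> (\<Sum>p<s. (-1) ^ p :: int) = 1"
proof -
  have "(\<Sum>p<2 * h + 1. (-1) ^ p :: int) = 1" for h by (induction h) auto
  thus "odd s \<Longrightarrow> (\<Sum>p<s. (-1) ^ p :: int) = 1" by (auto elim: oddE)
qed

lemma gap_a_inputs:
  assumes "odd s" "x < n"
  shows "gap_a s (inputs s n k q r \<omega>) x = (if x < k * q then colA s (\<omega> (x div k)) else 1)"
  using assms sum_alternating[OF assms(1)] by (simp add: gap_a_def inputs_def colA_def)

lemma gap_b_inputs:
  assumes "odd s" "x < n"
  shows "gap_b s (inputs s n k q r \<omega>) x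
    = (if x < k * q then colB s (\<omega> (x div k)) else if x < k * q + r then -1 else 1)"
  using assms sum_alternating[OF assms(1)]
  by (simp add: gap_b_def inputs_def colB_def sum_negf)

lemma gap_Delta_inputs:
  assumes "odd s" "k > 0" "k * q + r \<le> n"
  shows "real_of_int (gap_Delta s n (inputs s n k q r \<omega>))
    = k * blockW s q \<omega> + (real n - k * q - 2 * r)"
proof -
  define g where "g = (\<lambda>x. gap_a s (inputs s n k q r \<omega>) x * gap_b s (inputs s n k q r \<omega>) x)"
  have "{..<n} = {..<k * q} \<union> ({k * q..<k * q + r} \<union> {k * q + r..<n})" using assms by auto
  hence "gap_Delta s n (inputs s n k q r \<omega>) = sum g ({..<k * q} \<union> ({k * q..<k * q + r} \<union> {k * q + r..<n}))"
    by (simp add: gap_Delta_def g_def)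
  also have "\<dots> = sum g {..<k * q} + (sum g {k * q..<k * q + r} + sum g {k * q + r..<n})"
    by (subst sum.union_disjoint, simp, simp, force, subst sum.union_disjoint) auto
  also have "sum g {k * q..<k * q + r} = (\<Sum>x\<in>{k * q..<k * q + r}. -1)"
    using assms by (intro sum.cong) (auto simp: g_def gap_a_inputs gap_b_inputs)
  also have "sum g {k * q + r..<n} = (\<Sum>x\<in>{k * q + r..<n}. 1)"
    using assms by (intro sum.cong) (auto simp: g_def gap_a_inputs gap_b_inputs)
  also have "sum g {..<k * q} = (\<Sum>x<k * q. colA s (\<omega> (x div k)) * colB s (\<omega> (x div k)))"
    using assms by (intro sum.cong) (auto simp: g_def gap_a_inputs gap_b_inputs)
  also have "\<dots> = (\<Sum>j<q. \<Sum>x\<in>{j * k..<j * k + k}. colA s (\<omega> (x div k)) * colB s (\<omega> (x div k)))"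
    by (subst sum.nat_group) (simp add: mult.commute)
  also have "\<dots> = (\<Sum>j<q. \<Sum>x\<in>{j * k..<j * k + k}. colA s (\<omega> j) * colB s (\<omega> j))"
  proof (intro sum.cong refl)
    fix j x assume "x \<in> {j * k..<j * k + k}"
    hence "x div k = j" using assms(2) by (intro div_nat_eqI) (auto simp: mult.commute)
    thus "colA s (\<omega> (x div k)) * colB s (\<omega> (x div k)) = colA s (\<omega> j) * colB s (\<omega> j)" by simp
  qed
  finally have "gap_Delta s n (inputs s n k q r \<omega>)
    = int k * (\<Sum>j<q. colA s (\<omega> j) * colB s (\<omega> j)) + (int (n - (k * q + r)) - int r)"
    by (simp add: sum_distrib_left)
  thus ?thesis using assms(3) by (simp add: blockW_def colw_def of_nat_diff)
qed

lemma gap_valid_inputs: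
  assumes "odd s" "k > 0" "\<omega> \<in> Omega s q"
  shows "gap_valid s n c2 (inputs s n k q r \<omega>)
    \<longleftrightarrow> \<bar>real_of_int (gap_Delta s n (inputs s n k q r \<omega>))\<bar> \<le> c2 * sqrt n"
proof -
  have col: "\<omega> (x div k) \<in> Cols s" if "x < k * q" for x
  proof -
    have "x div k < q" using that assms(2) by (simp add: div_less_iff_less_mult mult.commute)
    thus ?thesis using assms(3) by (auto simp: Omega_def)
  qed
  have "set (inputs s n k q r \<omega> p) \<subseteq> {-1, 1}" for p
  proof -
    have "(-1::int) ^ m = -1 \<or> (-1::int) ^ m = 1" for m by (cases "even m") auto
    from this[of p] this[of "p - s"] show ?thesis by (auto simp: inputs_def sg_def split: if_splits)
  qed
  moreover have "gap_a s (inputs s n k q r \<omega>) x \<in> {-1, 1} \<and> gap_b s (inputs s n k q r \<omega>) x \<in> {-1, 1}"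
    if "x < n" for x
    using col[of x] that assms(1) by (auto simp: gap_a_inputs gap_b_inputs Cols_def)
  moreover have "length (inputs s n k q r \<omega> p) = n" if "p < 2 * s" for p
    using that by (simp add: inputs_def)
  moreover have "inputs s n k q r \<omega> p = []" if "2 * s \<le> p" for p
    using that by (simp add: inputs_def)
  ultimately show ?thesis
    unfolding gap_valid_def by blast
qed

text \<open>This embeds a two-player problem: \<open>S\<close> is visible to player \<open>i\<close>
  alone, \<open>T\<close> to player \<open>s + i\<close> alone, and nobody else sees a
  difference.\<close>

lemma inputs_flip:
  assumes "i < s" "k > 0"
  shows "p \<noteq> i \<Longrightarrow> p \<noteq> s + i \<Longrightarrow> inputs s n k q r (flip s q i \<omega> S T) p = inputs s n k q r (flip s q i \<omega> S' T') p"
    and "inputs s n k q r (flip s q i \<omega> S T) i = inputs s n k q r (flip s q i \<omega> S T') i"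
    and "inputs s n k q r (flip s q i \<omega> S T) (s + i) = inputs s n k q r (flip s q i \<omega> S' T) (s + i)"
proof -
  have *: "inputs s n k q r (flip s q i \<omega> S T) p = inputs s n k q r (flip s q i \<omega> S' T') p"
    if tog: "\<And>j. j < q \<Longrightarrow> p \<in> toggled s i S T j \<longleftrightarrow> p \<in> toggled s i S' T' j" for p S T S' T'
  proof -
    have "sg (flip s q i \<omega> S T (x div k)) p = sg (flip s q i \<omega> S' T' (x div k)) p" if x: "x < k * q" for x
    proof -
      have "x div k < q" using x assms(2) by (simp add: div_less_iff_less_mult mult.commute)
      thus ?thesis using tog[of "x div k"] by (simp add: flip_def sg_sym_diff)
    qed
    thus ?thesis by (simp add: inputs_def)
  qed
  show "p \<noteq> i \<Longrightarrow> p \<noteq> s + i \<Longrightarrow> inputs s n k q r (flip s q i \<omega> S T) p = inputs s n k q r (flip s q i \<omega> S' T') p"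
    by (rule *) (auto simp: toggled_def)
  show "inputs s n k q r (flip s q i \<omega> S T) i = inputs s n k q r (flip s q i \<omega> S T') i"
    by (rule *) (simp add: toggled_iff[OF assms(1)])
  show "inputs s n k q r (flip s q i \<omega> S T) (s + i) = inputs s n k q r (flip s q i \<omega> S' T) (s + i)"
    by (rule *) (simp add: toggled_iff[OF assms(1)])
qed

section \<open>The lower bound\<close>

text \<open>The easy direction of Yao's principle: the expected number of failures on
  \<open>V\<close> is at most \<open>\<delta> * card V\<close>, so some protocol in the support does
  no worse.\<close>

lemma pmf_exists_few_failures:
  fixes R :: "'p pmf" and good :: "'x \<Rightarrow> 'p \<Rightarrow> bool" and \<delta> :: real
  assumes V: "finite V" and p: "\<And>x. x \<in> V \<Longrightarrow> 1 - \<delta> \<le> measure_pmf.prob R {P. good x P}"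
  shows "\<exists>P\<in>set_pmf R. card {x \<in> V. \<not> good x P} \<le> \<delta> * card V"
proof (rule ccontr)
  assume "\<not> ?thesis"
  hence gt: "\<delta> * card V < real (card {x \<in> V. \<not> good x P})" if "P \<in> set_pmf R" for P
    using that by (auto simp: not_le)
  have eq: "real (card {x \<in> V. \<not> good x P}) = (\<Sum>x\<in>V. indicator {P. \<not> good x P} P)" for P
    using V by (simp add: indicator_def Int_def)
  have int: "integrable (measure_pmf R) (\<lambda>P. \<Sum>x\<in>V. indicator {P. \<not> good x P} P :: real)"
    by (intro Bochner_Integration.integrable_sum) (auto simp: integrable_real_indicator less_top[symmetric])
  have "\<delta> * card V < measure_pmf.expectation R (\<lambda>P. \<Sum>x\<in>V. indicator {P. \<not> good x P} P)"
    using gt int unfolding eq by (intro measure_pmf.expectation_greater) (auto simp: AE_measure_pmf_iff)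
  also have "\<dots> = (\<Sum>x\<in>V. measure_pmf.prob R {P. \<not> good x P})"
    by (subst Bochner_Integration.integral_sum) (auto simp: integrable_real_indicator less_top[symmetric])
  also have "\<dots> \<le> (\<Sum>x\<in>V. \<delta>)"
  proof (intro sum_mono)
    fix x assume "x \<in> V"
    have "{P. \<not> good x P} = space (measure_pmf R) - {P. good x P}" by auto
    hence "measure_pmf.prob R {P. \<not> good x P} = 1 - measure_pmf.prob R {P. good x P}"
      using measure_pmf.prob_compl[of "{P. good x P}" R] by simp
    thus "measure_pmf.prob R {P. \<not> good x P} \<le> \<delta>" using p[OF \<open>x \<in> V\<close>] by linarith
  qed
  finally show False by (simp add: mult.commute)
qed

lemma abs_fejer_diff_le_1: "\<bar>fejer L x - fejer L y\<bar> \<le> 1"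
  using fejer_le_1[of L x] fejer_le_1[of L y] fejer_nonneg[of L x] fejer_nonneg[of L y] by linarith

text \<open>For \<open>\<bar>z\<bar> \<le> 2 * M\<close> the argument of the kernel has modulus at
  most 3, so \<open>fejer_decay\<close> applies outside the window. For larger
  \<open>\<bar>z\<bar>\<close> other peaks of the periodic kernel may interfere and only the bound 1
  is used.\<close>

lemma fejer_window:
  fixes z t \<epsilon> :: real and M K :: nat
  assumes "M > 0" "K > 0" "0 < \<epsilon>" "\<bar>t\<bar> \<le> M"
  shows "fejer (M * K) ((z - t) / M)
    \<le> of_bool (\<bar>z - t\<bar> \<le> \<epsilon>) + 16 / (K * \<epsilon>)\<^sup>2 + of_bool (2 * M < \<bar>z\<bar>)"
proof (cases "\<bar>z - t\<bar> \<le> \<epsilon> \<or> 2 * M < \<bar>z\<bar>")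
  case True
  hence "1 \<le> of_bool (\<bar>z - t\<bar> \<le> \<epsilon>) + (of_bool (2 * M < \<bar>z\<bar>) :: real)" by auto
  moreover have "0 \<le> 16 / (K * \<epsilon>)\<^sup>2" by simp
  ultimately show ?thesis using fejer_le_1[of "M * K" "(z - t) / M"] by linarith
next
  case False
  hence z: "\<epsilon> < \<bar>z - t\<bar>" "\<bar>z\<bar> \<le> 2 * M" by auto
  have "fejer (M * K) ((z - t) / M) \<le> 16 / (real (M * K) * ((z - t) / M))\<^sup>2"
  proof (rule fejer_decay)
    show "0 < M * K" using assms by simp
    show "(z - t) / M \<noteq> 0" using z assms by auto
    have "\<bar>z - t\<bar> \<le> 3 * real M" using z(2) assms(4) by linarith
    thus "\<bar>(z - t) / M\<bar> \<le> 3" using assms(1) by (simp add: field_simps)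
  qed
  also have "real (M * K) * ((z - t) / M) = K * (z - t)" using assms by simp
  also have "16 / (K * (z - t))\<^sup>2 \<le> 16 / (K * \<epsilon>)\<^sup>2"
  proof (rule divide_left_mono)
    have "\<epsilon>\<^sup>2 \<le> \<bar>z - t\<bar>\<^sup>2" using z assms by (intro power_mono) auto
    thus "(K * \<epsilon>)\<^sup>2 \<le> (K * (z - t))\<^sup>2" unfolding power_mult_distrib by (intro mult_left_mono) auto
  qed (use z assms in auto)
  finally show ?thesis using False by simp
qed

text \<open>
  In units of \<open>\<surd>n\<close>, the kernel \<open>fejer (M * K) (x / M)\<close> has width \<open>1 / K\<close> and period \<open>2 \<pi> M\<close>, and \<open>t\<close> is the
  centre of the window on which the answer is prescribed.
\<close>

locale gap_instance =
  fixes s n k q r M K :: nat and t :: real and p :: proto and st :: strategies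
  assumes s: "odd s" and k: "k > 0" and q: "q > 0" and M: "M > 0" and K: "K > 0" and t0: "0 \<le> t"
    and kqr: "k * q + r \<le> n" and kq: "real n \<le> 2 * (real k * real q)"
    and n_large: "2 * real K * real k \<le> sqrt n"
begin

definition z :: "(nat \<Rightarrow> nat set) \<Rightarrow> real" where
  "z \<omega> = real_of_int (gap_Delta s n (inputs s n k q r \<omega>)) / sqrt n"

definition gplus :: "(nat \<Rightarrow> nat set) \<Rightarrow> real" where
  "gplus \<omega> = fejer (M * K) ((z \<omega> - t) / M)"

definition gminus :: "(nat \<Rightarrow> nat set) \<Rightarrow> real" where
  "gminus \<omega> = fejer (M * K) ((z \<omega> + t) / M)"

definition out :: "(nat \<Rightarrow> nat set) \<Rightarrow> bool" where
  "out \<omega> = proto_output (p, st) (inputs s n k q r \<omega>)"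

definition heard :: "nat \<Rightarrow> (nat \<Rightarrow> nat set) \<Rightarrow> bool list" where
  "heard i \<omega> = heard_from {i, s + i} p st (inputs s n k q r \<omega>) (\<lambda>_. [])"

text \<open>A positive answer is right on the window around \<open>t\<close> and wrong on that
  around \<open>- t\<close>. An accurate protocol with short transcripts would therefore make the
  sum of this quantity nearly that of \<open>gplus\<close>, whereas the rectangle estimate makes it
  small.\<close>

definition discrepancy :: "nat \<Rightarrow> nat \<Rightarrow> (nat \<Rightarrow> nat set) \<Rightarrow> real" where
  "discrepancy i B \<omega> = (if length (heard i \<omega>) \<le> B \<and> out \<omega> then gplus \<omega> - gminus \<omega> else 0)"

lemma n_pos: "n > 0"
  using kqr k q by (metis add_is_0 gr0I le_zero_eq mult_is_0 not_gr0)

lemma z_eq: "z \<omega> = (k * blockW s q \<omega> + (real n - k * q - 2 * r)) / sqrt n"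
  by (simp add: z_def gap_Delta_inputs[OF s k kqr])

lemma abs_discrepancy_le_1: "\<bar>discrepancy i B \<omega>\<bar> \<le> 1"
  using abs_fejer_diff_le_1 by (simp add: discrepancy_def gplus_def gminus_def)

lemma heard_rectangle:
  assumes i: "i < s" and eq: "heard i (flip s q i \<omega> S T) = heard i (flip s q i \<omega> S' T')"
  shows "heard i (flip s q i \<omega> S T') = heard i (flip s q i \<omega> S T)"
    and "out (flip s q i \<omega> S T) = out (flip s q i \<omega> S' T')"
proof -
  let ?x = "\<lambda>S T. inputs s n k q r (flip s q i \<omega> S T)"
  have off: "?x S T j = ?x S' T' j" if "j \<notin> {i, s + i}" for j
    using that inputs_flip(1)[OF i k] by simp
  show "heard i (flip s q i \<omega> S T') = heard i (flip s q i \<omega> S T)"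
    unfolding heard_def
  proof (rule heard_from_mix)
    show "?x S T' j = ?x S T j \<or> ?x S T' j = ?x S' T' j" for j
    proof (cases "j = s + i")
      case True
      thus ?thesis using inputs_flip(3)[OF i k] by simp
    next
      case False
      thus ?thesis using inputs_flip(1,2)[OF i k] by (cases "j = i") auto
    qed
  qed (use off eq in \<open>auto simp: heard_def\<close>)
  show "out (flip s q i \<omega> S T) = out (flip s q i \<omega> S' T')"
    unfolding out_def proto_output_def
    using run_eq_if_heard_from_eq[of "{i, s + i}" "?x S T" "?x S' T'" p st "\<lambda>_. []"] off eq
    by (simp add: heard_def)
qed

lemma discrepancy_good:
  assumes i: "i < s" and \<omega>: "\<omega> \<in> Omega s q" and F: "q \<le> 16 * card (free_blocks s q i \<omega>)"
  defines "F \<equiv> free_blocks s q i \<omega>"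
  shows "(\<Sum>S\<in>Pow F. \<Sum>T\<in>Pow F. discrepancy i B (flip s q i \<omega> S T)) / 4 ^ card F
    \<le> 4096 * t / (k * K) + 2 ^ (B + 1) * 2 powr (- (q / 1024))"
proof -
  define w where "w = (\<lambda>j. colw s (\<omega> j))"
  \<comment> \<open>Parameters for \<open>fejer_shift_rectangle\<close>, with
    \<open>z \<omega> / M\<close> as the kernel variable: \<open>\<phi>\<close> is the weight of one
    free block, \<open>\<psi>\<close> the constant from the other blocks and the padding. From
    \<open>n \<le> 2 * k * q\<close> and \<open>q \<le> 16 * card F\<close> the Gaussian rate is at
    least \<open>a\<close>, as 1024 = 32 * 2 * 16.\<close>
  define \<phi> \<psi> \<eta> a where "\<phi> = k / (M * sqrt n)"
    and "\<psi> = (k * (\<Sum>j\<in>{..<q} - F. w j) + (real n - k * q - 2 * r)) / (M * sqrt n)"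
    and "\<eta> = t / M" and "a = k / (1024 * (real M)\<^sup>2)"
  define \<theta> where "\<theta> = 2 powr (card F * (1 - 1/64))"
  define f where "f = (\<lambda>S T. gplus (flip s q i \<omega> S T) - gminus (flip s q i \<omega> S T))"
  have finF: "finite F" unfolding F_def by (rule finite_free_blocks)
  have cF: "real q \<le> 16 * real (card F)" using F by (simp add: F_def)
  have sn: "sqrt n > 0" using n_pos by simp
  have w: "w j \<in> {-1, 1}" if "j \<in> F" for j
    using that \<omega> colw_values by (auto simp: w_def F_def free_blocks_def Omega_def)
  have feq: "f S T = fejer (M * K) (\<phi> * bil F w S T + (\<psi> - \<eta>)) - fejer (M * K) (\<phi> * bil F w S T + (\<psi> + \<eta>))"
    if "S \<in> Pow F" "T \<in> Pow F" for S T
  proof -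
    have "blockW s q (flip s q i \<omega> S T) = bil F w S T + (\<Sum>j\<in>{..<q} - F. w j)"
      using that unfolding F_def w_def by (intro blockW_flip[OF i]) auto
    hence "z (flip s q i \<omega> S T) / M = \<phi> * bil F w S T + \<psi>"
      unfolding z_eq \<phi>_def \<psi>_def by (simp add: add_divide_distrib[symmetric] algebra_simps)
    thus ?thesis
      by (simp add: f_def gplus_def gminus_def \<eta>_def diff_divide_distrib add_divide_distrib algebra_simps)
  qed
  have a: "0 < a" using k M by (simp add: a_def)
  have a_le: "a \<le> card F * \<phi>\<^sup>2 / 32"
  proof -
    have \<phi>2: "\<phi>\<^sup>2 = (real k)\<^sup>2 / ((real M)\<^sup>2 * real n)"
      using n_pos by (simp add: \<phi>_def power_divide power_mult_distrib)
    have "real n * real k \<le> 2 * (real k * real q) * real k" using kq by (rule mult_right_mono) simp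
    moreover have "2 * (real k * real q) * real k \<le> 2 * (real k * (16 * real (card F))) * real k"
      using cF by (intro mult_right_mono mult_left_mono) auto
    ultimately have "real k * real n \<le> 32 * (card F * (real k)\<^sup>2)" by (simp add: power2_eq_square mult_ac)
    hence "real k * real n / (1024 * (real M)\<^sup>2 * real n) \<le> 32 * (card F * (real k)\<^sup>2) / (1024 * (real M)\<^sup>2 * real n)"
      by (rule divide_right_mono) simp
    moreover have "real k * real n / (1024 * (real M)\<^sup>2 * real n) = a" using n_pos by (simp add: a_def)
    moreover have "card F * \<phi>\<^sup>2 / 32 = 32 * (card F * (real k)\<^sup>2) / (1024 * (real M)\<^sup>2 * real n)"
      by (simp add: \<phi>2)
    ultimately show ?thesis by simp
  qed
  have Dval: "4 * \<eta> / (a * real (M * K)) = 4096 * t / (k * K)"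
    using M K k by (simp add: \<eta>_def a_def power2_eq_square)
  have main: "\<bar>\<Sum>S\<in>Pow F. \<Sum>T\<in>Pow F. if length (heard i (flip s q i \<omega> S T)) \<le> B \<and> out (flip s q i \<omega> S T) then f S T else 0\<bar>
    \<le> 4 ^ card F * (4096 * t / (k * K)) + 2 ^ (B + 1) * (2 ^ card F * \<theta>)"
  proof (rule rectangle_partition_bound[OF finF])
    fix S T S' T' assume "heard i (flip s q i \<omega> S T) = heard i (flip s q i \<omega> S' T')"
    from heard_rectangle[OF i this]
    show "heard i (flip s q i \<omega> S T') = heard i (flip s q i \<omega> S T)"
      and "out (flip s q i \<omega> S T) = out (flip s q i \<omega> S' T')" .
  next
    fix A C assume AC: "A \<subseteq> Pow F" "C \<subseteq> Pow F" "\<theta> \<le> card A" "\<theta> \<le> card C"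
    have "(\<Sum>S\<in>A. \<Sum>T\<in>C. f S T) = (\<Sum>S\<in>A. \<Sum>T\<in>C. fejer (M * K) (\<phi> * bil F w S T + (\<psi> - \<eta>)) - fejer (M * K) (\<phi> * bil F w S T + (\<psi> + \<eta>)))"
      using AC by (intro sum.cong refl feq) auto
    also have "\<bar>\<dots>\<bar> \<le> card A * card C * (4 * \<eta> / (a * real (M * K)))"
    proof (rule fejer_shift_rectangle[OF finF])
      have "\<bar>\<phi>\<bar> = real k / (real M * sqrt n)" using sn by (simp add: \<phi>_def)
      hence "2 * real (M * K) * \<bar>\<phi>\<bar> = 2 * real K * real k / sqrt n" using M by simp
      moreover have "2 * real K * real k / sqrt n \<le> 1"
        using n_large by (simp only: pos_divide_le_eq[OF sn] mult_1_left)
      ultimately show "2 * real (M * K) * \<bar>\<phi>\<bar> \<le> 1" by (simp only:)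
    qed (use w AC M K t0 a a_le in \<open>auto simp: \<theta>_def \<eta>_def\<close>)
    finally show "\<bar>\<Sum>S\<in>A. \<Sum>T\<in>C. f S T\<bar> \<le> card A * card C * (4096 * t / (k * K))"
      unfolding Dval by simp
  next
    fix S T
    show "\<bar>f S T\<bar> \<le> 1"
      unfolding f_def gplus_def gminus_def by (rule abs_fejer_diff_le_1)
  qed (use t0 in \<open>auto simp: \<theta>_def\<close>)
  have small: "2 ^ card F * \<theta> \<le> 4 ^ card F * 2 powr (- (q / 1024))"
  proof -
    have "2 ^ card F * \<theta> = 2 powr (2 * card F - card F / 64)"
      by (simp add: \<theta>_def powr_realpow[symmetric] powr_add[symmetric] algebra_simps)
    also have "\<dots> \<le> 2 powr (2 * card F - q / 1024)" using cF by (intro powr_mono) auto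
    also have "\<dots> = 2 powr (2 * card F) * 2 powr (- (q / 1024))"
      by (simp add: powr_add[symmetric])
    also have "(2::real) powr (2 * card F) = 2 ^ (2 * card F)"
      using powr_realpow[of 2 "2 * card F"] by simp
    also have "(2::real) ^ (2 * card F) = 4 ^ card F" by (simp add: power_mult)
    finally show ?thesis .
  qed
  have "(\<Sum>S\<in>Pow F. \<Sum>T\<in>Pow F. discrepancy i B (flip s q i \<omega> S T))
      = (\<Sum>S\<in>Pow F. \<Sum>T\<in>Pow F. if length (heard i (flip s q i \<omega> S T)) \<le> B \<and> out (flip s q i \<omega> S T) then f S T else 0)"
    unfolding discrepancy_def f_def ..
  also have "\<dots> \<le> 4 ^ card F * (4096 * t / (k * K)) + 2 ^ (B + 1) * (2 ^ card F * \<theta>)"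
    using main by linarith
  also have "\<dots> \<le> 4 ^ card F * (4096 * t / (k * K)) + 2 ^ (B + 1) * (4 ^ card F * 2 powr (- (q / 1024)))"
    using small by (intro add_left_mono mult_left_mono) auto
  also have "\<dots> = (4096 * t / (k * K) + 2 ^ (B + 1) * 2 powr (- (q / 1024))) * 4 ^ card F"
    by (simp only: distrib_left distrib_right mult_ac)
  finally show ?thesis by (simp only: pos_divide_le_eq zero_less_power zero_less_numeral)
qed

lemma sum_discrepancy:
  assumes i: "i < s"
  shows "(\<Sum>\<omega>\<in>Omega s q. discrepancy i B \<omega>)
    \<le> card (Omega s q) * (4096 * t / (k * K) + 2 ^ (B + 1) * 2 powr (- (q / 1024)) + (119 / 128) ^ q)"
proof -
  define D where "D = 4096 * t / (k * K) + 2 ^ (B + 1) * 2 powr (- (q / 1024))"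
  have D0: "0 \<le> D" using t0 by (simp add: D_def)
  define F where "F = free_blocks s q i"
  define av where "av = (\<lambda>\<omega>. (\<Sum>S\<in>Pow (F \<omega>). \<Sum>T\<in>Pow (F \<omega>). discrepancy i B (flip s q i \<omega> S T)) / 4 ^ card (F \<omega>))"
  have bound: "av \<omega> \<le> D + of_bool (16 * card (F \<omega>) < q)" if "\<omega> \<in> Omega s q" for \<omega>
  proof (cases "16 * card (F \<omega>) < q")
    case False
    thus ?thesis using discrepancy_good[OF i that, of B] by (simp add: av_def F_def D_def)
  next
    case True
    have "(\<Sum>S\<in>Pow (F \<omega>). \<Sum>T\<in>Pow (F \<omega>). discrepancy i B (flip s q i \<omega> S T))
        \<le> (\<Sum>S\<in>Pow (F \<omega>). \<Sum>T\<in>Pow (F \<omega>). 1)"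
      using abs_discrepancy_le_1 by (intro sum_mono) (simp add: abs_le_iff)
    also have "\<dots> = 4 ^ card (F \<omega>)"
      using finite_free_blocks by (simp add: F_def card_Pow power_mult_distrib[symmetric])
    finally have "av \<omega> \<le> 1" by (simp add: av_def)
    thus ?thesis using True D0 by simp
  qed
  have "(\<Sum>\<omega>\<in>Omega s q. discrepancy i B \<omega>) = (\<Sum>\<omega>\<in>Omega s q. av \<omega>)"
    unfolding av_def F_def by (rule sum_Omega_flip[OF i])
  also have "\<dots> \<le> (\<Sum>\<omega>\<in>Omega s q. D + of_bool (16 * card (F \<omega>) < q))" by (intro sum_mono bound)
  also have "\<dots> = card (Omega s q) * D + card {\<omega> \<in> Omega s q. 16 * card (free_blocks s q i \<omega>) < q}"
    by (simp add: sum.distrib finite_Omega F_def Int_def)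
  also have "\<dots> \<le> card (Omega s q) * D + card (Omega s q) * (119 / 128) ^ q"
    by (intro add_left_mono card_few_free_blocks[OF s i])
  finally show ?thesis by (simp add: D_def distrib_left)
qed

lemma abs_z_large:
  assumes M4: "4 * sqrt k \<le> M" and pad: "real n - k * q \<le> 4 * sqrt k * sqrt n"
    and large: "2 * M < \<bar>z \<omega>\<bar>"
  shows "M * sqrt n / k \<le> \<bar>blockW s q \<omega>\<bar>"
proof -
  have sn: "sqrt n > 0" using n_pos by simp
  have "real k * real q + real r \<le> real n" using kqr by (metis of_nat_add of_nat_le_iff of_nat_mult)
  hence e: "\<bar>real n - k * q - 2 * r\<bar> \<le> 4 * sqrt k * sqrt n" using pad by simp
  have "2 * M * sqrt n < \<bar>z \<omega>\<bar> * sqrt n" using large sn by simp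
  also have "\<dots> = \<bar>k * blockW s q \<omega> + (real n - k * q - 2 * r)\<bar>" using sn by (simp add: z_eq)
  also have "\<dots> \<le> k * \<bar>blockW s q \<omega>\<bar> + 4 * sqrt k * sqrt n"
    using e abs_triangle_ineq[of "k * blockW s q \<omega>" "real n - k * q - 2 * r"] by (simp add: abs_mult)
  also have "4 * sqrt k * sqrt n \<le> M * sqrt n" using M4 sn by (intro mult_right_mono) auto
  finally have "M * sqrt n \<le> \<bar>blockW s q \<omega>\<bar> * k" by (simp add: mult_ac)
  thus ?thesis using k by (simp add: pos_divide_le_eq)
qed

text \<open>Chebyshev: apart from a padding term of order \<open>sqrt k\<close>, \<open>z\<close>
  has standard deviation at most \<open>sqrt k\<close>, so a large \<open>M\<close> makes the region
  of the further kernel peaks negligible.\<close>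

lemma card_abs_z_large:
  assumes M4: "4 * sqrt k \<le> M" and pad: "real n - k * q \<le> 4 * sqrt k * sqrt n"
  shows "card {\<omega> \<in> Omega s q. 2 * M < \<bar>z \<omega>\<bar>} \<le> k / (real M)\<^sup>2 * card (Omega s q)"
proof -
  have "card {\<omega> \<in> Omega s q. 2 * M < \<bar>z \<omega>\<bar>} \<le> card {\<omega> \<in> Omega s q. M * sqrt n / k \<le> \<bar>blockW s q \<omega>\<bar>}"
    using abs_z_large[OF M4 pad] finite_Omega by (intro card_mono) auto
  also have "real (card {\<omega> \<in> Omega s q. M * sqrt n / k \<le> \<bar>blockW s q \<omega>\<bar>})
      \<le> q / (M * sqrt n / k)\<^sup>2 * card (Omega s q)"
    using s M k n_pos by (intro card_large_blockW) (auto intro: odd_pos)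
  also have "q / (M * sqrt n / k)\<^sup>2 \<le> k / (real M)\<^sup>2"
  proof -
    have "real k * real q \<le> real n" using kqr by (metis add_leD1 of_nat_le_iff of_nat_mult)
    hence "real k * (real k * real q) \<le> real k * real n" by (rule mult_left_mono) simp
    hence "real k * (real k * real q) / ((real M)\<^sup>2 * real n) \<le> real k * real n / ((real M)\<^sup>2 * real n)"
      by (rule divide_right_mono) simp
    moreover have "q / (M * sqrt n / k)\<^sup>2 = real k * (real k * real q) / ((real M)\<^sup>2 * real n)"
      by (simp add: power_divide power_mult_distrib) (simp add: power2_eq_square)
    moreover have "real k * real n / ((real M)\<^sup>2 * real n) = k / (real M)\<^sup>2" using n_pos by simp
    ultimately show ?thesis by simp
  qed
  finally show ?thesis by (simp add: mult_right_mono)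
qed

definition valid :: "real \<Rightarrow> (nat \<Rightarrow> nat set) \<Rightarrow> bool" where
  "valid c2 \<omega> = gap_valid s n c2 (inputs s n k q r \<omega>)"

definition wrong :: "real \<Rightarrow> (nat \<Rightarrow> nat set) \<Rightarrow> bool" where
  "wrong c1 \<omega> = (\<not> gap_correct s n c1 (inputs s n k q r \<omega>) (out \<omega>))"

lemma window:
  assumes \<omega>: "\<omega> \<in> Omega s q" and c: "0 < c1" "c1 < c2" and t: "t = (c1 + c2) / 2"
  shows "\<bar>z \<omega> - t\<bar> \<le> (c2 - c1) / 2 \<Longrightarrow> valid c2 \<omega> \<and> (\<not> out \<omega> \<longrightarrow> wrong c1 \<omega>)"
    and "\<bar>z \<omega> + t\<bar> \<le> (c2 - c1) / 2 \<Longrightarrow> valid c2 \<omega> \<and> (out \<omega> \<longrightarrow> wrong c1 \<omega>)"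
proof -
  define x where "x = inputs s n k q r \<omega>"
  have sn: "sqrt n > 0" using n_pos by simp
  have \<Delta>: "real_of_int (gap_Delta s n x) = z \<omega> * sqrt n" using sn by (simp add: z_def x_def)
  have val: "valid c2 \<omega>" if "\<bar>z \<omega>\<bar> \<le> c2"
  proof -
    have "valid c2 \<omega> \<longleftrightarrow> \<bar>real_of_int (gap_Delta s n x)\<bar> \<le> c2 * sqrt n"
      by (simp only: valid_def gap_valid_inputs[OF s k \<omega>] x_def)
    moreover have "\<bar>z \<omega>\<bar> * sqrt n \<le> c2 * sqrt n" using that sn by (intro mult_right_mono) auto
    ultimately show ?thesis using sn unfolding \<Delta> by (simp add: abs_mult)
  qed
  {
    assume "\<bar>z \<omega> - t\<bar> \<le> (c2 - c1) / 2"
    hence "c1 \<le> z \<omega>" "z \<omega> \<le> c2" unfolding t abs_le_iff by (simp_all add: field_simps)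
    moreover from this have "c1 * sqrt n \<le> z \<omega> * sqrt n" using sn by (intro mult_right_mono) auto
    ultimately show "valid c2 \<omega> \<and> (\<not> out \<omega> \<longrightarrow> wrong c1 \<omega>)"
      using val c by (auto simp: wrong_def gap_correct_def x_def[symmetric] \<Delta>)
  }
  {
    assume "\<bar>z \<omega> + t\<bar> \<le> (c2 - c1) / 2"
    hence "z \<omega> \<le> - c1" "- c2 \<le> z \<omega>" unfolding t abs_le_iff by (simp_all add: field_simps)
    moreover from this have "z \<omega> * sqrt n \<le> - c1 * sqrt n" using sn by (intro mult_right_mono) auto
    ultimately show "valid c2 \<omega> \<and> (out \<omega> \<longrightarrow> wrong c1 \<omega>)"
      using val c by (auto simp: wrong_def gap_correct_def x_def[symmetric] \<Delta>)
  }
qed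

text \<open>Short transcript, positive answer: beyond \<open>discrepancy\<close> there remains
  \<open>gminus \<omega>\<close>, which lives mostly on the window around \<open>- t\<close>, where
  this answer is wrong. Short transcript, negative answer: \<open>discrepancy\<close> is 0 and
  \<open>gplus \<omega>\<close> lives mostly on the window around \<open>t\<close>, where the answer
  is wrong. On a long transcript the window part is charged to the length.\<close>

lemma gplus_le:
  assumes \<omega>: "\<omega> \<in> Omega s q" and c: "0 < c1" "c1 < c2" and t: "t = (c1 + c2) / 2" and tM: "t \<le> M"
  defines "\<tau> \<equiv> 16 / (K * ((c2 - c1) / 2))\<^sup>2"
  shows "gplus \<omega> \<le> discrepancy i B \<omega> + 2 * of_bool (valid c2 \<omega> \<and> wrong c1 \<omega>)
    + of_bool (valid c2 \<omega> \<and> B < length (heard i \<omega>)) + 3 * \<tau> + 3 * of_bool (2 * M < \<bar>z \<omega>\<bar>)"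
proof -
  have \<epsilon>: "0 < (c2 - c1) / 2" using c by simp
  have gp: "gplus \<omega> \<le> of_bool (\<bar>z \<omega> - t\<bar> \<le> (c2 - c1) / 2) + \<tau> + of_bool (2 * M < \<bar>z \<omega>\<bar>)"
    unfolding gplus_def \<tau>_def using t0 tM by (intro fejer_window[OF M K \<epsilon>]) auto
  have gm: "gminus \<omega> \<le> of_bool (\<bar>z \<omega> + t\<bar> \<le> (c2 - c1) / 2) + \<tau> + of_bool (2 * M < \<bar>z \<omega>\<bar>)"
    using fejer_window[OF M K \<epsilon>, of "- t" "z \<omega>"] t0 tM by (simp add: gminus_def \<tau>_def)
  define u v X where "u = (of_bool (valid c2 \<omega> \<and> wrong c1 \<omega>) :: real)"
    and "v = (of_bool (valid c2 \<omega> \<and> B < length (heard i \<omega>)) :: real)"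
    and "X = (of_bool (2 * M < \<bar>z \<omega>\<bar>) :: real)"
  have nn: "0 \<le> \<tau>" "0 \<le> u" "0 \<le> v" "0 \<le> X" by (simp_all add: \<tau>_def u_def v_def X_def)
  consider "length (heard i \<omega>) \<le> B" "out \<omega>" | "length (heard i \<omega>) \<le> B" "\<not> out \<omega>" | "B < length (heard i \<omega>)"
    by linarith
  thus ?thesis
  proof cases
    case 1
    hence "of_bool (\<bar>z \<omega> + t\<bar> \<le> (c2 - c1) / 2) \<le> (of_bool (valid c2 \<omega> \<and> wrong c1 \<omega>) :: real)"
      using window(2)[OF \<omega> c t] by auto
    moreover have "discrepancy i B \<omega> = gplus \<omega> - gminus \<omega>" using 1 by (simp add: discrepancy_def)
    ultimately show ?thesis using gm nn unfolding u_def[symmetric] v_def[symmetric] X_def[symmetric] by linarith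
  next
    case 2
    hence "of_bool (\<bar>z \<omega> - t\<bar> \<le> (c2 - c1) / 2) \<le> (of_bool (valid c2 \<omega> \<and> wrong c1 \<omega>) :: real)"
      using window(1)[OF \<omega> c t] by auto
    moreover have "discrepancy i B \<omega> = 0" using 2 by (simp add: discrepancy_def)
    ultimately show ?thesis using gp nn unfolding u_def[symmetric] v_def[symmetric] X_def[symmetric] by linarith
  next
    case 3
    hence "of_bool (\<bar>z \<omega> - t\<bar> \<le> (c2 - c1) / 2) \<le> (of_bool (valid c2 \<omega> \<and> B < length (heard i \<omega>)) :: real)"
      using window(1)[OF \<omega> c t] by auto
    moreover have "discrepancy i B \<omega> = 0" using 3 by (simp add: discrepancy_def)
    ultimately show ?thesis using gp nn unfolding u_def[symmetric] v_def[symmetric] X_def[symmetric] by linarith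
  qed
qed

lemma sum_gplus_le:
  assumes i: "i < s" and c: "0 < c1" "c1 < c2" and t: "t = (c1 + c2) / 2" and tM: "t \<le> M"
    and M4: "4 * sqrt k \<le> M" and pad: "real n - k * q \<le> 4 * sqrt k * sqrt n"
  shows "(\<Sum>\<omega>\<in>Omega s q. gplus \<omega>) \<le> card (Omega s q) *
      (4096 * t / (k * K) + 2 ^ (B + 1) * 2 powr (- (q / 1024)) + (119 / 128) ^ q
        + 48 / (K * ((c2 - c1) / 2))\<^sup>2 + 3 * (k / (real M)\<^sup>2))
    + 2 * card {\<omega> \<in> Omega s q. valid c2 \<omega> \<and> wrong c1 \<omega>}
    + card {\<omega> \<in> Omega s q. valid c2 \<omega> \<and> B < length (heard i \<omega>)}"
proof -
  define \<tau> where "\<tau> = 16 / (K * ((c2 - c1) / 2))\<^sup>2"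
  have "(\<Sum>\<omega>\<in>Omega s q. gplus \<omega>) \<le> (\<Sum>\<omega>\<in>Omega s q. discrepancy i B \<omega>
     + 2 * of_bool (valid c2 \<omega> \<and> wrong c1 \<omega>)
     + of_bool (valid c2 \<omega> \<and> B < length (heard i \<omega>)) + 3 * \<tau> + 3 * of_bool (2 * M < \<bar>z \<omega>\<bar>))"
    unfolding \<tau>_def by (intro sum_mono gplus_le c t tM)
  also have "\<dots> = (\<Sum>\<omega>\<in>Omega s q. discrepancy i B \<omega>)
     + 2 * (\<Sum>\<omega>\<in>Omega s q. of_bool (valid c2 \<omega> \<and> wrong c1 \<omega>))
     + (\<Sum>\<omega>\<in>Omega s q. of_bool (valid c2 \<omega> \<and> B < length (heard i \<omega>)))
     + (\<Sum>\<omega>\<in>Omega s q. 3 * \<tau>) + 3 * (\<Sum>\<omega>\<in>Omega s q. of_bool (2 * M < \<bar>z \<omega>\<bar>))"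
    by (simp only: sum.distrib sum_distrib_left)
  also have "\<dots> = (\<Sum>\<omega>\<in>Omega s q. discrepancy i B \<omega>)
     + 2 * card {\<omega> \<in> Omega s q. valid c2 \<omega> \<and> wrong c1 \<omega>}
     + card {\<omega> \<in> Omega s q. valid c2 \<omega> \<and> B < length (heard i \<omega>)}
     + card (Omega s q) * (3 * \<tau>) + 3 * card {\<omega> \<in> Omega s q. 2 * M < \<bar>z \<omega>\<bar>}"
    by (simp add: finite_Omega Int_def)
  finally have "(\<Sum>\<omega>\<in>Omega s q. gplus \<omega>) \<le> \<dots>" .
  moreover have t48: "48 / (K * ((c2 - c1) / 2))\<^sup>2 = 3 * \<tau>" by (simp add: \<tau>_def)
  moreover define X Y N where "X = 4096 * t / (real k * real K) + 2 ^ (B + 1) * 2 powr (- (q / 1024)) + (119 / 128) ^ q"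
    and "Y = k / (real M)\<^sup>2" and "N = real (card (Omega s q))"
  moreover have "(\<Sum>\<omega>\<in>Omega s q. discrepancy i B \<omega>) \<le> N * X"
    unfolding N_def X_def of_nat_mult[symmetric] by (rule sum_discrepancy[OF i])
  moreover have "3 * real (card {\<omega> \<in> Omega s q. 2 * M < \<bar>z \<omega>\<bar>}) \<le> 3 * (Y * N)"
    unfolding N_def Y_def using card_abs_z_large[OF M4 pad] by (intro mult_left_mono) auto
  moreover have "N * (X + 3 * \<tau> + 3 * Y) = N * X + N * (3 * \<tau>) + 3 * (Y * N)"
    by (simp only: distrib_left mult_ac)
  ultimately show ?thesis
    unfolding of_nat_mult of_nat_numeral t48 X_def[symmetric] Y_def[symmetric] N_def[symmetric] by linarith
qed

text \<open>Double counting over pairs and inputs, then Markov: a transcript longer than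
  \<open>B\<close> has at least \<open>B + 1\<close> bits. The pair is chosen once for the whole
  input distribution, as the resampling argument requires.\<close>

lemma exists_quiet_player:
  fixes B C :: nat
  assumes cost: "\<And>\<omega>. \<omega> \<in> Omega s q \<Longrightarrow> valid c2 \<omega> \<Longrightarrow> proto_cost (p, st) (inputs s n k q r \<omega>) \<le> C"
  shows "\<exists>i<s. real s * (B + 1) * card {\<omega> \<in> Omega s q. valid c2 \<omega> \<and> B < length (heard i \<omega>)}
    \<le> real C * card (Omega s q)"
proof (rule ccontr)
  define V where "V = {\<omega> \<in> Omega s q. valid c2 \<omega>}"
  define N where "N = (\<lambda>i. card {\<omega> \<in> Omega s q. valid c2 \<omega> \<and> B < length (heard i \<omega>)})"
  assume "\<not> ?thesis"
  hence gt: "C * card (Omega s q) < s * (B + 1) * N i" if "i < s" for i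
    using that unfolding N_def by (metis (no_types, lifting) not_le of_nat_less_iff of_nat_mult of_nat_add of_nat_1)
  have V: "finite V" "V \<subseteq> Omega s q" using finite_Omega by (auto simp: V_def)
  have Nb: "(B + 1) * N i \<le> (\<Sum>\<omega>\<in>V. length (heard i \<omega>))" for i
  proof -
    have "(B + 1) * N i = (\<Sum>\<omega>\<in>{\<omega> \<in> Omega s q. valid c2 \<omega> \<and> B < length (heard i \<omega>)}. B + 1)"
      by (simp add: N_def)
    also have "\<dots> \<le> (\<Sum>\<omega>\<in>{\<omega> \<in> Omega s q. valid c2 \<omega> \<and> B < length (heard i \<omega>)}. length (heard i \<omega>))"
      by (intro sum_mono) auto
    also have "\<dots> \<le> (\<Sum>\<omega>\<in>V. length (heard i \<omega>))"
      using V by (intro sum_mono2) (auto simp: V_def)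
    finally show ?thesis .
  qed
  have s0: "s > 0" using s by (rule odd_pos)
  have "(\<Sum>i<s. C * card (Omega s q)) < (\<Sum>i<s. s * (B + 1) * N i)"
    using gt s0 by (intro sum_strict_mono) auto
  also have "\<dots> = s * (\<Sum>i<s. (B + 1) * N i)" by (simp only: sum_distrib_left mult.assoc)
  also have "\<dots> \<le> s * (\<Sum>i<s. \<Sum>\<omega>\<in>V. length (heard i \<omega>))"
    using Nb by (intro mult_left_mono sum_mono) auto
  also have "(\<Sum>i<s. \<Sum>\<omega>\<in>V. length (heard i \<omega>)) = (\<Sum>\<omega>\<in>V. \<Sum>i<s. length (heard i \<omega>))"
    by (rule sum.swap)
  also have "\<dots> \<le> (\<Sum>\<omega>\<in>V. C)"
  proof (intro sum_mono)
    fix \<omega> assume "\<omega> \<in> V"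
    hence "snd (run p st (inputs s n k q r \<omega>) (\<lambda>_. [])) \<le> C"
      using cost by (auto simp: V_def proto_cost_def)
    thus "(\<Sum>i<s. length (heard i \<omega>)) \<le> C"
      unfolding heard_def by (intro order.trans[OF sum_heard_from_le_cost]) auto
  qed
  also have "\<dots> = C * card V" by simp
  also have "C * card V \<le> C * card (Omega s q)"
    using V finite_Omega by (intro mult_left_mono card_mono) auto
  finally show False by simp
qed

end

text \<open>For three quarters of the column choices the block sum is moderate, and then some grid
  value of \<open>r\<close> brings the normalised inner product within \<open>1 / K\<close> of
  \<open>t\<close>, where the kernel is at least 1/4. The grid has at most
  \<open>32 * sqrt k * K\<close> values, so one of them serves a sufficient share of all
  choices.\<close>

lemma exists_padding:
  fixes t :: real
  assumes s: "odd s" and k: "k > 0" and q: "q > 0" and M: "M > 0" and K: "K > 0" and t0: "0 \<le> t"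
    and kq: "k * q \<le> n" and lower: "(2 * sqrt k + t) * sqrt n \<le> real n - k * q"
    and upper: "real n - k * q \<le> 4 * sqrt k * sqrt n" and n: "2 * real K \<le> sqrt n"
  shows "\<exists>r. k * q + r \<le> n \<and> card (Omega s q) / (200 * sqrt k * K)
    \<le> (\<Sum>\<omega>\<in>Omega s q. fejer (M * K) ((real_of_int (gap_Delta s n (inputs s n k q r \<omega>)) / sqrt n - t) / M))"
proof -
  define O' where "O' = real (card (Omega s q))"
  define Lp where "Lp = n - k * q"
  have Lp: "real Lp = real n - k * q" using kq by (simp add: Lp_def of_nat_diff)
  have sn: "sqrt n > 0"
  proof -
    have "0 < 2 * real K" using K by simp
    thus ?thesis using n by linarith
  qed
  \<comment> \<open>Grid step: raising \<open>r\<close> by \<open>H\<close> lowers the inner product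
    by \<open>2 * H\<close>, at most \<open>sqrt n / K\<close>, the width of the kernel.\<close>
  define H where "H = nat \<lfloor>sqrt n / (2 * K)\<rfloor>"
  have y1: "1 \<le> sqrt n / (2 * K)" using n K by (simp add: field_simps)
  have H: "real H \<le> sqrt n / (2 * K)" "sqrt n / (2 * K) < real H + 1"
    using y1 unfolding H_def by (simp_all add: floor_less_iff)
  have H1: "1 \<le> H" using y1 unfolding H_def by (simp add: le_nat_floor)
  have H4: "sqrt n / (4 * K) \<le> H" using H(2) H1 by (simp add: field_simps)
  define G where "G = Lp div H"
  define g where "g = (\<lambda>a \<omega>. fejer (M * K) ((real_of_int (gap_Delta s n (inputs s n k q (H * a) \<omega>)) / sqrt n - t) / M))"
  have rG: "k * q + H * a \<le> n" if "a \<le> G" for a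
  proof -
    have "H * a \<le> H * (Lp div H)" using that by (simp add: G_def)
    also have "\<dots> \<le> Lp" by (rule times_div_less_eq_dividend)
    finally show ?thesis using kq by (simp add: Lp_def)
  qed
  define U where "U = {\<omega> \<in> Omega s q. \<not> 2 * sqrt q \<le> \<bar>blockW s q \<omega>\<bar>}"
  have finU: "finite U" "U \<subseteq> Omega s q" using finite_Omega by (auto simp: U_def)
  have cardU: "3 / 4 * O' \<le> card U"
  proof -
    have "card {\<omega> \<in> Omega s q. 2 * sqrt q \<le> \<bar>blockW s q \<omega>\<bar>} \<le> q / (2 * sqrt q)\<^sup>2 * O'"
      unfolding O'_def using s q by (intro card_large_blockW) (auto intro: odd_pos)
    also have "q / (2 * sqrt q)\<^sup>2 = 1 / 4" using q by (simp add: power_mult_distrib)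
    finally have b: "card {\<omega> \<in> Omega s q. 2 * sqrt q \<le> \<bar>blockW s q \<omega>\<bar>} \<le> 1 / 4 * O'" .
    have "Omega s q = U \<union> {\<omega> \<in> Omega s q. 2 * sqrt q \<le> \<bar>blockW s q \<omega>\<bar>}" by (auto simp: U_def)
    hence "card (Omega s q) \<le> card U + card {\<omega> \<in> Omega s q. 2 * sqrt q \<le> \<bar>blockW s q \<omega>\<bar>}"
      by (metis (no_types, lifting) card_Un_le)
    thus ?thesis using b unfolding O'_def by linarith
  qed
  have hit: "\<exists>a\<le>G. 1 / 4 \<le> g a \<omega>" if \<omega>: "\<omega> \<in> U" for \<omega>
  proof -
    \<comment> \<open>The excess over \<open>t * sqrt n\<close> at \<open>r = 0\<close>. Padding
      \<open>r\<close> removes \<open>2 * r\<close> of it, and the lower bound on the padding places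
      \<open>y\<close> between 0 and \<open>2 * Lp\<close>, the most that can be removed.\<close>
    define y where "y = k * blockW s q \<omega> + Lp - t * sqrt n"
    have "k * \<bar>blockW s q \<omega>\<bar> \<le> k * (2 * sqrt q)" using \<omega> by (intro mult_left_mono) (auto simp: U_def)
    also have "\<dots> = 2 * sqrt k * sqrt (k * q)" by (simp add: real_sqrt_mult)
    also have "\<dots> \<le> 2 * sqrt k * sqrt n"
    proof -
      have "real k * real q \<le> real n" using kq by (metis of_nat_le_iff of_nat_mult)
      thus ?thesis by (intro mult_left_mono) auto
    qed
    finally have W: "k * \<bar>blockW s q \<omega>\<bar> \<le> 2 * sqrt k * sqrt n" .
    have W': "\<bar>k * blockW s q \<omega>\<bar> \<le> 2 * sqrt k * sqrt n" using W by (simp add: abs_mult)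
    have tn: "0 \<le> t * sqrt n" using t0 by simp
    have y0: "0 \<le> y"
      using W' lower tn unfolding y_def Lp distrib_right of_nat_mult by linarith
    have yL: "y \<le> 2 * real Lp"
      using abs_le_D1[OF W'] lower tn unfolding y_def Lp distrib_right of_nat_mult by argo
    define a where "a = nat \<lfloor>y / (2 * H)\<rfloor>"
    have yH: "0 \<le> y / (2 * H)" using y0 by simp
    have a: "real a \<le> y / (2 * H)" "y / (2 * H) < real a + 1"
      using yH unfolding a_def by (simp_all add: floor_less_iff)
    have ya: "2 * real H * a \<le> y" "y < 2 * real H * a + 2 * H"
      using a H1 by (simp_all add: field_simps)
    have "real (H * a) \<le> Lp" using ya yL by simp
    hence "H * a \<le> Lp" by (simp only: of_nat_le_iff)
    hence aG: "a \<le> G" using H1 by (simp add: G_def less_eq_div_iff_mult_less_eq mult.commute)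
    have "real_of_int (gap_Delta s n (inputs s n k q (H * a) \<omega>)) / sqrt n - t = (y - 2 * real H * a) / sqrt n"
      unfolding gap_Delta_inputs[OF s k rG[OF aG]] y_def Lp using sn by (simp add: field_simps)
    moreover have "\<bar>(y - 2 * real H * a) / sqrt n\<bar> \<le> 1 / K"
    proof -
      have "\<bar>y - 2 * real H * a\<bar> \<le> 2 * H" using ya by simp
      also have "\<dots> \<le> sqrt n / K" using H(1) K by (simp add: field_simps)
      finally show ?thesis using sn K by (simp add: field_simps)
    qed
    ultimately have d: "\<bar>real_of_int (gap_Delta s n (inputs s n k q (H * a) \<omega>)) / sqrt n - t\<bar> \<le> 1 / K" by simp
    have "1 / 4 \<le> g a \<omega>"
      unfolding g_def
    proof (rule fejer_near_0)
      show "real (M * K) * \<bar>(real_of_int (gap_Delta s n (inputs s n k q (H * a) \<omega>)) / sqrt n - t) / M\<bar> \<le> 1"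
        using d M K by (simp add: field_simps)
    qed (use M K in simp)
    thus ?thesis using aG by blast
  qed
  have "1 / 4 * (3 / 4 * O') \<le> (\<Sum>\<omega>\<in>U. 1 / 4)" using cardU by simp
  also have "\<dots> \<le> (\<Sum>\<omega>\<in>U. \<Sum>a\<le>G. g a \<omega>)"
  proof (intro sum_mono)
    fix \<omega> assume "\<omega> \<in> U"
    then obtain a where a: "a \<le> G" "1 / 4 \<le> g a \<omega>" using hit by blast
    have "g a \<omega> \<le> (\<Sum>a\<le>G. g a \<omega>)"
      using a by (intro member_le_sum) (auto simp: g_def fejer_nonneg)
    thus "1 / 4 \<le> (\<Sum>a\<le>G. g a \<omega>)" using a by linarith
  qed
  also have "\<dots> \<le> (\<Sum>\<omega>\<in>Omega s q. \<Sum>a\<le>G. g a \<omega>)"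
    using finU finite_Omega by (intro sum_mono2 sum_nonneg) (auto simp: g_def fejer_nonneg)
  also have "\<dots> = (\<Sum>a\<le>G. \<Sum>\<omega>\<in>Omega s q. g a \<omega>)" by (rule sum.swap)
  finally have total: "3 / 16 * O' \<le> (\<Sum>a\<le>G. \<Sum>\<omega>\<in>Omega s q. g a \<omega>)" by simp
  have G: "real G + 1 \<le> 32 * sqrt k * K"
  proof -
    have HL: "real H \<le> Lp"
    proof -
      have "real H \<le> sqrt n / (2 * K)" by (rule H(1))
      also have "\<dots> \<le> sqrt n" using sn K by (simp add: field_simps)
      also have "\<dots> \<le> 2 * sqrt k * sqrt n"
      proof -
        have "1 \<le> sqrt k" using k by simp
        hence "1 \<le> 2 * sqrt k" by linarith
        from mult_right_mono[OF this, of "sqrt n"] show ?thesis by simp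
      qed
      also have "\<dots> \<le> Lp"
      proof -
        have "0 \<le> t * sqrt n" using t0 by simp
        thus ?thesis using lower unfolding Lp distrib_right of_nat_mult by linarith
      qed
      finally show ?thesis .
    qed
    have "G * H \<le> Lp" by (simp add: G_def)
    hence "real G * real H \<le> Lp" by (metis of_nat_le_iff of_nat_mult)
    hence "(real G + 1) * H \<le> 2 * Lp" using HL by (simp add: distrib_right)
    also have "\<dots> \<le> 8 * sqrt k * sqrt n" using upper by (simp add: Lp)
    also have "\<dots> = 32 * sqrt k * K * (sqrt n / (4 * K))" using K by simp
    also have "\<dots> \<le> 32 * sqrt k * K * H" using H4 by (intro mult_left_mono) auto
    finally show ?thesis using H1 by simp
  qed
  \<comment> \<open>Pigeonhole: otherwise the total would be at most 32/200 of \<open>O'\<close>,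
    less than 3/16.\<close>
  have "\<exists>a\<le>G. O' / (200 * sqrt k * K) \<le> (\<Sum>\<omega>\<in>Omega s q. g a \<omega>)"
  proof (rule ccontr)
    assume "\<not> ?thesis"
    hence lt: "(\<Sum>\<omega>\<in>Omega s q. g a \<omega>) < O' / (200 * sqrt k * K)" if "a \<le> G" for a
      using that by (meson not_le)
    have O: "0 < O'" using card_Omega_pos[OF s] by (simp add: O'_def)
    have "3 / 16 * O' < (\<Sum>a\<le>G. O' / (200 * sqrt k * K))"
      using total lt by (intro le_less_trans[OF total] sum_strict_mono) auto
    also have "\<dots> = (real G + 1) * (O' / (200 * sqrt k * K))" by simp
    also have "\<dots> \<le> (32 * sqrt k * K) * (O' / (200 * sqrt k * K))"
      using G O by (intro mult_right_mono) auto
    also have "\<dots> = 32 / 200 * O'" using k K by simp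
    finally show False using O by simp
  qed
  then obtain a where "a \<le> G" "O' / (200 * sqrt k * K) \<le> (\<Sum>\<omega>\<in>Omega s q. g a \<omega>)" by blast
  thus ?thesis unfolding g_def O'_def using rG by blast
qed

text \<open>Odd \<open>s\<close> is forced by the promise: a sum of an even number of signs is never
  1 or -1. The constants depend on \<open>c1\<close> and \<open>c2\<close> only;
  \<open>1 - \<delta>\<close> renders the large constant probability.\<close>

theorem mainTheorem6:
  fixes c1 c2 :: real
  assumes "0 < c1" and "c1 < c2"
  shows "\<exists>\<delta>>0. \<exists>c>0. \<exists>N. \<forall>s n. odd s \<longrightarrow> n \<ge> N \<longrightarrow>
           (\<forall>R C. solves_gap s n c1 c2 (1 - \<delta>) R \<longrightarrow> cost_bound s n c2 R C \<longrightarrow>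
              real C \<ge> c * real s * real n)"
proof -
  define t \<epsilon> where "t = (c1 + c2) / 2" and "\<epsilon> = (c2 - c1) / 2"
  have t: "0 < t" and \<epsilon>: "0 < \<epsilon>" using assms by (simp_all add: t_def \<epsilon>_def)
  \<comment> \<open>1638400 = 4096 * 400 brings \<open>4096 * t / (k * K)\<close> below half of the
    \<open>\<Theta>\<close> defined below, for every \<open>K\<close>.\<close>
  obtain k :: nat where k': "(1638400 * t)\<^sup>2 + 1 \<le> real k" using real_arch_simple by blast
  have k1: "1 \<le> real k" using k' zero_le_power2[of "1638400 * t"] by linarith
  have k0: "k > 0" using k1 by simp
  have kt: "1638400 * t \<le> sqrt k" using k' by (intro real_le_rsqrt) linarith
  have sk: "0 < sqrt k" "1 \<le> sqrt k" "sqrt k * sqrt k = k" using k1 by simp_all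
  \<comment> \<open>The kernel tail is quadratic in \<open>1 / K\<close> and \<open>\<Theta>\<close>
    only linear; 192000 = 48 * 4000 makes the tail at most \<open>\<Theta> / 20\<close>. Likewise
    12000 = 3 * 4000 for \<open>M\<close>.\<close>
  obtain K :: nat where K': "192000 * sqrt k / \<epsilon>\<^sup>2 + 1 \<le> real K" using real_arch_simple by blast
  have "0 \<le> 192000 * sqrt k / \<epsilon>\<^sup>2" by simp
  with K' have K1: "1 \<le> real K" and K2: "192000 * sqrt k / \<epsilon>\<^sup>2 \<le> real K" by linarith+
  have K0: "K > 0" using K1 by simp
  obtain M :: nat where M': "12000 * k * sqrt k * K + 4 * sqrt k + t + 1 \<le> real M"
    using real_arch_simple by blast
  have "0 \<le> 12000 * k * sqrt k * K" by simp
  with M' sk t have M1: "1 \<le> real M" and M2: "12000 * k * sqrt k * K \<le> real M"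
    and M4: "4 * sqrt k \<le> M" and tM: "t \<le> M" by linarith+
  have M0: "M > 0" using M1 by simp
  \<comment> \<open>The relative weight supplied by \<open>exists_padding\<close>. Against it stand
    \<open>\<Theta> / 2\<close> for the discrepancy and six terms of \<open>\<Theta> / 20\<close>:
    kernel tail, large \<open>z\<close>, small rectangles, few free blocks, wrong answers, long
    transcripts. Together they stay below \<open>\<Theta>\<close>.\<close>
  define \<Theta> where "\<Theta> = 1 / (200 * sqrt k * K)"
  have \<Theta>: "\<Theta> > 0" using sk K0 by (simp add: \<Theta>_def)
  have D: "4096 * t / (k * K) \<le> \<Theta> / 2"
  proof -
    have "(1638400 * t) * sqrt k \<le> sqrt k * sqrt k" using kt by (intro mult_right_mono) auto
    hence "1638400 * t * sqrt k \<le> k" using sk by simp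
    thus ?thesis using k0 K0 sk by (simp add: \<Theta>_def field_simps)
  qed
  have E: "48 / (K * \<epsilon>)\<^sup>2 \<le> \<Theta> / 20"
  proof -
    have "192000 * sqrt k \<le> K * \<epsilon>\<^sup>2" using K2 \<epsilon> by (simp add: field_simps)
    hence "192000 * sqrt k * K \<le> K * \<epsilon>\<^sup>2 * K" by (intro mult_right_mono) auto
    also have "\<dots> = (K * \<epsilon>)\<^sup>2" by (simp add: power2_eq_square)
    finally have "48 / (K * \<epsilon>)\<^sup>2 \<le> 48 / (192000 * sqrt k * K)"
      using sk K0 \<epsilon> by (intro divide_left_mono) auto
    also have "\<dots> = \<Theta> / 20" using sk K0 by (simp add: \<Theta>_def)
    finally show ?thesis .
  qed
  have F: "3 * (k / (real M)\<^sup>2) \<le> \<Theta> / 20"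
  proof -
    have "12000 * k * sqrt k * K \<le> real M * 1" using M2 by simp
    also have "\<dots> \<le> (real M)\<^sup>2" unfolding power2_eq_square using M1 by (intro mult_left_mono) auto
    finally have "3 * k / (real M)\<^sup>2 \<le> 3 * k / (12000 * k * sqrt k * K)"
      using sk K0 k0 M0 by (intro divide_left_mono) auto
    also have "\<dots> = \<Theta> / 20" using sk K0 k0 by (simp add: \<Theta>_def)
    finally show ?thesis by simp
  qed
  have "(\<lambda>q::nat. (119 / 128 :: real) ^ q) \<longlonglongrightarrow> 0" by (rule LIMSEQ_power_zero) simp
  hence ev1: "\<forall>\<^sub>F q in sequentially. (119 / 128 :: real) ^ q < \<Theta> / 20"
    using \<Theta> by (intro order_tendstoD) auto
  have "(\<lambda>q::nat. 2 * (2 powr (- 1 / 2048) :: real) ^ q) \<longlonglongrightarrow> 2 * 0"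
    by (intro tendsto_mult tendsto_const LIMSEQ_power_zero) (simp add: powr_less_one)
  moreover have "(2 powr (- 1 / 2048) :: real) ^ q = 2 powr (- (real q / 2048))" for q
    by (simp add: powr_realpow[symmetric] powr_powr)
  ultimately have lim: "(\<lambda>q::nat. 2 * 2 powr (- (real q / 2048)) :: real) \<longlonglongrightarrow> 0"
    by (simp only: mult_zero_right)
  have ev2: "\<forall>\<^sub>F q :: nat in sequentially. 2 * 2 powr (- (real q / 2048)) < \<Theta> / 20"
    by (rule order_tendstoD(2)[OF lim]) (use \<Theta> in simp)
  from ev1 ev2 obtain Q0 where Q0: "\<And>q. q \<ge> Q0 \<Longrightarrow> (119 / 128 :: real) ^ q < \<Theta> / 20"
    "\<And>q. q \<ge> Q0 \<Longrightarrow> 2 * 2 powr (- (real q / 2048)) < \<Theta> / 20"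
    using eventually_conj[OF ev1 ev2] unfolding eventually_sequentially by blast
  \<comment> \<open>Wrong answers count twice, hence 40. With \<open>n \<le> 2 * k * q\<close> and
    transcripts cut at about \<open>q / 2048\<close> bits, 81920 = 20 * 2 * 2048.\<close>
  define \<delta> c where "\<delta> = \<Theta> / 40" and "c = \<Theta> / (81920 * k)"
  \<comment> \<open>In this order the terms ensure that the padding takes at most half of
    \<open>n\<close>, that the kernel frequencies stay in the controlled range, that
    \<open>q \<ge> Q0\<close>, and that \<open>n > 0\<close>.\<close>
  define N where "N = 64 * k + (2 * K * k)\<^sup>2 + 2 * k * Q0 + 1"
  have "real C \<ge> c * real s * real n"
    if s: "odd s" and n: "n \<ge> N" and solves: "solves_gap s n c1 c2 (1 - \<delta>) R"
      and cost: "cost_bound s n c2 R C" for s n R C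
  proof (rule ccontr)
    assume "\<not> ?thesis"
    hence C: "real C < c * real s * real n" by simp
    have s0: "s > 0" using s by (rule odd_pos)
    have nk: "64 * k \<le> n" and nKk: "(2 * K * k)\<^sup>2 \<le> n" and nQ: "2 * k * Q0 \<le> n" and n0: "n > 0"
      using n by (simp_all add: N_def)
    have sn: "0 < sqrt n" "sqrt n * sqrt n = n" using n0 by simp_all
    have sn8: "8 * sqrt k \<le> sqrt n"
    proof -
      have "sqrt (64 * real k) \<le> sqrt n" using nk by (intro real_sqrt_le_mono) (metis of_nat_le_iff of_nat_mult of_nat_numeral)
      moreover have "sqrt (64 * real k) = 8 * sqrt k" by (simp add: real_sqrt_mult)
      ultimately show ?thesis by simp
    qed
    have snK: "2 * real K * real k \<le> sqrt n"
    proof (rule real_le_rsqrt)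
      have "real ((2 * K * k)\<^sup>2) \<le> real n" using nKk by (simp only: of_nat_le_iff)
      thus "(2 * real K * real k)\<^sup>2 \<le> real n" by simp
    qed
    define L0 where "L0 = (2 * sqrt k + t) * sqrt n"
    have L0: "L0 \<le> 3 * (sqrt k * sqrt n)"
    proof -
      have "t \<le> sqrt k" using kt t by linarith
      hence "(2 * sqrt k + t) * sqrt n \<le> (3 * sqrt k) * sqrt n" using sn by (intro mult_right_mono) auto
      thus ?thesis by (simp add: L0_def)
    qed
    have kk: "real k \<le> sqrt k * sqrt n"
    proof -
      have "sqrt k \<le> sqrt n" using sn8 sk by linarith
      hence "sqrt k * sqrt k \<le> sqrt k * sqrt n" by (rule mult_left_mono) simp
      thus ?thesis using sk by simp
    qed
    have half: "4 * (sqrt k * sqrt n) \<le> n / 2"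
    proof -
      have "(8 * sqrt k) * sqrt n \<le> sqrt n * sqrt n" by (rule mult_right_mono[OF sn8]) simp
      thus ?thesis using sn by simp
    qed
    \<comment> \<open>As many blocks as leave a padding of at least \<open>L0\<close>, the amount
      that \<open>exists_padding\<close> demands; the actual padding exceeds it by less than
      \<open>k\<close>.\<close>
    define q where "q = nat \<lfloor>(n - L0) / k\<rfloor>"
    have "0 \<le> (n - L0) / k" using L0 half kk k1 by simp
    hence q1: "real q \<le> (n - L0) / k" "(n - L0) / k < real q + 1"
      unfolding q_def by (simp_all add: floor_less_iff)
    have kq: "real k * q \<le> n - L0" "n - L0 < k * q + k"
      using q1 k0 by (simp_all add: field_simps)
    have L0p: "0 \<le> L0" using t sn by (simp add: L0_def)
    have pad1: "(2 * sqrt k + t) * sqrt n \<le> real n - real k * real q" using kq by (simp add: L0_def)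
    have pad2: "real n - real k * real q \<le> 4 * sqrt k * sqrt n" using kq L0 kk by simp
    have pad2': "real n - real (k * q) \<le> 4 * sqrt k * sqrt n" using pad2 by simp
    have kqn: "k * q \<le> n"
    proof -
      have "real (k * q) \<le> real n" using kq L0p by simp
      thus ?thesis by (simp only: of_nat_le_iff)
    qed
    have n2: "real n \<le> 2 * (real k * real q)" using pad2 half by simp
    have qQ: "q \<ge> Q0"
    proof -
      have "real (2 * k * Q0) \<le> real n" using nQ by (simp only: of_nat_le_iff)
      hence "real k * Q0 \<le> real k * q" using n2 by simp
      thus ?thesis using k0 by simp
    qed
    have q0: "q > 0" using n2 n0 by (cases q) auto
    have K2n: "2 * real K \<le> sqrt n"
    proof -
      have "2 * real K * 1 \<le> 2 * real K * real k" using k1 by (intro mult_left_mono) auto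
      thus ?thesis using snK by simp
    qed
    obtain r where r: "k * q + r \<le> n" "card (Omega s q) / (200 * sqrt k * K)
        \<le> (\<Sum>\<omega>\<in>Omega s q. fejer (M * K) ((real_of_int (gap_Delta s n (inputs s n k q r \<omega>)) / sqrt n - t) / M))"
      using exists_padding[OF s k0 q0 M0 K0 less_imp_le[OF t] kqn pad1 pad2 K2n] by blast
    define V where "V = {\<omega> \<in> Omega s q. gap_valid s n c2 (inputs s n k q r \<omega>)}"
    have V: "finite V" "V \<subseteq> Omega s q" using finite_Omega by (auto simp: V_def)
    have "\<exists>P\<in>set_pmf R. card {\<omega> \<in> V. \<not> gap_correct s n c1 (inputs s n k q r \<omega>) (proto_output P (inputs s n k q r \<omega>))}
        \<le> \<delta> * card V"
      using V(1) solves by (intro pmf_exists_few_failures) (auto simp: V_def solves_gap_def)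
    then obtain P where P: "P \<in> set_pmf R"
      "card {\<omega> \<in> V. \<not> gap_correct s n c1 (inputs s n k q r \<omega>) (proto_output P (inputs s n k q r \<omega>))} \<le> \<delta> * card V"
      by blast
    obtain p st where Pp: "P = (p, st)" by (cases P)
    interpret gap_instance s n k q r M K t p st
      using s k0 q0 M0 K0 t r(1) n2 snK by unfold_locales auto
    define O' where "O' = real (card (Omega s q))"
    have O': "0 < O'" using card_Omega_pos[OF s] by (simp add: O'_def)
    have few: "card {\<omega> \<in> Omega s q. valid c2 \<omega> \<and> wrong c1 \<omega>} \<le> \<delta> * O'"
    proof -
      have "{\<omega> \<in> V. \<not> gap_correct s n c1 (inputs s n k q r \<omega>) (proto_output P (inputs s n k q r \<omega>))}
        = {\<omega> \<in> Omega s q. valid c2 \<omega> \<and> wrong c1 \<omega>}"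
        by (auto simp: V_def valid_def wrong_def out_def Pp)
      moreover have "\<delta> * card V \<le> \<delta> * O'"
        unfolding O'_def using V finite_Omega \<Theta> by (intro mult_left_mono) (auto simp: \<delta>_def card_mono)
      ultimately show ?thesis using P(2) by simp
    qed
    \<comment> \<open>Half of the exponent \<open>q / 1024\<close>: then \<open>2 ^ (B + 1)\<close>
      small rectangles still have negligible total weight.\<close>
    define B where "B = q div 2048"
    have B: "real B \<le> q / 2048" "q / 2048 \<le> real B + 1"
    proof -
      have "q = B * 2048 + q mod 2048" unfolding B_def by (rule div_mult_mod_eq[symmetric])
      moreover have "q mod 2048 < 2048" by (rule mod_less_divisor) simp
      ultimately have b: "B * 2048 \<le> q" "q \<le> B * 2048 + 2048" by linarith+
      show "real B \<le> q / 2048" using b(1) by linarith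
      show "q / 2048 \<le> real B + 1" using b(2) by linarith
    qed
    have cost': "proto_cost (p, st) (inputs s n k q r \<omega>) \<le> C" if "\<omega> \<in> Omega s q" "valid c2 \<omega>" for \<omega>
      using that cost P(1) by (auto simp: cost_bound_def valid_def Pp)
    obtain i where i: "i < s"
      and quiet: "real s * (B + 1) * card {\<omega> \<in> Omega s q. valid c2 \<omega> \<and> B < length (heard i \<omega>)}
        \<le> real C * card (Omega s q)"
      using exists_quiet_player[of c2 C B] cost' by blast
    define Lc where "Lc = real (card {\<omega> \<in> Omega s q. valid c2 \<omega> \<and> B < length (heard i \<omega>)})"
    have long: "Lc \<le> \<Theta> / 20 * O'"
    proof -
      have "real s * (q / 2048) * Lc \<le> real s * (B + 1) * Lc"
        using B(2) by (intro mult_right_mono mult_left_mono) (auto simp: Lc_def)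
      also have "\<dots> \<le> C * O'" using quiet by (simp add: Lc_def O'_def)
      also have "\<dots> \<le> (c * real s * real n) * O'" using C O' by (intro mult_right_mono) auto
      also have "\<dots> \<le> (c * real s * (2 * (real k * real q))) * O'"
        using n2 O' \<Theta> by (intro mult_right_mono mult_left_mono) (auto simp: c_def)
      also have "\<dots> = real s * (q / 2048) * (\<Theta> / 20 * O')" using k0 by (simp add: c_def)
      finally show ?thesis using s0 q0 by simp
    qed
    have pw: "2 ^ (B + 1) * 2 powr (- (q / 1024)) < \<Theta> / 20"
    proof -
      have "(2::real) ^ (B + 1) = 2 powr (real B + 1)"
        using powr_realpow[of 2 "B + 1"] by (simp add: add.commute)
      hence "(2::real) ^ (B + 1) * 2 powr (- (q / 1024)) = 2 powr (real B + 1 - q / 1024)"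
        by (simp add: powr_add[symmetric])
      also have "\<dots> \<le> 2 powr (1 - q / 2048)" using B(1) by (intro powr_mono) auto
      also have "\<dots> = 2 * 2 powr (- (real q / 2048))" by (simp add: powr_diff powr_minus_divide)
      also have "\<dots> < \<Theta> / 20" by (rule Q0(2)[OF qQ])
      finally show ?thesis .
    qed
    define S where "S = 4096 * t / (k * K) + 2 ^ (B + 1) * 2 powr (- (q / 1024)) + (119 / 128) ^ q
        + 48 / (K * ((c2 - c1) / 2))\<^sup>2 + 3 * (k / (real M)\<^sup>2)"
    have S: "S < \<Theta> / 2 + 4 * (\<Theta> / 20)"
      using D E F pw Q0(1)[OF qQ] unfolding S_def \<epsilon>_def by linarith
    have "O' * \<Theta> \<le> (\<Sum>\<omega>\<in>Omega s q. gplus \<omega>)"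
      using r(2) by (simp add: gplus_def z_def O'_def \<Theta>_def)
    also have "\<dots> \<le> O' * S + 2 * card {\<omega> \<in> Omega s q. valid c2 \<omega> \<and> wrong c1 \<omega>} + Lc"
      using sum_gplus_le[OF i assms t_def tM M4 pad2', of B] unfolding S_def O'_def Lc_def by simp
    also have "\<dots> \<le> O' * S + 2 * (\<delta> * O') + \<Theta> / 20 * O'"
      using few long by linarith
    also have "\<dots> = O' * (S + 2 * (\<Theta> / 20))" by (simp add: \<delta>_def algebra_simps)
    also have "\<dots> < O' * \<Theta>" using O' S \<Theta> by (intro mult_strict_left_mono) auto
    finally show False by simp
  qed
  moreover have "\<delta> > 0" "c > 0" using \<Theta> k0 by (simp_all add: \<delta>_def c_def)
  ultimately show ?thesis by blast
qed

end
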